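(* Assume the $L$-functions ratios conjecture for real quadratic Dirichlet characters of Conrey–Snaith (Conjecture 2.6 of J. B. Conrey and N. C. Snaith, "Applications of the L-functions ratios conjectures"). Let $2<T<X$ with $X\notin\mathbb{Z}$, let $1<D_1<D$, let $\varepsilon$ satisfy $\frac{1}{\log X}<\varepsilon<\frac14$, and suppose $T\ll X^{1-\varepsilon}$ and $T\ll D_1^{1-\varepsilon}$. Let $\mathcal{F}_\chi=\{d: D_1<d<D,\ d\text{ a fundamental discriminant}\}$. Then \begin{align*} \frac{1}{\#\mathcal{F}_\chi}\sum_{d\in\mathcal{F}_\chi}\sum_{\substack{p^k<X\\ k\text{ odd}}}\chi_d(p)\log p &=\frac{X^{1/2}}{2\pi i}\int_{\frac12+\varepsilon-iT}^{\frac12+\varepsilon+iT}\frac{\pi^2}{6}\frac{\Gamma(\frac{1-s}{2})}{\Gamma(\frac s2)}\frac{\zeta(2-2s)}{\zeta(3-2s)}\frac{1}{\#\mathcal{F}_\chi}\sum_{d\in\mathcal{F}_\chi}\Big(\frac{\pi X}{d}\Big)^{s-\frac12}\frac{ds}{s}\\ &\quad+\sum_{\substack{p^k<X\\ k\text{ even}}}\frac{\#\{d\in\mathcal{F}_\chi:p\mid d\}}{\#\mathcal{F}_\chi}\log p+O\Big(X^{\frac12+\varepsilon}T^\varepsilon\mathcal{R}(D)\#\mathcal{F}_\chi^{-1}+X^{1+\varepsilon}T^{-1+\varepsilon}D^\varepsilon\Big), \end{align*} where $p$ ranges over primes and $k$ over positive integers.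
   Context: $\chi_d=(\frac{d}{\cdot})$ is the Kronecker symbol; for a fundamental discriminant $d>1$ it is a real even primitive Dirichlet character modulo $d$, with $L$-function $L(s,\chi_d)$. Let $\mathcal{F}(D)=\{d:1<d<D,\ d\text{ a fundamental discriminant}\}$. $\mathcal{R}(D)$ denotes the remainder term in the asymptotic formula implied by the Conrey–Snaith conjecture: for $\frac{1}{\log D}\ll\Re r<\frac34$ and $\Im r\ll D^{1-\varepsilon}$, $$\sum_{d\in\mathcal{F}(D)}\frac{L'(\frac12+r,\chi_d)}{L(\frac12+r,\chi_d)}=\sum_{d\in\mathcal{F}(D)}\Big[\frac{\zeta'(1+2r)}{\zeta(1+2r)}+\sum_p\frac{\log p}{(p+1)(p^{1+2r}-1)}-\Big(\frac d\pi\Big)^{-r}\frac{\Gamma(\frac14-\frac r2)}{\Gamma(\frac14+\frac r2)}\zeta(1-2r)\prod_p\Big(1-\frac{1}{(p+1)p^{1-2r}}-\frac{1}{p+1}\Big)\Big(1-\frac1p\Big)^{-1}\Big]+\mathcal{R}(D),$$ and under the conjecture $\mathcal{R}(D)\ll D^{\frac12+\varepsilon}$. *)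

theory Defs
  imports
    "HOL-Complex_Analysis.Complex_Analysis"
    "HOL-Number_Theory.Number_Theory"
    "HOL-Computational_Algebra.Squarefree"
begin

definition fundamental_discriminant :: "int \<Rightarrow> bool" where
  "fundamental_discriminant d \<longleftrightarrow>
     (d mod 4 = 1 \<and> squarefree d) \<or>
     (\<exists>m. d = 4 * m \<and> (m mod 4 = 2 \<or> m mod 4 = 3) \<and> squarefree m)"

definition kronecker_prime :: "int \<Rightarrow> nat \<Rightarrow> int" where
  "kronecker_prime d p =
     (if p = 2 then (if even d then 0 else if d mod 8 = 1 \<or> d mod 8 = 7 then 1 else -1)
      else Legendre d (int p))"

definition kronecker :: "int \<Rightarrow> nat \<Rightarrow> int" where
  "kronecker d n =
     (if n = 0 then (if \<bar>d\<bar> = 1 then 1 else 0)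
      else (\<Prod>p\<in>prime_factors n. kronecker_prime d p ^ multiplicity p n))"

definition discs_between :: "real \<Rightarrow> real \<Rightarrow> int set" where
  "discs_between a b = {d. a < real_of_int d \<and> real_of_int d < b \<and> fundamental_discriminant d}"

text \<open>
  The Riemann zeta function, as the analytic continuation of its Dirichlet series to the plane
  without 1. The value at 1 is unspecified.
\<close>

definition zeta :: "complex \<Rightarrow> complex" where
  "zeta = (SOME f. f holomorphic_on (- {1}) \<and>
             (\<forall>s. Re s > 1 \<longrightarrow> f s = (\<Sum>n. 1 / of_nat (Suc n) powr s)))"

text \<open>
  For a fundamental discriminant \<open>d > 1\<close> the character is non-principal, so its Dirichlet series,
  summed in the natural order, converges for \<open>Re s > 0\<close>; below, L-values and their derivatives
  are only taken at points with \<open>Re s > 1/2\<close>.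
\<close>

definition L_kronecker :: "int \<Rightarrow> complex \<Rightarrow> complex" where
  "L_kronecker d s = (\<Sum>n. of_int (kronecker d (Suc n)) / of_nat (Suc n) powr s)"

text \<open>
  The Euler product occurring in the dual term of the ratios formula. It converges only for
  \<open>Re r < 1/2\<close>. There its factor at \<open>p\<close> equals
  \<open>(1 - p powr (2r - 2)) / (1 - p powr (-2))\<close>, so that the product is
  \<open>\<zeta>(2) / \<zeta>(2 - 2r)\<close>; further to the right it stands for this meromorphic continuation.
\<close>

definition dual_euler_product :: "complex \<Rightarrow> complex" where
  "dual_euler_product r =
     (if Re r < 1/2 then
        prodinf (\<lambda>p::nat. if prime p then
            (1 - 1 / ((of_nat p + 1) * of_nat p powr (1 - 2 * r)) - 1 / (of_nat p + 1))
              * inverse (1 - 1 / of_nat p)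
          else 1)
      else zeta 2 / zeta (2 - 2 * r))"

definition ratios_main_term :: "int \<Rightarrow> complex \<Rightarrow> complex" where
  "ratios_main_term d r =
     deriv zeta (1 + 2 * r) / zeta (1 + 2 * r)
     + (\<Sum>\<^sub>\<infinity>p\<in>{p::nat. prime p}.
          of_real (ln (real p)) / ((of_nat p + 1) * (of_nat p powr (1 + 2 * r) - 1)))
     - of_real (real_of_int d / pi) powr (- r) * (Gamma (1/4 - r/2) / Gamma (1/4 + r/2))
         * zeta (1 - 2 * r) * dual_euler_product r"

definition ratios_remainder :: "real \<Rightarrow> complex \<Rightarrow> complex" where
  "ratios_remainder D r =
     (\<Sum>d\<in>discs_between 1 D. deriv (L_kronecker d) (1/2 + r) / L_kronecker d (1/2 + r))
     - (\<Sum>d\<in>discs_between 1 D. ratios_main_term d r)"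

text \<open>
  The range \<open>1/log D \<lless> Re r < 3/4\<close>, \<open>Im r \<lless> D powr (1 - \<epsilon>)\<close> with its implied constants
  \<open>c\<close>, \<open>K\<close> made explicit. At \<open>Re r = 3/4\<close> the dual term has poles, coming from the zeros of
  \<open>\<zeta>(2 - 2r)\<close>, so uniformity can only be asked for on \<open>Re r \<le> 3/4 - \<eta>\<close>, for every fixed
  \<open>\<eta> > 0\<close>. The point \<open>r = 1/2\<close> is a removable singularity of the dual term, where the pole of
  the Gamma factor meets the pole of \<open>\<zeta>(2 - 2r)\<close>; it is left out since \<^const>\<open>Gamma\<close> is 0 at its
  poles.
\<close>

definition ratios_range :: "real \<Rightarrow> real \<Rightarrow> real \<Rightarrow> real \<Rightarrow> real \<Rightarrow> complex set" where
  "ratios_range c K \<eta> \<epsilon> D =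
     {r. c / ln D \<le> Re r \<and> Re r \<le> 3/4 - \<eta> \<and> \<bar>Im r\<bar> \<le> K * D powr (1 - \<epsilon>) \<and> r \<noteq> 1/2}"

text \<open>
  The Conrey--Snaith ratios conjecture for the family of real quadratic characters, in the form of
  the asymptotic formula it yields for logarithmic derivatives.
\<close>

definition ratios_conjecture :: bool where
  "ratios_conjecture \<longleftrightarrow>
     (\<forall>c>0. \<forall>K>0. \<forall>\<eta>>0. \<forall>\<epsilon>. 0 < \<epsilon> \<and> \<epsilon> < 1 \<longrightarrow> (\<forall>\<delta>>0. \<exists>B. \<forall>D>1.
        \<forall>r\<in>ratios_range c K \<eta> \<epsilon> D. norm (ratios_remainder D r) \<le> B * D powr (1/2 + \<delta>)))"

text \<open>
  The remainder as a function of \<open>D\<close> alone, uniform in \<open>r\<close>. The sum over \<open>D\<^sub>1 < d < D\<close> is a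
  difference of two sums starting at 1, so the remainder at \<open>D\<^sub>1\<close> enters as well; the supremum
  over all \<open>D' \<le> D\<close> makes the bound nondecreasing in \<open>D\<close>. The element 0 only serves to give the
  value 0 when no \<open>D'\<close>, \<open>r\<close> are admissible. Under the conjecture the set is bounded.
\<close>

definition ratios_error :: "real \<Rightarrow> real \<Rightarrow> real \<Rightarrow> real \<Rightarrow> real \<Rightarrow> real" where
  "ratios_error c K \<eta> \<epsilon> D =
     Sup (insert 0 {norm (ratios_remainder D' r) | D' r.
                      1 < D' \<and> D' \<le> D \<and> r \<in> ratios_range c K \<eta> \<epsilon> D'})"

end

(*
The ratios formula forces L(s, chi_d) to have no zeros in Re s > 1/2: after multiplication by z - s and
z -> s, a zero contributes a positive integer for each d, while the only term that could cancel it is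
proportional to d powr (1/2 - s) and tends to 0 with growing d. A Borel-Caratheodory argument turns this
into L'/L(s, chi_d) << log(d (|t| + 2)) on Re s >= 1/2 + eps.

The generating series of the odd prime powers is zeta'/zeta(2s) + sum_{p | d} log p / (p^(2s) - 1) - L'/L(s).
Apply the truncated Perron formula on Re s = 1 + eps and move the line of integration to 1/2 + eps, where
the ratios formula may be inserted for the average over d. The terms zeta'/zeta(2s) cancel, the dual term
is exactly the integral in the theorem, and what remains is
sum_p log p / (p^(2s) - 1) (#{d : p | d} / #F - 1 / (p + 1)), which continues to Re s > 0 and is negligible
on Re s = eps/2. The sum over even powers in the theorem is itself O(log X log D), hence absorbed by the
error term. If D_1 is bounded, so that Re r = eps violates Re r >= c / log D_1, then T is bounded and all
terms are estimated trivially.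
*)
theory Submission
  imports Defs "HOL-Real_Asymp.Real_Asymp"
begin

section \<open>Dirichlet series and Euler products\<close>


text \<open>Both functions have to be built from their definitions. \<open>zeta\<close> is a
  \<open>SOME\<close>, so nothing is known about it until a continuation is exhibited, and one is
  needed because the dual term evaluates zeta at 2 - 2 s, left of 1. \<open>kronecker\<close> is a
  product over the prime factors of n; its periodicity, on which convergence of the L-series for Re
  s > 0 rests, comes only out of quadratic reciprocity. The ratios formula controls an average over
  d, yet the shift of the contour needs a bound for each single L'/L. On the horizontal sides the
  averaged remainder would carry the weight X powr (1 + \<epsilon>) / T, and for a short family its
  quotient by #F is not known to be O(D powr \<epsilon>). This is why nonvanishing is proved for
  every d, small ones included, before any line is moved. No growth of zeta or Gamma on vertical
  lines enters: the dual term stays on Re s = 1/2 + \<epsilon> as part of the answer, and where it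
  has to be bounded, T is bounded and compactness suffices.\<close>

lemma holomorphic_on_suminf:
  fixes f :: "nat \<Rightarrow> complex \<Rightarrow> complex"
  assumes "open S" and hol: "\<And>n. f n holomorphic_on S"
    and bd: "\<And>x. x \<in> S \<Longrightarrow> \<exists>r M. 0 < r \<and> cball x r \<subseteq> S \<and> summable M \<and> (\<forall>n. \<forall>z\<in>cball x r. norm (f n z) \<le> M n)"
  shows "(\<lambda>z. \<Sum>n. f n z) holomorphic_on S"
proof (rule holomorphic_uniform_sequence[OF \<open>open S\<close>, where f = "\<lambda>N z. \<Sum>n<N. f n z"])
  show "(\<lambda>z. \<Sum>n<N. f n z) holomorphic_on S" for N
    by (intro holomorphic_intros hol)
next
  fix x assume "x \<in> S"
  from bd[OF this] obtain r M where r: "0 < r" "cball x r \<subseteq> S" "summable M"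
      "\<And>n z. z \<in> cball x r \<Longrightarrow> norm (f n z) \<le> M n" by blast
  have "uniform_limit (cball x r) (\<lambda>N z. \<Sum>n<N. f n z) (\<lambda>z. \<Sum>n. f n z) sequentially"
    by (rule Weierstrass_m_test) (use r in auto)
  with r show "\<exists>d>0. cball x d \<subseteq> S \<and> uniform_limit (cball x d) (\<lambda>N z. \<Sum>n<N. f n z) (\<lambda>z. \<Sum>n. f n z) sequentially"
    by blast
qed

lemma open_Re_gt: "open {s. Re s > a}"
  by (rule open_halfspace_Re_gt)

lemma cball_Re_bound: "z \<in> cball x r \<Longrightarrow> Re z \<ge> Re x - r"
  using abs_Re_le_cmod[of "x - z"] by (simp add: dist_norm)

lemma cball_subset_Re_gt:
  assumes "Re x > a" shows "cball x ((Re x - a) / 2) \<subseteq> {s. Re s > a}"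
  using cball_Re_bound[of _ x "(Re x - a) / 2"] assms by (fastforce simp: field_simps)

lemma powr_neg_summable_on:
  assumes "\<sigma> > (1::real)" shows "(\<lambda>n::nat. real n powr (-\<sigma>)) summable_on A"
proof -
  have "summable (\<lambda>n. real n powr (-\<sigma>))" using assms by (simp add: summable_real_powr_iff)
  hence "(\<lambda>n::nat. real n powr (-\<sigma>)) summable_on UNIV"
    by (intro summable_nonneg_imp_summable_on) auto
  thus ?thesis by (rule summable_on_subset_banach) auto
qed

lemma powr_neg_tail_tendsto:
  assumes "\<sigma> > (1::real)"
  shows "(\<lambda>N. \<Sum>\<^sub>\<infinity>n\<in>{N..}. real n powr (-\<sigma>)) \<longlonglongrightarrow> 0"
proof -
  let ?f = "\<lambda>n::nat. real n powr (-\<sigma>)"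
  have "?f sums (\<Sum>\<^sub>\<infinity>n. ?f n)"
    by (intro has_sum_imp_sums has_sum_infsum powr_neg_summable_on assms)
  hence "(\<lambda>N. (\<Sum>\<^sub>\<infinity>n. ?f n) - (\<Sum>n<N. ?f n)) \<longlonglongrightarrow> (\<Sum>\<^sub>\<infinity>n. ?f n) - (\<Sum>\<^sub>\<infinity>n. ?f n)"
    unfolding sums_def by (intro tendsto_intros)
  moreover have "(\<Sum>\<^sub>\<infinity>n. ?f n) - (\<Sum>n<N. ?f n) = (\<Sum>\<^sub>\<infinity>n\<in>{N..}. ?f n)" for N
  proof -
    have "(\<Sum>\<^sub>\<infinity>n\<in>{..<N} \<union> {N..}. ?f n) = (\<Sum>\<^sub>\<infinity>n\<in>{..<N}. ?f n) + (\<Sum>\<^sub>\<infinity>n\<in>{N..}. ?f n)"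
      by (intro infsum_Un_disjoint powr_neg_summable_on assms) auto
    moreover have "{..<N} \<union> {N..} = UNIV" by auto
    ultimately show ?thesis by simp
  qed
  ultimately show ?thesis by simp
qed

text \<open>One set of facts serves zeta, with the constant 1, and all L(s, chi_d). Multiplicativity
  is asked at positive arguments only, since \<open>kronecker d 0\<close> is fixed by
  convention.\<close>

locale bounded_multiplicative =
  fixes \<psi> :: "nat \<Rightarrow> complex"
  assumes chi_1: "\<psi> (Suc 0) = 1"
    and chi_mult: "m > 0 \<Longrightarrow> n > 0 \<Longrightarrow> \<psi> (m * n) = \<psi> m * \<psi> n"
    and norm_chi: "norm (\<psi> n) \<le> 1"
begin

definition dterm :: "complex \<Rightarrow> nat \<Rightarrow> complex" where
  "dterm s n = \<psi> n * of_nat n powr (-s)"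

text \<open>The unordered sum, because the sieve splits and reindexes the index set;
  \<open>dsum_eq_suminf\<close> returns to the ordered series.\<close>

definition dsum :: "complex \<Rightarrow> complex" where
  "dsum s = (\<Sum>\<^sub>\<infinity>n\<in>{0<..}. dterm s n)"

lemma dterm_1: "dterm s (Suc 0) = 1" by (simp add: dterm_def chi_1)

lemma dterm_mult: "m > 0 \<Longrightarrow> n > 0 \<Longrightarrow> dterm s (m * n) = dterm s m * dterm s n"
  using powr_times_real[of "of_nat m" "of_nat n" "-s"] by (simp add: dterm_def chi_mult)

lemma norm_dterm_le: "norm (dterm s n) \<le> real n powr (- Re s)"
proof -
  have "norm (of_nat n powr (-s)) = real n powr (- Re s)"
    using norm_powr_real_powr[of "of_nat n" "-s"] by simp
  thus ?thesis using mult_right_mono[OF norm_chi[of n], of "real n powr (- Re s)"]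
    by (simp add: dterm_def norm_mult)
qed

lemma dterm_abs_summable:
  assumes "Re s > 1" shows "(\<lambda>n. norm (dterm s n)) summable_on A"
  using powr_neg_summable_on[OF assms] norm_dterm_le
  by (rule summable_on_comparison_test) auto

lemma dterm_summable: "Re s > 1 \<Longrightarrow> dterm s summable_on A"
  using dterm_abs_summable abs_summable_summable by blast

definition coprimes_to :: "nat set \<Rightarrow> nat set" where
  "coprimes_to S = {n. n > 0 \<and> (\<forall>p\<in>S. \<not> p dvd n)}"

text \<open>Sieve of Eratosthenes. For a prime p outside S the multiples of p in
  \<open>coprimes_to S\<close> are p times the elements of that set, so by complete multiplicativity
  their terms sum to \<open>dterm s p\<close> times the whole sum. The factor 1 -
  \<open>dterm s p\<close> deletes them.\<close>

lemma sieve_prod: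
  assumes "Re s > 1" "finite S" "\<And>p. p \<in> S \<Longrightarrow> prime p"
  shows "dsum s * (\<Prod>p\<in>S. 1 - dterm s p) = (\<Sum>\<^sub>\<infinity>n\<in>coprimes_to S. dterm s n)"
  using assms(2,3)
proof (induction S)
  case empty
  have "coprimes_to {} = {0<..}" by (auto simp: coprimes_to_def)
  thus ?case by (simp add: dsum_def)
next
  case (insert p S)
  let ?A = "coprimes_to S"
  have p: "prime p" using insert by auto
  hence p0: "p > 0" using prime_gt_0_nat by blast
  have eq: "{n\<in>?A. p dvd n} = (\<lambda>n. p * n) ` ?A"
  proof (intro equalityI subsetI)
    fix n assume "n \<in> {n\<in>?A. p dvd n}"
    then obtain k where k: "n = p * k" "n \<in> ?A" by auto
    hence "k \<in> ?A" by (auto simp: coprimes_to_def)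
    with k show "n \<in> (\<lambda>n. p * n) ` ?A" by blast
  next
    fix n assume "n \<in> (\<lambda>n. p * n) ` ?A"
    then obtain k where k: "n = p * k" "k \<in> ?A" by auto
    have "\<not> q dvd n" if "q \<in> S" for q
    proof
      assume "q dvd n"
      moreover have "prime q" using insert that by auto
      ultimately have "q dvd p \<or> q dvd k" using k by (simp add: prime_dvd_mult_iff)
      moreover have "\<not> q dvd p" using p \<open>prime q\<close> that insert.hyps primes_dvd_imp_eq by blast
      ultimately show False using k that by (auto simp: coprimes_to_def)
    qed
    thus "n \<in> {n\<in>?A. p dvd n}" using k p0 by (auto simp: coprimes_to_def)
  qed
  have "(\<Sum>\<^sub>\<infinity>n\<in>?A. dterm s n) = (\<Sum>\<^sub>\<infinity>n\<in>coprimes_to (insert p S) \<union> {n\<in>?A. p dvd n}. dterm s n)"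
    by (rule arg_cong[of _ _ "infsum (dterm s)"]) (auto simp: coprimes_to_def)
  also have "\<dots> = (\<Sum>\<^sub>\<infinity>n\<in>coprimes_to (insert p S). dterm s n) + (\<Sum>\<^sub>\<infinity>n\<in>{n\<in>?A. p dvd n}. dterm s n)"
    by (intro infsum_Un_disjoint dterm_summable assms) (auto simp: coprimes_to_def)
  also have "(\<Sum>\<^sub>\<infinity>n\<in>{n\<in>?A. p dvd n}. dterm s n) = (\<Sum>\<^sub>\<infinity>n\<in>?A. dterm s (p * n))"
    unfolding eq using p0 by (subst infsum_reindex) (auto simp: inj_on_def o_def)
  also have "\<dots> = (\<Sum>\<^sub>\<infinity>n\<in>?A. dterm s p * dterm s n)"
    by (intro infsum_cong dterm_mult p0) (auto simp: coprimes_to_def)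
  also have "\<dots> = dterm s p * (\<Sum>\<^sub>\<infinity>n\<in>?A. dterm s n)"
    by (intro infsum_cmult_right dterm_summable assms)
  finally have split: "(\<Sum>\<^sub>\<infinity>n\<in>?A. dterm s n) = (\<Sum>\<^sub>\<infinity>n\<in>coprimes_to (insert p S). dterm s n)
      + dterm s p * (\<Sum>\<^sub>\<infinity>n\<in>?A. dterm s n)" .
  have "b = a * (1 - t)" if "a = b + t * a" for a b t :: complex
  proof -
    have "b = a - t * a" using that by (metis add_diff_cancel_right')
    thus ?thesis by (simp add: algebra_simps)
  qed
  from this[OF split] have "(\<Sum>\<^sub>\<infinity>n\<in>coprimes_to (insert p S). dterm s n)
      = (\<Sum>\<^sub>\<infinity>n\<in>?A. dterm s n) * (1 - dterm s p)" .
  moreover have "dsum s * (\<Prod>p\<in>S. 1 - dterm s p) = (\<Sum>\<^sub>\<infinity>n\<in>?A. dterm s n)"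
    by (rule insert.IH) (use insert.prems in auto)
  moreover have "(\<Prod>q\<in>insert p S. 1 - dterm s q) = (1 - dterm s p) * (\<Prod>q\<in>S. 1 - dterm s q)"
    by (rule prod.insert) (use insert.hyps in auto)
  ultimately show ?case by (metis mult.commute mult.left_commute)
qed

text \<open>Apart from 1, an integer without prime factors below N is at least N, so the sieve
  leaves 1 plus part of a tail. The bound depends on \<sigma> and N alone, which makes the Euler
  product converge uniformly and, with N = 2, gives a lower bound for L on Re s = 2.\<close>

lemma euler_product_error:
  assumes "Re s \<ge> \<sigma>" "\<sigma> > 1"
  shows "norm (dsum s * (\<Prod>p | p < N \<and> prime p. 1 - dterm s p) - 1)
          \<le> (\<Sum>\<^sub>\<infinity>n\<in>{N..}. real n powr (-\<sigma>))"
proof -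
  let ?S = "{p. p < N \<and> prime p}" let ?B = "coprimes_to ?S - {1}"
  have s: "Re s > 1" using assms by simp
  have sub: "?B \<subseteq> {N..}"
  proof
    fix n assume n: "n \<in> ?B"
    hence "n > 1" by (auto simp: coprimes_to_def)
    then obtain p where p: "prime p" "p dvd n" using prime_factor_nat[of n] by auto
    hence "p \<ge> N" using n by (auto simp: coprimes_to_def not_less[symmetric])
    moreover have "p \<le> n" using p \<open>n > 1\<close> by (simp add: dvd_imp_le)
    ultimately show "n \<in> {N..}" by simp
  qed
  have one: "1 \<in> coprimes_to ?S" by (auto simp: coprimes_to_def)
  have "dsum s * (\<Prod>p\<in>?S. 1 - dterm s p) = (\<Sum>\<^sub>\<infinity>n\<in>coprimes_to ?S. dterm s n)"
    by (intro sieve_prod s) auto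
  also have "\<dots> = (\<Sum>\<^sub>\<infinity>n\<in>insert 1 ?B. dterm s n)"
    using one by (simp add: insert_absorb)
  also have "\<dots> = 1 + (\<Sum>\<^sub>\<infinity>n\<in>?B. dterm s n)"
    by (subst infsum_insert) (auto simp: dterm_summable s dterm_1)
  finally have "norm (dsum s * (\<Prod>p\<in>?S. 1 - dterm s p) - 1) = norm (\<Sum>\<^sub>\<infinity>n\<in>?B. dterm s n)" by simp
  also have "\<dots> \<le> (\<Sum>\<^sub>\<infinity>n\<in>?B. real n powr (-\<sigma>))"
  proof (rule norm_infsum_le)
    fix n assume "n \<in> ?B"
    hence "real n \<ge> 1" by (auto simp: coprimes_to_def)
    thus "norm (dterm s n) \<le> real n powr (-\<sigma>)"
      by (intro order_trans[OF norm_dterm_le] powr_mono) (use assms in auto)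
  qed (auto intro!: has_sum_infsum dterm_summable powr_neg_summable_on s assms)
  also have "\<dots> \<le> (\<Sum>\<^sub>\<infinity>n\<in>{N..}. real n powr (-\<sigma>))"
    by (intro infsum_mono2 powr_neg_summable_on assms sub) auto
  finally show ?thesis .
qed

lemma euler_product_tendsto:
  assumes "Re s > 1"
  shows "(\<lambda>N. dsum s * (\<Prod>p | p < N \<and> prime p. 1 - dterm s p)) \<longlonglongrightarrow> 1"
proof (rule Lim_null_comparison[OF always_eventually, THEN LIM_zero_cancel])
  show "\<forall>N. norm (dsum s * (\<Prod>p | p < N \<and> prime p. 1 - dterm s p) - 1) \<le> (\<Sum>\<^sub>\<infinity>n\<in>{N..}. real n powr (- Re s))"
    using euler_product_error[of "Re s" s] assms by simp
qed (rule powr_neg_tail_tendsto[OF assms])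

lemma dsum_nonzero: "Re s > 1 \<Longrightarrow> dsum s \<noteq> 0"
  using euler_product_tendsto[of s] by (auto simp: LIMSEQ_const_iff)

lemma dsum_eq_suminf:
  assumes "Re s > 1" shows "dsum s = (\<Sum>n. dterm s (Suc n))" "summable (\<lambda>n. norm (dterm s (Suc n)))"
proof -
  have "dsum s = (\<Sum>\<^sub>\<infinity>n. dterm s (Suc n))" unfolding dsum_def
    by (intro infsum_reindex_bij_betw[symmetric] bij_betwI[where g = "\<lambda>n. n - 1"]) auto
  moreover have "(\<lambda>n. norm (dterm s (Suc n))) summable_on UNIV"
    using dterm_abs_summable[OF assms, of "Suc ` UNIV"] by (subst (asm) summable_on_reindex) (auto simp: o_def)
  ultimately have 1: "dsum s = (\<Sum>\<^sub>\<infinity>n. dterm s (Suc n))"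
    and 2: "(\<lambda>n. norm (dterm s (Suc n))) summable_on UNIV" by blast+
  have "(\<lambda>n. dterm s (Suc n)) summable_on UNIV" using 2 by (rule abs_summable_summable)
  from has_sum_imp_sums[OF has_sum_infsum[OF this]]
  show "dsum s = (\<Sum>n. dterm s (Suc n))" by (simp add: sums_iff 1)
  from 2 show "summable (\<lambda>n. norm (dterm s (Suc n)))" by (rule summable_on_imp_summable)
qed

lemma dsum_holomorphic: "dsum holomorphic_on {s. Re s > 1}"
proof -
  have "(\<lambda>s. \<Sum>n. dterm s (Suc n)) holomorphic_on {s. Re s > 1}"
  proof (rule holomorphic_on_suminf[OF open_Re_gt])
    show "(\<lambda>s. dterm s (Suc n)) holomorphic_on {s. Re s > 1}" for n
      unfolding dterm_def by (intro holomorphic_intros)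
  next
    fix x assume x: "x \<in> {s. Re s > 1}"
    let ?r = "(Re x - 1) / 2" let ?M = "\<lambda>n. real (Suc n) powr (-(Re x - ?r))"
    have "summable ?M" using x by (subst summable_Suc_iff) (auto simp: summable_real_powr_iff field_simps)
    moreover have "norm (dterm z (Suc n)) \<le> ?M n" if "z \<in> cball x ?r" for z n
      by (rule order_trans[OF norm_dterm_le powr_mono]) (use cball_Re_bound[OF that] in auto)
    ultimately show "\<exists>r M. 0 < r \<and> cball x r \<subseteq> {s. Re s > 1} \<and> summable M
       \<and> (\<forall>n. \<forall>z\<in>cball x r. norm (dterm z (Suc n)) \<le> M n)"
      using x cball_subset_Re_gt[of 1 x] by (intro exI[of _ ?r] exI[of _ ?M]) auto
  qed
  thus ?thesis by (rule holomorphic_transform) (simp add: dsum_eq_suminf)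
qed

lemma one_minus_dterm_nonzero: "Re s > 0 \<Longrightarrow> prime p \<Longrightarrow> 1 - dterm s p \<noteq> 0"
proof
  assume s: "Re s > 0" and p: "prime p" and eq: "1 - dterm s p = 0"
  have "norm (dterm s p) \<le> real p powr (- Re s)" by (rule norm_dterm_le)
  also have "\<dots> < 1" using s prime_gt_1_nat[OF p] by (intro powr_less_one) auto
  finally show False using eq by simp
qed

text \<open>The product of \<open>dsum z\<close> and all 1 - \<open>dterm z p\<close> with p < N
  tends to 1 uniformly, so the logarithmic derivatives of all factors, that of \<open>dsum\<close>
  included, add up to 0.\<close>

lemma logderiv_dsum:
  assumes s: "Re s > 1"
  shows "(\<lambda>p. if prime p then of_real (ln (real p)) * \<psi> p / (of_nat p powr s - \<psi> p) else 0)
           sums (- deriv dsum s / dsum s)"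
proof -
  define \<sigma> where "\<sigma> = (1 + Re s) / 2"
  have \<sigma>: "1 < \<sigma>" "\<sigma> < Re s" using s by (auto simp: \<sigma>_def)
  \<comment> \<open>Index 0 is not a prime and is used to hold \<open>dsum\<close> itself.\<close>
  define f where "f = (\<lambda>k z. if k = 0 then dsum z else if prime k then 1 - dterm z k else 1)"
  let ?A = "{s. Re s > \<sigma>}"
  have prod_eq: "(\<Prod>k<Suc n. f k z) = dsum z * (\<Prod>p | p < Suc n \<and> prime p. 1 - dterm z p)" for n z
  proof -
    have "(\<Prod>k<Suc n. f k z) = f 0 z * (\<Prod>k\<in>{1..<Suc n}. f k z)"
      using prod.atLeast_Suc_lessThan[of 0 "Suc n" "\<lambda>k. f k z"] by (simp add: atLeast0LessThan)
    also have "(\<Prod>k\<in>{1..<Suc n}. f k z) = (\<Prod>p | p < Suc n \<and> prime p. 1 - dterm z p)"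
      by (rule prod.mono_neutral_cong_right) (auto simp: f_def Suc_le_eq prime_gt_0_nat dest: prime_gt_0_nat)
    finally show ?thesis by (simp add: f_def)
  qed
  have lim: "uniform_limit ?A (\<lambda>n z. \<Prod>k<n. f k z) (\<lambda>_. 1) sequentially"
  proof (rule uniform_limitI)
    fix e :: real assume "e > 0"
    from order_tendstoD(2)[OF powr_neg_tail_tendsto[OF \<sigma>(1)] this]
    have "eventually (\<lambda>N. (\<Sum>\<^sub>\<infinity>n\<in>{N..}. real n powr (-\<sigma>)) < e) sequentially" .
    with eventually_gt_at_top[of 0]
    show "\<forall>\<^sub>F n in sequentially. \<forall>z\<in>?A. dist (\<Prod>k<n. f k z) 1 < e"
    proof eventually_elim
      case (elim n)
      then obtain m where "n = Suc m" by (cases n) auto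
      show ?case
      proof
        fix z assume z: "z \<in> ?A"
        have "dist (\<Prod>k<n. f k z) 1 \<le> (\<Sum>\<^sub>\<infinity>k\<in>{n..}. real k powr (-\<sigma>))"
          unfolding dist_norm \<open>n = Suc m\<close> prod_eq by (rule euler_product_error) (use z \<sigma> in auto)
        also have "\<dots> < e" by (rule elim(2))
        finally show "dist (\<Prod>k<n. f k z) 1 < e" .
      qed
    qed
  qed
  have fhol: "f k holomorphic_on ?A" for k
  proof -
    consider "k = 0" | "k > 0" "prime k" | "k > 0" "\<not> prime k" by blast
    thus ?thesis
    proof cases
      case 1
      moreover have "?A \<subseteq> {s. Re s > 1}" using \<sigma> by auto
      ultimately show ?thesis using holomorphic_on_subset[OF dsum_holomorphic] by (simp add: f_def)
    next
      case 2
      hence "f k = (\<lambda>z. 1 - \<psi> k * of_nat k powr (-z))" by (simp add: f_def dterm_def fun_eq_iff)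
      moreover have "(\<lambda>z. 1 - \<psi> k * of_nat k powr (-z)) holomorphic_on ?A"
        using 2 by (intro holomorphic_intros) auto
      ultimately show ?thesis by simp
    next
      case 3
      hence "f k = (\<lambda>z. 1)" by (simp add: f_def fun_eq_iff)
      thus ?thesis by simp
    qed
  qed
  from logderiv_prodinf_complex_uniform_limit[OF lim fhol, of s]
  have sums: "(\<lambda>k. deriv (f k) s / f k s) sums 0"
    using \<sigma> open_Re_gt by simp
  have eq: "deriv (f (Suc k)) s / f (Suc k) s =
      (if prime (Suc k) then of_real (ln (real (Suc k))) * \<psi> (Suc k) / (of_nat (Suc k) powr s - \<psi> (Suc k)) else 0)" for k
  proof (cases "prime (Suc k)")
    case True
    let ?p = "Suc k"
    have "((\<lambda>z. 1 - \<psi> ?p * of_nat ?p powr (-z)) has_field_derivative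
        \<psi> ?p * (of_nat ?p powr (-s) * ln (of_nat ?p))) (at s)"
      by (auto intro!: derivative_eq_intros simp: powr_def)
    moreover have "f ?p = (\<lambda>z. 1 - \<psi> ?p * of_nat ?p powr (-z))"
      using True by (simp add: f_def dterm_def fun_eq_iff)
    ultimately have d: "deriv (f ?p) s = \<psi> ?p * (of_nat ?p powr (-s) * ln (of_nat ?p))"
      using DERIV_imp_deriv by metis
    have l: "ln (of_nat ?p :: complex) = of_real (ln (real ?p))"
      using Ln_of_real[of "real ?p"] by simp
    have nz: "1 - dterm s ?p \<noteq> 0" using one_minus_dterm_nonzero True s by simp
    have pnz: "of_nat ?p powr s \<noteq> (0::complex)" by (simp del: of_nat_Suc)
    define q where "q = (of_nat ?p powr s :: complex)"
    have q: "of_nat ?p powr (-s) = 1 / q" by (simp add: q_def powr_minus divide_simps del: of_nat_Suc)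
    have fp: "f ?p s = 1 - \<psi> ?p / q" using True by (simp add: f_def dterm_def q del: of_nat_Suc)
    have "1 - \<psi> ?p / q \<noteq> 0" using nz by (simp add: dterm_def q del: of_nat_Suc)
    moreover have "q \<noteq> 0" using pnz by (simp add: q_def)
    ultimately have "\<psi> ?p * (1 / q * l) / (1 - \<psi> ?p / q) = l * \<psi> ?p / (q - \<psi> ?p)" for l
      by (simp add: field_simps)
    thus ?thesis using True unfolding d fp q l q_def[symmetric] by simp
  next
    case False
    hence "f (Suc k) = (\<lambda>z. 1)" by (simp add: f_def fun_eq_iff)
    thus ?thesis using False by simp
  qed
  have f0: "deriv (f 0) s / f 0 s = deriv dsum s / dsum s"
    by (simp add: f_def)
  have "(\<lambda>k. deriv (f (Suc k)) s / f (Suc k) s) sums (0 - deriv dsum s / dsum s)"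
    using sums f0 by (subst sums_Suc_iff) simp
  thus ?thesis unfolding eq
    by (subst (asm) sums_Suc_iff) auto
qed

end

section \<open>The Riemann zeta function\<close>


text \<open>The function to be continued; \<open>zeta\<close> itself cannot be used before a
  continuation is known to exist.\<close>

definition zeta_series :: "complex \<Rightarrow> complex" where
  "zeta_series s = (\<Sum>n. 1 / of_nat (Suc n) powr s)"

global_interpretation one_char: bounded_multiplicative "\<lambda>_. 1"
  by unfold_locales auto

lemma zeta_series_eq_dsum: "Re s > 1 \<Longrightarrow> zeta_series s = one_char.dsum s"
  unfolding zeta_series_def
  by (subst one_char.dsum_eq_suminf) (auto simp: one_char.dterm_def powr_minus_divide)

lemma zeta_series_sums:
  assumes "Re s > 1" shows "(\<lambda>n. of_nat (Suc n) powr (-s)) sums zeta_series s"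
  using one_char.dsum_eq_suminf[OF assms] summable_norm_cancel summable_sums
  by (fastforce simp: zeta_series_eq_dsum[OF assms] one_char.dterm_def)

lemma zeta_series_holomorphic: "zeta_series holomorphic_on {s. Re s > 1}"
  using one_char.dsum_holomorphic by (rule holomorphic_transform) (simp add: zeta_series_eq_dsum)

text \<open>The i-th derivative of x powr (1 - s) is this coefficient times x powr (1 - s -
  i).\<close>

definition taylor_coeff :: "nat \<Rightarrow> complex \<Rightarrow> complex" where
  "taylor_coeff i s = (\<Prod>k<i. 1 - s - of_nat k)"

text \<open>The error of the Taylor polynomial of degree m of x powr (1 - s) about n + 1, taken at n
  + 2.\<close>

definition taylor_rem :: "nat \<Rightarrow> nat \<Rightarrow> complex \<Rightarrow> complex" where
  "taylor_rem m n s = of_nat (Suc (Suc n)) powr (1 - s)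
     - (\<Sum>i\<le>m. taylor_coeff i s * of_nat (Suc n) powr (1 - s - of_nat i) / fact i)"

lemma taylor_coeff_holomorphic [holomorphic_intros]: "taylor_coeff i holomorphic_on A"
  unfolding taylor_coeff_def by (intro holomorphic_intros)

text \<open>Taylor's theorem on the unit segment from n + 1 to n + 2. The hypothesis on Re s makes
  the exponent in the derivative of order m + 1 negative in real part, so that this derivative is
  largest at the left end.\<close>

lemma norm_taylor_rem_le:
  assumes "Re s > - real m"
  shows "norm (taylor_rem m n s) \<le> norm (taylor_coeff (Suc m) s) * real (Suc n) powr (- Re s - real m)"
proof -
  define N where "N = real (Suc n)"
  have N: "N \<ge> 1" by (simp add: N_def)
  define S where "S = complex_of_real ` {N..N+1}"
  define f where "f = (\<lambda>i x. taylor_coeff i s * x powr (1 - s - of_nat i))"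
  have "norm (f 0 (of_real (N+1)) - (\<Sum>i\<le>m. f i (of_real N) * (of_real (N+1) - of_real N) ^ i / fact i))
      \<le> norm (taylor_coeff (Suc m) s) * N powr (- Re s - real m) * norm (complex_of_real (N+1) - of_real N) ^ Suc m / fact m"
  proof (rule complex_Taylor[of S])
    show "convex S" unfolding S_def
      by (intro convex_linear_image linearI) (auto simp: scaleR_conv_of_real)
  next
    fix i x assume "x \<in> S" "i \<le> m"
    then obtain t where t: "x = of_real t" "t \<ge> N" by (auto simp: S_def)
    hence x: "x \<notin> \<real>\<^sub>\<le>\<^sub>0" using N by (auto simp: complex_nonpos_Reals_iff)
    show "(f i has_field_derivative f (Suc i) x) (at x within S)"
      unfolding f_def using x
      by (auto intro!: derivative_eq_intros simp: taylor_coeff_def algebra_simps)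
  next
    fix x assume "x \<in> S"
    then obtain t where t: "x = of_real t" "t \<ge> N" by (auto simp: S_def)
    have "norm (x powr (1 - s - of_nat (Suc m))) = t powr (- Re s - real m)"
      using t N by (simp add: norm_powr_real_powr)
    also have "\<dots> \<le> N powr (- Re s - real m)"
      using t N assms by (intro powr_mono2') auto
    finally show "norm (f (Suc m) x) \<le> norm (taylor_coeff (Suc m) s) * N powr (- Re s - real m)"
      unfolding f_def norm_mult by (intro mult_left_mono) auto
  next
    show "of_real N \<in> S" "of_real (N+1) \<in> S" unfolding S_def by (intro imageI; simp)+
  qed
  moreover have "f 0 (of_real (N+1)) - (\<Sum>i\<le>m. f i (of_real N) * (of_real (N+1) - of_real N) ^ i / fact i) = taylor_rem m n s"
    by (simp add: f_def N_def taylor_rem_def taylor_coeff_def add_ac)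
  moreover have "norm (taylor_coeff (Suc m) s) * N powr (- Re s - real m) * norm (complex_of_real (N+1) - of_real N) ^ Suc m / fact m
     \<le> norm (taylor_coeff (Suc m) s) * N powr (- Re s - real m) / 1"
    by (simp, intro divide_left_mono[of 1 "fact m", simplified] mult_nonneg_nonneg) (auto simp: fact_ge_1)
  ultimately show ?thesis by (simp add: N_def)
qed

text \<open>At order m + 1 the remainders are O(n powr (- Re s - m - 1)), and the sum of these
  majorants converges exactly for Re s > - m.\<close>

lemma taylor_rem_sum_holomorphic:
  "(\<lambda>s. \<Sum>n. taylor_rem (Suc m) n s) holomorphic_on {s. Re s > - real m}"
proof (rule holomorphic_on_suminf[OF open_Re_gt])
  show "taylor_rem (Suc m) n holomorphic_on {s. Re s > - real m}" for n
    unfolding taylor_rem_def by (intro holomorphic_intros) auto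
next
  fix x assume x: "x \<in> {s. Re s > - real m}"
  let ?r = "(Re x - (- real m)) / 2"
  have "compact (taylor_coeff (Suc (Suc m)) ` cball x ?r)"
    by (intro compact_continuous_image holomorphic_on_imp_continuous_on holomorphic_intros) auto
  hence "bounded (taylor_coeff (Suc (Suc m)) ` cball x ?r)" by (rule compact_imp_bounded)
  then obtain B where B: "\<And>z. z \<in> cball x ?r \<Longrightarrow> norm (taylor_coeff (Suc (Suc m)) z) \<le> B"
    unfolding bounded_iff by blast
  let ?M = "\<lambda>n. B * real (Suc n) powr (- (Re x - ?r) - real (Suc m))"
  have "summable ?M" using x
    by (intro summable_mult, subst summable_Suc_iff) (auto simp: summable_real_powr_iff field_simps)
  moreover have "norm (taylor_rem (Suc m) n z) \<le> ?M n" if z: "z \<in> cball x ?r" for z n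
  proof -
    have "norm (taylor_rem (Suc m) n z) \<le> norm (taylor_coeff (Suc (Suc m)) z) * real (Suc n) powr (- Re z - real (Suc m))"
      using cball_subset_Re_gt[of "- real m" x] x z by (intro norm_taylor_rem_le) auto
    also have "\<dots> \<le> ?M n"
      by (intro mult_mono B z powr_mono order_trans[OF norm_ge_zero B[OF z]])
         (use cball_Re_bound[OF z] in \<open>linarith | simp\<close>)+
    finally show ?thesis .
  qed
  ultimately show "\<exists>r M. 0 < r \<and> cball x r \<subseteq> {s. Re s > - real m} \<and> summable M
       \<and> (\<forall>n. \<forall>z\<in>cball x r. norm (taylor_rem (Suc m) n z) \<le> M n)"
    using x cball_subset_Re_gt[of "- real m" x] by (intro exI[of _ ?r] exI[of _ ?M]) auto
qed

text \<open>Taylor expansion of \<open>(n+1) powr (1-s)\<close> at \<open>n\<close>, summed over \<open>n\<close>, expresses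
  \<open>(s-1) \<zeta>(s)\<close> through \<open>\<zeta>(s+1), \<dots>, \<zeta>(s+m)\<close>: this continues \<open>\<zeta>\<close> one unit to the left.\<close>

lemma zeta_series_recurrence:
  assumes "Re s > 1"
  shows "(s - 1) * zeta_series s = 1 + (\<Sum>n. taylor_rem (Suc m) n s)
    - (\<Sum>j=1..m. taylor_coeff j s / fact (Suc j) * ((s + of_nat j - 1) * zeta_series (s + of_nat j)))"
proof -
  let ?N = "\<lambda>n. of_nat (Suc n) :: complex"
  let ?t = "\<lambda>i n. taylor_coeff i s * ?N n powr (1 - s - of_nat i) / fact i"
  have lim: "(\<lambda>n. ?N n powr (1 - s)) \<longlonglongrightarrow> 0"
  proof (rule tendsto_norm_zero_cancel)
    have "norm (?N n powr (1 - s)) = real (Suc n) powr (1 - Re s)" for n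
      using norm_powr_real_powr[of "?N n" "1-s"] by simp
    moreover have "(\<lambda>n. real (Suc n) powr (1 - Re s)) \<longlonglongrightarrow> 0"
      using assms by (intro tendsto_neg_powr filterlim_compose[OF filterlim_real_sequentially] filterlim_Suc) auto
    ultimately show "(\<lambda>n. norm (?N n powr (1 - s))) \<longlonglongrightarrow> 0" by simp
  qed
  \<comment> \<open>The telescoping sum starts at (0 + 1) powr (1 - s) = 1; this is the constant 1
    of the recurrence.\<close>
  have tel: "(\<lambda>n. ?N (Suc n) powr (1 - s) - ?N n powr (1 - s)) sums (0 - ?N 0 powr (1 - s))"
    by (rule telescope_sums[OF lim])
  have term_sums: "?t (Suc j) sums (taylor_coeff (Suc j) s / fact (Suc j) * zeta_series (s + of_nat j))" for j
  proof -
    have "(\<lambda>n. taylor_coeff (Suc j) s / fact (Suc j) * ?N n powr (-(s + of_nat j))) sums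
       (taylor_coeff (Suc j) s / fact (Suc j) * zeta_series (s + of_nat j))"
      by (intro sums_mult zeta_series_sums) (use assms in auto)
    thus ?thesis by (simp add: algebra_simps)
  qed
  have "(\<lambda>n. (?N (Suc n) powr (1 - s) - ?N n powr (1 - s)) - (\<Sum>j\<le>m. ?t (Suc j) n)) sums
      (0 - ?N 0 powr (1 - s) - (\<Sum>j\<le>m. taylor_coeff (Suc j) s / fact (Suc j) * zeta_series (s + of_nat j)))"
    by (intro sums_diff tel sums_sum term_sums)
  moreover have "(?N (Suc n) powr (1 - s) - ?N n powr (1 - s)) - (\<Sum>j\<le>m. ?t (Suc j) n) = taylor_rem (Suc m) n s" for n
    unfolding taylor_rem_def by (subst sum.atMost_Suc_shift) (simp add: taylor_coeff_def)
  ultimately have "(\<Sum>n. taylor_rem (Suc m) n s) =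
      0 - ?N 0 powr (1 - s) - (\<Sum>j\<le>m. taylor_coeff (Suc j) s / fact (Suc j) * zeta_series (s + of_nat j))"
    by (simp add: sums_iff)
  also have "(\<Sum>j\<le>m. taylor_coeff (Suc j) s / fact (Suc j) * zeta_series (s + of_nat j)) =
     (1 - s) * zeta_series s + (\<Sum>j=1..m. taylor_coeff (Suc j) s / fact (Suc j) * zeta_series (s + of_nat j))"
    by (simp add: sum.atLeast_Suc_atMost atMost_atLeast0 taylor_coeff_def)
  \<comment> \<open>The last factor of \<open>taylor_coeff (Suc j) s\<close> is 1 - s - j. Up to
    sign it is moved to zeta(s + j), whose pole at s = 1 - j it cancels.\<close>
  also have "(\<Sum>j=1..m. taylor_coeff (Suc j) s / fact (Suc j) * zeta_series (s + of_nat j)) =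
     - (\<Sum>j=1..m. taylor_coeff j s / fact (Suc j) * ((s + of_nat j - 1) * zeta_series (s + of_nat j)))"
    unfolding sum_negf[symmetric]
    by (intro sum.cong refl) (simp add: taylor_coeff_def algebra_simps diff_divide_distrib add_divide_distrib del: fact_Suc)
  finally show ?thesis by (simp add: algebra_simps)
qed

text \<open>The product (s - 1) zeta(s) is continued because it has no pole. The recurrence, which
  calls for it at s + 1, ..., s + m, then stays holomorphic, and the point 1 has to be excepted only
  when dividing at the very end.\<close>

lemma zeta_continuation_strip:
  "\<exists>g. g holomorphic_on {s. Re s > 1 - real m} \<and> (\<forall>s. Re s > 1 \<longrightarrow> g s = (s - 1) * zeta_series s)"
proof (induction m)
  case 0
  show ?case using zeta_series_holomorphic
    by (intro exI[of _ "\<lambda>s. (s - 1) * zeta_series s"]) (auto intro!: holomorphic_intros)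
next
  case (Suc m)
  then obtain g where g: "g holomorphic_on {s. Re s > 1 - real m}"
      "\<And>s. Re s > 1 \<Longrightarrow> g s = (s - 1) * zeta_series s" by blast
  define h where "h = (\<lambda>s. 1 + (\<Sum>n. taylor_rem (Suc m) n s)
    - (\<Sum>j=1..m. taylor_coeff j s / fact (Suc j) * g (s + of_nat j)))"
  have "(\<lambda>s. g (s + of_nat j)) holomorphic_on {s. Re s > - real m}" if "j \<in> {1..m}" for j
    by (rule holomorphic_on_compose_gen[OF _ g(1), unfolded o_def]) (use that in \<open>auto intro!: holomorphic_intros\<close>)
  hence "h holomorphic_on {s. Re s > - real m}"
    unfolding h_def by (intro holomorphic_intros taylor_rem_sum_holomorphic) auto
  moreover have "h s = (s - 1) * zeta_series s" if "Re s > 1" for s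
    unfolding h_def zeta_series_recurrence[OF that, of m]
    by (intro arg_cong2[of _ _ _ _ "(-)"] refl sum.cong) (subst g(2), use that in auto)
  ultimately show ?case by (intro exI[of _ h]) auto
qed

lemma zeta_continuation_exists:
  "\<exists>f. f holomorphic_on (- {1}) \<and> (\<forall>s. Re s > 1 \<longrightarrow> f s = (\<Sum>n. 1 / of_nat (Suc n) powr s))"
proof -
  obtain g where g: "\<And>m. g m holomorphic_on {s. Re s > 1 - real m}"
     "\<And>m s. Re s > 1 \<Longrightarrow> g m s = (s - 1) * zeta_series s"
    using zeta_continuation_strip by metis
  have agree: "g m s = g m' s" if "Re s > 1 - real m" "m \<le> m'" for m m' s
  proof (rule analytic_continuation_open[of "{s. Re s > 1}" "{s. Re s > 1 - real m}" "g m" "g m'"])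
    show "{s. Re s > 1} \<noteq> {}" by (auto intro!: exI[of _ 2])
    show "connected {s. Re s > 1 - real m}" by (intro convex_connected convex_halfspace_Re_gt)
    show "g m' holomorphic_on {s. Re s > 1 - real m}"
      by (rule holomorphic_on_subset[OF g(1)]) (use that in auto)
  qed (use that g open_Re_gt in auto)
  \<comment> \<open>The functions on the strips agree, so any m with Re s > 1 - m may serve at s;
    this is one.\<close>
  define G where "G = (\<lambda>s. g (nat \<lceil>2 - Re s\<rceil>) s)"
  have Geq: "G s = g m s" if "Re s > 1 - real m" for s m
  proof -
    have "Re s > 1 - real (nat \<lceil>2 - Re s\<rceil>)" by linarith
    thus ?thesis using agree[of m s "nat \<lceil>2 - Re s\<rceil>"] agree[of "nat \<lceil>2 - Re s\<rceil>" s m] that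
      unfolding G_def by (cases "m \<le> nat \<lceil>2 - Re s\<rceil>") auto
  qed
  have "G holomorphic_on UNIV"
  proof -
    have "G field_differentiable at s" for s
    proof -
      define m where "m = nat \<lceil>2 - Re s\<rceil>"
      have s: "Re s > 1 - real m" unfolding m_def by linarith
      have "G holomorphic_on {s. Re s > 1 - real m}"
        by (rule holomorphic_transform[OF g(1)[of m]]) (simp add: Geq)
      thus ?thesis using s open_Re_gt holomorphic_on_imp_differentiable_at by blast
    qed
    thus ?thesis by (simp add: holomorphic_on_def)
  qed
  hence "(\<lambda>s. G s / (s - 1)) holomorphic_on (- {1})"
    by (intro holomorphic_intros) (auto intro: holomorphic_on_subset)
  moreover have "G s / (s - 1) = (\<Sum>n. 1 / of_nat (Suc n) powr s)" if "Re s > 1" for s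
    using Geq[of 0 s] g(2)[OF that, of 0] that by (auto simp: zeta_series_def)
  ultimately show ?thesis by blast
qed

section \<open>zeta to the right of Re s = 1 and the dual Euler product\<close>

lemma zeta_holomorphic: "zeta holomorphic_on (- {1})"
  and zeta_eq_series: "Re s > 1 \<Longrightarrow> zeta s = zeta_series s"
  using someI_ex[OF zeta_continuation_exists] by (auto simp: zeta_def zeta_series_def)

lemma zeta_holomorphic_on [holomorphic_intros]: "1 \<notin> A \<Longrightarrow> zeta holomorphic_on A"
  by (rule holomorphic_on_subset[OF zeta_holomorphic]) auto

lemma zeta_eq_dsum: "Re s > 1 \<Longrightarrow> zeta s = one_char.dsum s"
  by (simp add: zeta_eq_series zeta_series_eq_dsum)

lemma zeta_nonzero: "Re s > 1 \<Longrightarrow> zeta s \<noteq> 0"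
  by (simp add: zeta_eq_dsum one_char.dsum_nonzero)

lemma logderiv_zeta:
  assumes "Re s > 1"
  shows "(\<lambda>p. if prime p then of_real (ln (real p)) / (of_nat p powr s - 1) else 0) sums (- deriv zeta s / zeta s)"
proof -
  have "\<forall>\<^sub>F z in nhds s. zeta z = one_char.dsum z"
    using eventually_nhds_in_open[OF open_Re_gt[of 1], of s] assms
    by (auto elim!: eventually_mono intro!: zeta_eq_dsum)
  hence "deriv zeta s = deriv one_char.dsum s" by (intro deriv_cong_ev refl)
  thus ?thesis using one_char.logderiv_dsum[OF assms] by (simp add: zeta_eq_dsum assms cong: if_cong)
qed

lemma logderiv_zeta_holomorphic: "(\<lambda>z. deriv zeta (2 * z) / zeta (2 * z)) holomorphic_on {z. Re z > 1/2}"
proof -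
  have "zeta holomorphic_on {z. Re z > 1}" by (intro holomorphic_intros) auto
  moreover from this have "deriv zeta holomorphic_on {z. Re z > 1}" by (rule holomorphic_deriv) (rule open_Re_gt)
  ultimately have "(\<lambda>z. deriv zeta (2 * z)) holomorphic_on {z. Re z > 1/2}" "(\<lambda>z. zeta (2 * z)) holomorphic_on {z. Re z > 1/2}"
    by (auto intro!: holomorphic_on_compose_gen[of "\<lambda>z. 2 * z" _ _ "{z. Re z > 1}", unfolded o_def] holomorphic_intros)
  thus ?thesis by (intro holomorphic_on_divide) (auto simp: zeta_nonzero)
qed

lemma zeta_2: "zeta 2 = of_real (pi\<^sup>2 / 6)"
proof -
  have "(\<lambda>n. complex_of_real (1 / (real n + 1)\<^sup>2)) sums of_real (pi\<^sup>2 / 6)"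
    using inverse_squares_sums by (subst sums_of_real_iff) (simp add: add_ac)
  moreover have "complex_of_real (1 / (real n + 1)\<^sup>2) = 1 / of_nat (Suc n) powr 2" for n
    by (simp add: powr_numeral add_ac del: of_nat_Suc) (simp add: add_ac)
  ultimately show ?thesis by (simp add: zeta_eq_series zeta_series_def sums_iff)
qed

text \<open>A partial product is the quotient of the sieve products at 2 - 2 r and at 2, which
  converge because both points lie to the right of 1.\<close>

lemma dual_euler_product_eq:
  assumes "Re r < 1/2" shows "dual_euler_product r = zeta 2 / zeta (2 - 2 * r)"
proof -
  let ?w = "2 - 2 * r"
  let ?f = "\<lambda>p::nat. if prime p then
            (1 - 1 / ((of_nat p + 1) * of_nat p powr (1 - 2 * r)) - 1 / (of_nat p + 1))
              * inverse (1 - 1 / of_nat p)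
          else (1::complex)"
  have w: "Re ?w > 1" using assms by simp
  let ?P = "\<lambda>s N. \<Prod>p | p < N \<and> prime p. 1 - one_char.dterm s p"
  have lim: "?P s \<longlonglongrightarrow> 1 / zeta s" if "Re s > 1" for s
    using tendsto_mult_left[OF one_char.euler_product_tendsto[OF that], of "1 / zeta s"] zeta_nonzero[OF that]
    by (simp add: zeta_eq_dsum[OF that] mult.assoc[symmetric])
  have fac: "?f p = (1 - one_char.dterm ?w p) / (1 - one_char.dterm 2 p)" if p: "prime p" for p
  proof -
    have p1: "p > 1" using prime_gt_1_nat[OF p] .
    define x :: complex where "x = of_nat p"
    have x: "x \<noteq> 0" "x + 1 \<noteq> 0" "x - 1 \<noteq> 0" "x\<^sup>2 \<noteq> 1"
    proof -
      show "x \<noteq> 0" "x - 1 \<noteq> 0" using p1 by (auto simp: x_def)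
      show "x + 1 \<noteq> 0" using of_nat_neq_0[of p, where 'a = complex] by (simp add: x_def add.commute)
      with \<open>x - 1 \<noteq> 0\<close> show "x\<^sup>2 \<noteq> 1" by (simp add: power2_eq_1_iff eq_neg_iff_add_eq_0)
    qed
    define y where "y = x powr (2 * r)"
    have y: "x powr (1 - 2 * r) = x / y" "x powr (- ?w) = y / x\<^sup>2" "x powr (-2) = 1 / x\<^sup>2" "y \<noteq> 0"
      using x by (simp_all add: y_def powr_diff powr_numeral powr_minus field_simps)
    have "(1 - 1 / ((x + 1) * (x / y)) - 1 / (x + 1)) * inverse (1 - 1 / x) = (1 - y / x\<^sup>2) / (1 - 1 / x\<^sup>2)"
      using x y(4) by (simp add: divide_simps) (simp add: algebra_simps power2_eq_square)
    thus ?thesis using p y unfolding one_char.dterm_def x_def[symmetric] by simp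
  qed
  have "(\<Prod>p<Suc n. ?f p) = ?P ?w (Suc n) / ?P 2 (Suc n)" for n
  proof -
    have "(\<Prod>p<Suc n. ?f p) = (\<Prod>p | p < Suc n \<and> prime p. ?f p)"
      by (rule prod.mono_neutral_right) auto
    also have "\<dots> = (\<Prod>p | p < Suc n \<and> prime p. (1 - one_char.dterm ?w p) / (1 - one_char.dterm 2 p))"
      by (intro prod.cong refl fac) auto
    finally show ?thesis by (simp add: prod_dividef)
  qed
  moreover have "(\<lambda>n. ?P ?w (Suc n) / ?P 2 (Suc n)) \<longlonglongrightarrow> (1 / zeta ?w) / (1 / zeta 2)"
    by (intro tendsto_divide LIMSEQ_Suc lim w) (auto simp: zeta_nonzero)
  ultimately have "(\<lambda>n. \<Prod>i\<le>n. ?f i) \<longlonglongrightarrow> zeta 2 / zeta ?w"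
    by (simp add: lessThan_Suc_atMost)
  \<comment> \<open>\<open>raw_has_prod\<close> demands a nonzero limit, whence the nonvanishing of
    zeta at both points.\<close>
  hence "raw_has_prod ?f 0 (zeta 2 / zeta ?w)"
    using zeta_nonzero[OF w] zeta_nonzero[of 2] unfolding raw_has_prod_def add_0_right by simp
  hence "?f has_prod (zeta 2 / zeta ?w)" unfolding has_prod_def by blast
  from has_prod_unique[OF this] show ?thesis using assms by (simp add: dual_euler_product_def)
qed

section \<open>The Kronecker symbol as a periodic character\<close>


lemma Legendre_cong: "[a = b] (mod p) \<Longrightarrow> Legendre a p = Legendre b p"
  by (simp add: Legendre_def QuadRes_def cong_def)

lemma Legendre_values: "Legendre a p \<in> {-1, 0, 1}"
  by (simp add: Legendre_def)

text \<open>For p > 2 the values -1, 0, 1 are distinct modulo p. Thus Euler's criterion, a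
  congruence, determines a Legendre symbol as an integer.\<close>

lemma eq_if_cong_small:
  fixes a b p :: int
  assumes "[a = b] (mod p)" "p > 2" "a \<in> {-1, 0, 1}" "b \<in> {-1, 0, 1}"
  shows "a = b"
proof -
  have "p dvd a - b" using assms(1) by (simp add: cong_iff_dvd_diff)
  moreover have "\<bar>a - b\<bar> < p" using assms by auto
  ultimately show ?thesis using zdvd_imp_le[of p "\<bar>a - b\<bar>"] by force
qed

lemma Legendre_mult:
  assumes "prime (p::nat)" "p > 2"
  shows "Legendre (a * b) p = Legendre a p * Legendre b p"
proof (rule eq_if_cong_small[of _ _ p])
  have "[Legendre (a * b) p = (a * b) ^ ((p - 1) div 2)] (mod p)"
    by (rule euler_criterion[OF assms])
  moreover have "[Legendre a p * Legendre b p = a ^ ((p - 1) div 2) * b ^ ((p - 1) div 2)] (mod p)"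
    by (intro cong_mult euler_criterion assms)
  ultimately show "[Legendre (a * b) p = Legendre a p * Legendre b p] (mod p)"
    by (metis cong_sym cong_trans power_mult_distrib)
  show "Legendre a p * Legendre b p \<in> {-1, 0, 1}" using Legendre_values[of a p] Legendre_values[of b p] by auto
qed (use assms Legendre_values in auto)

lemma Legendre_1: "p > 1 \<Longrightarrow> Legendre 1 p = 1"
  unfolding Legendre_def QuadRes_def by (auto simp: cong_def intro: exI[of _ 1])

text \<open>The Jacobi symbol (-1|n), extended by 0 to even n.\<close>

definition char4 :: "nat \<Rightarrow> int" where
  "char4 n = (if n mod 4 = 1 then 1 else if n mod 4 = 3 then -1 else 0)"

text \<open>The Jacobi symbol (2|n), extended by 0 to even n.\<close>

definition char8 :: "nat \<Rightarrow> int" where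
  "char8 n = (if n mod 8 = 1 \<or> n mod 8 = 7 then 1 else if n mod 8 = 3 \<or> n mod 8 = 5 then -1 else 0)"

lemma mod_4_cases: obtains "(n::nat) mod 4 = 0" | "n mod 4 = 1" | "n mod 4 = 2" | "n mod 4 = 3"
  by linarith

lemma mod_8_cases: obtains "(n::nat) mod 8 = 0" | "n mod 8 = 1" | "n mod 8 = 2" | "n mod 8 = 3"
   | "n mod 8 = 4" | "n mod 8 = 5" | "n mod 8 = 6" | "n mod 8 = 7"
  by linarith

lemma char4_mult: "char4 (m * n) = char4 m * char4 n"
proof -
  have "(m * n) mod 4 = (m mod 4) * (n mod 4) mod 4" by (simp add: mod_mult_eq)
  thus ?thesis unfolding char4_def by (cases m rule: mod_4_cases; cases n rule: mod_4_cases) simp_all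
qed

lemma char8_mult: "char8 (m * n) = char8 m * char8 n"
proof -
  have "(m * n) mod 8 = (m mod 8) * (n mod 8) mod 8" by (simp add: mod_mult_eq)
  thus ?thesis unfolding char8_def by (cases m rule: mod_8_cases; cases n rule: mod_8_cases) simp_all
qed

lemma char4_square: "odd n \<Longrightarrow> char4 n * char4 n = 1"
  unfolding char4_def by (cases n rule: mod_4_cases) (simp_all, presburger+)

lemma char8_square: "odd n \<Longrightarrow> char8 n * char8 n = 1"
  unfolding char8_def by (cases n rule: mod_8_cases) (simp_all, presburger+)

text \<open>Gauss's lemma with multiplier 2. With h = (p - 1) / 2 the doubles 2, 4, ..., 2 h are
  smaller than p and so are their own residues. Those exceeding h come from x > h div 2, and the
  parity of their number h - h div 2 depends only on p mod 8.\<close>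

lemma Legendre_2:
  assumes "prime p" "p > 2" shows "Legendre 2 (int p) = char8 p"
proof -
  interpret GAUSS p 2
    by unfold_locales (use assms in \<open>auto simp: cong_def\<close>)
  define h where "h = (int p - 1) div 2"
  have "odd p" using odd_p .
  hence ph: "int p = 2 * h + 1" unfolding h_def by (metis even_of_nat odd_two_times_div_two_succ dvd_diff_commute even_add odd_one p_eq2)
  have "E = (\<lambda>x. 2 * x) ` {h div 2 <.. h}"
  proof -
    have "C = (\<lambda>x. 2 * x) ` {0 <.. h}"
      unfolding C_def B_def A_def h_def[symmetric] image_image
      by (intro image_cong refl) (use ph in \<open>auto simp: mult.commute\<close>)
    thus ?thesis unfolding E_def h_def[symmetric] by (auto simp: image_iff)
  qed
  hence "card E = card {h div 2 <.. h}" by (simp add: card_image inj_on_def)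
  also have "\<dots> = nat (h - h div 2)" by simp
  finally have L: "Legendre 2 (int p) = (-1) ^ nat (h - h div 2)" using gauss_lemma by simp
  have par: "even (nat (h - h div 2)) \<longleftrightarrow> even (h - h div 2)" if "h \<ge> 0"
    using that by (simp add: even_nat_iff)
  have h0: "h \<ge> 0" using ph assms by simp
  have hp: "int p = 2 * h + 1" by (rule ph)
  from \<open>odd p\<close> show ?thesis
  proof (cases p rule: mod_8_cases)
    case 2
    hence "even (h - h div 2)" using hp by presburger
    thus ?thesis using L par[OF h0] 2 by (simp add: char8_def)
  next
    case 4
    hence "odd (h - h div 2)" using hp by presburger
    thus ?thesis using L par[OF h0] 4 by (simp add: char8_def)
  next
    case 6
    hence "odd (h - h div 2)" using hp by presburger
    thus ?thesis using L par[OF h0] 6 by (simp add: char8_def)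
  next
    case 8
    hence "even (h - h div 2)" using hp by presburger
    thus ?thesis using L par[OF h0] 8 by (simp add: char8_def)
  qed presburger+
qed

text \<open>Squaring maps the nonzero residues to themselves and is not injective, since 1 and -1
  have the same square. On a finite set it therefore misses some value.\<close>

lemma quadratic_nonresidue_exists:
  assumes "prime (q::nat)" "q > 2" obtains c :: nat where "Legendre (int c) (int q) = -1"
proof -
  let ?A = "{1..<int q}" let ?f = "\<lambda>x::int. x\<^sup>2 mod int q"
  have q: "prime (int q)" using assms by simp
  have maps: "?f ` ?A \<subseteq> ?A"
  proof (clarify)
    fix x assume x: "x \<in> ?A"
    have "\<not> int q dvd x" using x zdvd_imp_le[of "int q" x] by auto
    hence "\<not> int q dvd x\<^sup>2" using q prime_dvd_power by blast
    hence "x\<^sup>2 mod int q \<noteq> 0" by (simp add: dvd_eq_mod_eq_0)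
    moreover have "0 \<le> x\<^sup>2 mod int q" "x\<^sup>2 mod int q < int q" using assms by auto
    ultimately show "x\<^sup>2 mod int q \<in> ?A" by auto
  qed
  have "?f 1 = ?f (int q - 1)"
  proof -
    have "(int q - 1)\<^sup>2 = 1 + int q * (int q - 2)" by (simp add: power2_eq_square algebra_simps)
    thus ?thesis by simp
  qed
  moreover have "1 \<in> ?A" "int q - 1 \<in> ?A" "1 \<noteq> int q - 1" using assms by auto
  ultimately have "\<not> inj_on ?f ?A" unfolding inj_on_def by blast
  hence "?f ` ?A \<noteq> ?A" using eq_card_imp_inj_on[of ?A ?f] by fastforce
  then obtain c where c: "c \<in> ?A" "c \<notin> ?f ` ?A" using maps by blast
  have "\<not> QuadRes (int q) c"
  proof
    assume "QuadRes (int q) c"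
    then obtain y where y: "[y\<^sup>2 = c] (mod int q)" by (auto simp: QuadRes_def)
    have cm: "c mod int q = c" using c by auto
    have "(y mod int q)\<^sup>2 mod int q = c" using y cm by (simp add: cong_def power_mod)
    moreover from this have "y mod int q \<noteq> 0" using c by (auto simp: power2_eq_square)
    moreover have "0 \<le> y mod int q" "y mod int q < int q" using assms by auto
    ultimately have "y mod int q \<in> ?A" "?f (y mod int q) = c" by auto
    thus False using c by blast
  qed
  moreover have "\<not> [c = 0] (mod int q)" using c zdvd_imp_le[of "int q" c] by (auto simp: cong_0_iff)
  ultimately have "Legendre c (int q) = -1" by (simp add: Legendre_def)
  moreover have "c = int (nat c)" using c by simp
  ultimately show thesis using that[of "nat c"] by metis
qed

text \<open>Multiplication by c permutes the residues modulo M and changes the sign of every value,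
  so the sum equals its own negative.\<close>

lemma periodic_multiplicative_sum_zero:
  fixes f :: "nat \<Rightarrow> int"
  assumes "M > 0" and per: "\<And>n. f (n mod M) = f n" and mult: "\<And>m n. f (m * n) = f m * f n"
    and c: "coprime c M" "f c = -1"
  shows "(\<Sum>n<M. f n) = 0"
proof -
  let ?g = "\<lambda>n. (c * n) mod M"
  have inj: "inj_on ?g {..<M}"
  proof (rule inj_onI)
    fix x y assume xy: "x \<in> {..<M}" "y \<in> {..<M}" "?g x = ?g y"
    hence "[c * x = c * y] (mod M)" by (simp add: cong_def)
    hence "[x = y] (mod M)" using c by (simp add: cong_mult_lcancel_nat)
    thus "x = y" using xy by (simp add: cong_def)
  qed
  moreover have "?g ` {..<M} \<subseteq> {..<M}" using assms by auto
  ultimately have "bij_betw ?g {..<M} {..<M}"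
    by (simp add: bij_betw_def endo_inj_surj)
  hence "(\<Sum>n<M. f n) = (\<Sum>n<M. f (?g n))"
    by (rule sum.reindex_bij_betw[symmetric])
  also have "\<dots> = - (\<Sum>n<M. f n)" by (simp add: per mult c sum_negf)
  finally show ?thesis by simp
qed

text \<open>The form that chi_d takes after reciprocity: n now stands on top of each symbol, so
  periodicity in n is visible. \<sigma> will be a character modulo 8.\<close>

definition twisted_Legendre :: "(nat \<Rightarrow> int) \<Rightarrow> nat set \<Rightarrow> nat \<Rightarrow> int" where
  "twisted_Legendre \<sigma> Q n = \<sigma> n * (\<Prod>q\<in>Q. Legendre (int n) (int q))"

text \<open>An argument c of value -1 is produced by the Chinese remainder theorem: a nonresidue
  modulo one q0 in Q and 1 modulo 8 and the other primes of Q. If Q is empty, c = 3 does it by the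
  assumption on \<sigma>.\<close>

lemma twisted_Legendre_sum_zero:
  fixes \<sigma> :: "nat \<Rightarrow> int"
  assumes Q: "finite Q" "\<And>q. q \<in> Q \<Longrightarrow> prime q \<and> q > 2"
    and per: "\<And>n. \<sigma> (n mod 8) = \<sigma> n" and mult: "\<And>m n. \<sigma> (m * n) = \<sigma> m * \<sigma> n" and one: "\<sigma> 1 = 1"
    and nontriv: "Q \<noteq> {} \<or> \<sigma> 3 = -1"
  defines "M \<equiv> 8 * \<Prod>Q"
  shows "twisted_Legendre \<sigma> Q (n mod M) = twisted_Legendre \<sigma> Q n"
    and "twisted_Legendre \<sigma> Q (m * n) = twisted_Legendre \<sigma> Q m * twisted_Legendre \<sigma> Q n"
    and "(\<Sum>n<M. twisted_Legendre \<sigma> Q n) = 0"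
proof -
  let ?f = "twisted_Legendre \<sigma> Q"
  have congM: "?f a = ?f b" if "[a = b] (mod M)" for a b
  proof -
    have "[a = b] (mod 8)" using that by (rule cong_dvd_modulus_nat) (simp add: M_def)
    hence "\<sigma> a = \<sigma> b" using per[of a] per[of b] by (simp add: cong_def)
    moreover have "Legendre (int a) (int q) = Legendre (int b) (int q)" if "q \<in> Q" for q
    proof (rule Legendre_cong)
      have "q dvd M" using Q that unfolding M_def by (intro dvd_mult dvd_prodI) auto
      hence "[a = b] (mod q)" using \<open>[a = b] (mod M)\<close> cong_dvd_modulus_nat by blast
      thus "[int a = int b] (mod int q)" by (simp add: cong_int_iff)
    qed
    ultimately show ?thesis by (simp add: twisted_Legendre_def)
  qed
  show per': "?f (n mod M) = ?f n" for n by (rule congM) (simp add: cong_def)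
  show mult': "?f (m * n) = ?f m * ?f n" for m n
    by (simp add: twisted_Legendre_def mult Legendre_mult Q prod.distrib mult_ac cong: prod.cong)
  have M0: "M > 0" using Q prime_gt_0_nat unfolding M_def by (auto intro!: prod_pos)
  obtain c where "coprime c M" "?f c = -1"
  proof (cases "Q = {}")
    case True
    have "coprime 3 (8::nat)" by (simp add: coprime_iff_gcd_eq_1 gcd_nat.simps gcd_non_0_nat)
    thus thesis using that[of 3] True nontriv by (simp add: M_def twisted_Legendre_def)
  next
    case False
    then obtain q0 where q0: "q0 \<in> Q" by auto
    from quadratic_nonresidue_exists[of q0] Q q0 obtain c0 where c0: "Legendre (int c0) (int q0) = -1" by blast
    let ?R = "8 * \<Prod>(Q - {q0})"
    have MR: "M = q0 * ?R" unfolding M_def using Q q0 by (subst prod.remove[of Q q0]) auto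
    have "coprime q0 (\<Prod>(Q - {q0}))"
      by (intro prod_coprime_right) (use Q q0 in \<open>auto intro!: primes_coprime\<close>)
    moreover have "coprime q0 8"
    proof -
      have "coprime q0 (2 ^ 3)" using Q q0 primes_coprime[of q0 2] by (intro coprime_power_right_iff[THEN iffD2]) auto
      thus ?thesis by simp
    qed
    ultimately have cop: "coprime q0 ?R" by simp
    from binary_chinese_remainder_nat[OF cop, of c0 1] obtain c where
      c: "[c = c0] (mod q0)" "[c = 1] (mod ?R)" by blast
    have L0: "Legendre (int c) (int q0) = -1"
      using Legendre_cong[of "int c" "int c0" "int q0"] c(1) c0 by (simp add: cong_int_iff)
    have Lq: "Legendre (int c) (int q) = 1" if "q \<in> Q - {q0}" for q
    proof -
      have "q dvd ?R" using Q that by (intro dvd_mult dvd_prodI) auto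
      hence "[c = 1] (mod q)" using c(2) cong_dvd_modulus_nat by blast
      hence "Legendre (int c) (int q) = Legendre 1 (int q)"
        by (intro Legendre_cong) (metis cong_int_iff of_nat_1)
      thus ?thesis using Q that Legendre_1[of "int q"] by force
    qed
    have "[c = 1] (mod 8)" using c(2) by (rule cong_dvd_modulus_nat) simp
    hence "\<sigma> c = 1" using per[of c] per[of 1] one by (simp add: cong_def)
    hence fc: "?f c = -1" unfolding twisted_Legendre_def using Q q0 L0 Lq
      by (subst prod.remove[of Q q0]) auto
    have "coprime c q0"
    proof -
      have "\<not> q0 dvd c" using L0 by (auto simp: Legendre_def cong_0_iff)
      thus ?thesis using Q q0 prime_imp_coprime[of q0 c] by (simp add: coprime_commute)
    qed
    moreover have "coprime c ?R" using c(2) by (metis cong_imp_coprime coprime_1_left cong_sym)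
    ultimately show thesis using that[of c] fc MR by simp
  qed
  thus "(\<Sum>n<M. ?f n) = 0" by (intro periodic_multiplicative_sum_zero[OF M0 per' mult'])
qed

text \<open>With a product over a multiset, complete multiplicativity becomes the additivity of
  \<open>prime_factorization\<close>.\<close>

lemma kronecker_prime_factorization:
  "n > 0 \<Longrightarrow> kronecker d n = prod_mset (image_mset (kronecker_prime d) (prime_factorization n))"
  unfolding kronecker_def image_prod_mset_multiplicity
  by (auto intro!: prod.cong simp: count_prime_factorization_prime prime_factors_dvd)

lemma kronecker_mult: "m > 0 \<Longrightarrow> n > 0 \<Longrightarrow> kronecker d (m * n) = kronecker d m * kronecker d n"
  by (simp add: kronecker_prime_factorization prime_factorization_mult)

lemma kronecker_1: "kronecker d (Suc 0) = 1"
  by (simp add: kronecker_def)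

lemma kronecker_of_prime: "prime p \<Longrightarrow> kronecker d p = kronecker_prime d p"
  by (simp add: kronecker_prime_factorization prime_factorization_prime prime_gt_0_nat)

lemma kronecker_prime_values: "kronecker_prime d p \<in> {-1, 0, 1}"
  using Legendre_values by (simp add: kronecker_prime_def)

lemma kronecker_eqI:
  assumes "n > 0" "f (Suc 0) = (1::int)" "\<And>m n. f (m * n) = f m * f n"
    "\<And>p. prime p \<Longrightarrow> f p = kronecker_prime d p"
  shows "kronecker d n = f n"
  using assms(1)
proof (induction n rule: prime_divisors_induct)
  case (unit x) thus ?case by (simp add: kronecker_1 assms)
next
  case (factor p x)
  hence "x > 0" "p > 0" by auto
  thus ?case using factor by (simp add: kronecker_mult kronecker_of_prime assms)
qed auto

lemma kronecker_values: "kronecker d n \<in> {-1, 0, 1}"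
proof (cases "n = 0")
  case False
  hence "n > 0" by simp
  thus ?thesis
  proof (induction n rule: prime_divisors_induct)
    case (factor p x)
    hence "x > 0" "p > 0" by auto
    thus ?case using factor kronecker_prime_values[of d p] by (auto simp: kronecker_mult kronecker_of_prime)
  qed (auto simp: kronecker_1)
qed (simp add: kronecker_def)

text \<open>Reciprocity with the sign written as a function of p: \<open>char4 p\<close> is the
  power of -1 with exponent (p - 1) / 2. For p = q both symbols vanish.\<close>

lemma Legendre_swap:
  assumes "prime p" "p > 2" "prime q" "q > 2"
  shows "Legendre (int q) (int p) = Legendre (int p) (int q) * char4 p ^ ((q - 1) div 2)"
proof (cases "p = q")
  case True
  have "Legendre (int p) (int p) = 0" by (simp add: Legendre_def cong_0_iff)
  thus ?thesis using True by simp
next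
  case False
  have "odd p" using assms prime_odd_nat by blast
  have c4: "char4 p = (-1) ^ ((p - 1) div 2)"
  proof (cases p rule: mod_4_cases)
    case 2
    hence "even ((p - 1) div 2)" by presburger
    thus ?thesis using 2 by (simp add: char4_def)
  next
    case 4
    hence "odd ((p - 1) div 2)" by presburger
    thus ?thesis using 4 by (simp add: char4_def)
  qed (use \<open>odd p\<close> in presburger)+
  have rec: "Legendre (int p) (int q) * Legendre (int q) (int p) = char4 p ^ ((q - 1) div 2)"
    unfolding c4 power_mult[symmetric] using Quadratic_Reciprocity[of p q] assms False by simp
  have "Legendre (int p) (int q) \<noteq> 0"
    using assms False primes_dvd_imp_eq[of q p] by (auto simp: Legendre_def cong_0_iff)
  hence "Legendre (int p) (int q) * Legendre (int p) (int q) = 1" using Legendre_values[of p q] by auto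
  thus ?thesis using rec by (metis mult.assoc mult.left_neutral)
qed

text \<open>\<open>\<Prod>q \<equiv> 1 + 2 \<Sum>(q-1)/2\<close> modulo 4, so the sign produced by reciprocity is \<open>char4 p\<close> exactly
  when \<open>\<Prod>q \<equiv> 3\<close>.\<close>

lemma Legendre_swap_prod:
  assumes "prime p" "p > 2" "finite Q" "\<And>q. q \<in> Q \<Longrightarrow> prime q \<and> q > (2::nat)"
  shows "Legendre (int (\<Prod>Q)) (int p) =
    (if \<Prod>Q mod 4 = 1 then 1 else char4 p) * (\<Prod>q\<in>Q. Legendre (int p) (int q)) \<and> odd (\<Prod>Q)"
  using assms(3,4)
proof (induction Q)
  case empty
  thus ?case using Legendre_1[of "int p"] assms by simp
next
  case (insert q Q)
  have q: "prime q" "q > 2" using insert by auto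
  have oq: "odd q" using q prime_odd_nat by blast
  have IH: "Legendre (int (\<Prod>Q)) (int p) = (if \<Prod>Q mod 4 = 1 then 1 else char4 p) * (\<Prod>q\<in>Q. Legendre (int p) (int q))"
     "odd (\<Prod>Q)" using insert by auto
  have pq: "\<Prod>(insert q Q) = q * \<Prod>Q" using insert by simp
  have op: "odd p" using assms prime_odd_nat by blast
  have sq: "char4 p * char4 p = 1" by (rule char4_square[OF op])
  \<comment> \<open>A power of \<open>char4 p\<close> depends only on the parity of the exponent,
    and (q - 1) / 2 is even exactly for q = 1 mod 4; what remains is multiplication of odd residues
    modulo 4.\<close>
  have sgn: "char4 p ^ ((q - 1) div 2) * (if \<Prod>Q mod 4 = 1 then 1 else char4 p) =
     (if (q * \<Prod>Q) mod 4 = 1 then 1 else char4 p)"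
  proof -
    have ev: "char4 p ^ k = (if even k then 1 else char4 p)" for k
      using sq by (induction k) auto
    have m: "(q * \<Prod>Q) mod 4 = (q mod 4) * (\<Prod>Q mod 4) mod 4" by (simp add: mod_mult_eq)
    have par: "even ((q - 1) div 2) \<longleftrightarrow> q mod 4 = 1" using oq by presburger
    show ?thesis unfolding ev par m using oq IH(2) sq
      by (cases q rule: mod_4_cases; cases "\<Prod>Q" rule: mod_4_cases) (simp_all, presburger+)
  qed
  have "Legendre (int (\<Prod>(insert q Q))) (int p) = Legendre (int q) (int p) * Legendre (int (\<Prod>Q)) (int p)"
    unfolding pq of_nat_mult using assms by (simp add: Legendre_mult)
  also have "\<dots> = (char4 p ^ ((q - 1) div 2) * (if \<Prod>Q mod 4 = 1 then 1 else char4 p)) *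
     (Legendre (int p) (int q) * (\<Prod>q\<in>Q. Legendre (int p) (int q)))"
    unfolding IH(1) Legendre_swap[OF assms(1,2) q] by (simp add: mult_ac)
  also have "Legendre (int p) (int q) * (\<Prod>q\<in>Q. Legendre (int p) (int q)) = (\<Prod>q\<in>insert q Q. Legendre (int p) (int q))"
    using insert by simp
  finally show ?case unfolding sgn pq using oq IH(2) by simp
qed

lemma squarefree_prod_prime_factors:
  assumes "squarefree (n::nat)" shows "\<Prod>(prime_factors n) = n"
proof -
  have n0: "n \<noteq> 0" using assms by (metis not_squarefree_0)
  have "n = (\<Prod>p\<in>prime_factors n. p ^ multiplicity p n)" using n0 by (simp add: prime_factorization_nat)
  also have "\<dots> = \<Prod>(prime_factors n)"
  proof (intro prod.cong refl)
    fix p assume "p \<in> prime_factors n"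
    hence "multiplicity p n \<le> 1" "multiplicity p n > 0"
      using assms n0 by (auto simp: squarefree_factorial_semiring'' prime_factors_multiplicity)
    hence "multiplicity p n = 1" by linarith
    thus "p ^ multiplicity p n = p" by simp
  qed
  finally show ?thesis by simp
qed

lemma squarefree_nat_of_int: "squarefree (n::int) \<Longrightarrow> n > 0 \<Longrightarrow> squarefree (nat n)"
proof (rule squarefreeI)
  fix x assume n: "squarefree n" "n > 0" and "x\<^sup>2 dvd nat n"
  hence "int (x\<^sup>2) dvd int (nat n)" by (simp only: int_dvd_int_iff)
  hence "(int x)\<^sup>2 dvd n" using n by simp
  hence "is_unit (int x)" using n(1) squarefreeD by blast
  thus "is_unit x" by simp
qed

lemma char8_prod: "finite Q \<Longrightarrow> char8 (\<Prod>Q) = (\<Prod>q\<in>Q. char8 q)"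
  by (induction Q rule: finite_induct) (auto simp: char8_mult, simp add: char8_def)

lemma odd_squarefree_prime_factors:
  assumes "squarefree (n::nat)" "odd n"
  shows "finite (prime_factors n)" "\<Prod>(prime_factors n) = n"
    "q \<in> prime_factors n \<Longrightarrow> prime q \<and> q > 2"
proof -
  show "\<Prod>(prime_factors n) = n" by (rule squarefree_prod_prime_factors[OF assms(1)])
  assume q: "q \<in> prime_factors n"
  hence "prime q" "q dvd n" by auto
  moreover from this have "q \<noteq> 2" using assms(2) by auto
  ultimately show "prime q \<and> q > 2" using prime_ge_2_nat[of q] by auto
qed simp

text \<open>The odd part of d supplies Q, while the prime 2 and the sign of reciprocity supply
  \<sigma>. It is 1 for d = 1 mod 4, \<open>char4\<close> for d = 4 m with m = 3 mod 4, and
  \<open>char8\<close>, possibly times \<open>char4\<close>, for d = 8 k.\<close>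

lemma kronecker_eq_twisted_Legendre:
  assumes "fundamental_discriminant d" "d > 1"
  obtains \<sigma> Q where "finite Q" "\<And>q. q \<in> Q \<Longrightarrow> prime q \<and> q > 2"
    "\<And>n. \<sigma> (n mod 8) = \<sigma> n" "\<And>m n. \<sigma> (m * n) = \<sigma> m * \<sigma> n" "\<sigma> 1 = 1" "Q \<noteq> {} \<or> \<sigma> 3 = -1"
    "int (\<Prod>Q) \<le> d" "\<And>n. n > 0 \<Longrightarrow> kronecker d n = twisted_Legendre \<sigma> Q n"
proof -
  note found = that
  \<comment> \<open>The common part of the three cases, with D the odd part of d. The factor in
    \<open>odd\<close> that is 1 or \<open>char4 p\<close> is its own inverse and cancels the sign
    from \<open>Legendre_swap_prod\<close>. The prime 2, to which reciprocity does not apply, is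
    matched by \<open>two\<close>, through (2|q) = \<open>char8 q\<close>.\<close>
  have main: thesis if D: "squarefree D" "odd D" "int D \<le> d"
    and sig: "\<And>n. \<sigma> (n mod 8) = \<sigma> n" "\<And>m n. \<sigma> (m * n) = \<sigma> m * \<sigma> n" "\<sigma> 1 = 1" "D \<noteq> 1 \<or> \<sigma> 3 = -1"
    and odd: "\<And>p. prime p \<Longrightarrow> p > 2 \<Longrightarrow> kronecker_prime d p =
        \<sigma> p * (if D mod 4 = 1 then 1 else char4 p) * Legendre (int D) (int p)"
    and two: "kronecker_prime d 2 = \<sigma> 2 * char8 D" for \<sigma> D
  proof (rule found)
    let ?Q = "prime_factors D"
    note Q = odd_squarefree_prime_factors[OF D(1,2)]
    show "finite ?Q" "\<And>q. q \<in> ?Q \<Longrightarrow> prime q \<and> q > 2" "int (\<Prod>?Q) \<le> d"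
      using Q D(3) by auto
    show nontriv: "?Q \<noteq> {} \<or> \<sigma> 3 = -1" using sig(4) Q(2) by (cases "?Q = {}") auto
    have "kronecker_prime d p = twisted_Legendre \<sigma> ?Q p" if p: "prime p" for p
    proof (cases "p = 2")
      case True
      have "char8 D = (\<Prod>q\<in>?Q. char8 q)" using char8_prod[OF Q(1)] Q(2) by simp
      also have "\<dots> = (\<Prod>q\<in>?Q. Legendre 2 (int q))"
        using Q(3) by (intro prod.cong refl) (auto simp: Legendre_2)
      finally show ?thesis using True two by (simp add: twisted_Legendre_def)
    next
      case False
      hence p2: "p > 2" using prime_ge_2_nat[OF p] by simp
      have o: "odd p" using p p2 prime_odd_nat by blast
      have sq: "char4 p * char4 p = 1" by (rule char4_square[OF o])
      have "Legendre (int D) (int p) = (if D mod 4 = 1 then 1 else char4 p) * (\<Prod>q\<in>?Q. Legendre (int p) (int q))"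
        using Legendre_swap_prod[OF p p2 Q(1)] Q(2,3) by auto
      thus ?thesis unfolding odd[OF p p2] twisted_Legendre_def using sq
        by (auto simp: mult.assoc)
    qed
    thus "kronecker d n = twisted_Legendre \<sigma> ?Q n" if "n > 0" for n
      using that Q(3) sig nontriv
      by (intro kronecker_eqI twisted_Legendre_sum_zero(2)[OF Q(1)]) (auto simp: twisted_Legendre_def intro!: prod.neutral Legendre_1 dest: Q(3))
  qed (use sig in auto)
  have sq8: "char8 p * char8 p = 1" if "prime p" "p > 2" for p
    using that prime_odd_nat by (intro char8_square) blast
  have sq4: "char4 p * char4 p = 1" if "prime p" "p > 2" for p
    using that prime_odd_nat by (intro char4_square) blast
  have odd4: "odd n" if "n mod 4 = 1 \<or> n mod 4 = 3" for n :: nat using that by presburger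
  have mod8: "n mod 8 = 1 \<or> n mod 8 = 5" if "n mod 4 = 1" for n :: nat using that by presburger
  from assms(1) consider "d mod 4 = 1" "squarefree d"
    | m where "d = 4 * m" "m mod 4 = 3" "squarefree m"
    | m where "d = 4 * m" "m mod 4 = 2" "squarefree m"
    by (auto simp: fundamental_discriminant_def)
  thus thesis
  proof cases
    case 1
    let ?D = "nat d"
    have dD: "int ?D = d" using assms by simp
    have m4: "?D mod 4 = 1" using nat_mod_distrib[of d 4] 1(1) assms(2) by simp
    show thesis
    proof (rule main[of ?D "\<lambda>_. 1"])
      show "squarefree ?D" using squarefree_nat_of_int 1 assms by simp
      show "odd ?D" using odd4 m4 by blast
      show "?D \<noteq> 1 \<or> (1::int) = -1" using assms by simp
      have "odd d" using 1(1) by presburger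
      moreover have "d mod 8 = int (?D mod 8)" using dD by (metis of_nat_mod of_nat_numeral)
      moreover have "?D mod 8 = 1 \<or> ?D mod 8 = 5" using mod8 m4 by blast
      ultimately show "kronecker_prime d 2 = 1 * char8 ?D"
        by (auto simp: kronecker_prime_def char8_def)
    qed (use dD m4 in \<open>auto simp: kronecker_prime_def\<close>)
  next
    case 2
    let ?D = "nat m"
    have m0: "m > 0" using 2 assms by simp
    hence dD: "int ?D = m" by simp
    have m4: "?D mod 4 = 3" using nat_mod_distrib[of m 4] 2(2) m0 by simp
    show thesis
    proof (rule main[of ?D char4])
      show "squarefree ?D" using squarefree_nat_of_int 2 m0 by simp
      show "odd ?D" using odd4 m4 by blast
      show "?D \<noteq> 1 \<or> char4 3 = -1" by (simp add: char4_def)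
      show "kronecker_prime d 2 = char4 2 * char8 ?D" using 2 by (simp add: kronecker_prime_def char4_def)
      show "char4 (n mod 8) = char4 n" for n by (simp add: char4_def mod_mod_cancel)
      fix p :: nat assume p: "prime p" "p > 2"
      have "Legendre d p = Legendre (2 * (2 * m)) p" using 2 by simp
      also have "\<dots> = (char8 p * char8 p) * Legendre m p" using p by (simp only: Legendre_mult Legendre_2 mult.assoc)
      finally show "kronecker_prime d p = char4 p * (if ?D mod 4 = 1 then 1 else char4 p) * Legendre (int ?D) (int p)"
        using p m4 dD sq4[OF p] sq8[OF p] by (simp add: kronecker_prime_def)
    qed (use 2 m0 char4_mult in \<open>auto simp: char4_def\<close>)
  next
    case 3
    have "even m" using 3(2) by presburger
    then obtain k where k: "m = 2 * k" by (rule evenE)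
    have k0: "k > 0" using 3 k assms by simp
    let ?D = "nat k"
    have dD: "int ?D = k" using k0 by simp
    let ?s = "\<lambda>n. char8 n * (if ?D mod 4 = 1 then 1 else char4 n)"
    have "squarefree k" using 3(3) k squarefree_mono[of k m] by simp
    show thesis
    proof (rule main[of ?D ?s])
      show "squarefree ?D" using squarefree_nat_of_int \<open>squarefree k\<close> k0 by simp
      have "odd k" using 3(2) k by presburger
      thus "odd ?D" using k0 by (simp add: even_nat_iff)
      \<comment> \<open>In this case D = 1 means d = 8, where \<sigma> = \<open>char8\<close> still
        is nontrivial.\<close>
      show "?D \<noteq> 1 \<or> ?s 3 = -1" by (simp add: char8_def)
      show "kronecker_prime d 2 = ?s 2 * char8 ?D" using 3 by (simp add: kronecker_prime_def char8_def)
      have "char4 (n mod 8) = char4 n" "char8 (n mod 8) = char8 n" for n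
        by (simp_all add: char4_def char8_def mod_mod_cancel)
      thus "?s (n mod 8) = ?s n" for n by simp
      show "?s (m * n) = ?s m * ?s n" for m n by (simp add: char4_mult char8_mult)
      fix p :: nat assume p: "prime p" "p > 2"
      have "Legendre d p = Legendre (2 * (2 * (2 * k))) p" using 3 k by simp
      also have "\<dots> = (char8 p * char8 p) * char8 p * Legendre k p" using p by (simp only: Legendre_mult Legendre_2 mult.assoc)
      finally show "kronecker_prime d p = ?s p * (if ?D mod 4 = 1 then 1 else char4 p) * Legendre (int ?D) (int p)"
        using p dD sq4[OF p] sq8[OF p] by (simp add: kronecker_prime_def)
    qed (use 3 k k0 in \<open>auto simp: char4_def char8_def\<close>)
  qed
qed

text \<open>The values over a full period M, eight times the product of Q, sum to 0. A partial sum
  thus reduces to one with fewer than M terms, and M is at most 8 d.\<close>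

lemma kronecker_partial_sums:
  assumes "fundamental_discriminant d" "d > 1"
  shows "\<bar>\<Sum>n<N. kronecker d (Suc n)\<bar> \<le> 8 * d"
proof (rule kronecker_eq_twisted_Legendre[OF assms])
  fix \<sigma> :: "nat \<Rightarrow> int" and Q
  assume Q: "finite Q" "\<And>q. q \<in> Q \<Longrightarrow> prime q \<and> q > 2"
    "\<And>n. \<sigma> (n mod 8) = \<sigma> n" "\<And>m n. \<sigma> (m * n) = \<sigma> m * \<sigma> n" "\<sigma> 1 = 1" "Q \<noteq> {} \<or> \<sigma> 3 = -1"
    "int (\<Prod>Q) \<le> d" "\<And>n. n > 0 \<Longrightarrow> kronecker d n = twisted_Legendre \<sigma> Q n"
  define M where "M = 8 * \<Prod>Q"
  let ?f = "twisted_Legendre \<sigma> Q"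
  have per: "?f (n mod M) = ?f n" and zero: "(\<Sum>n<M. ?f n) = 0" for n
    using twisted_Legendre_sum_zero[OF Q(1-6)] unfolding M_def by auto
  have M0: "M > 0" using Q prime_gt_0_nat unfolding M_def by (auto intro!: prod_pos)
  \<comment> \<open>The identity with \<open>kronecker d\<close> holds at positive arguments only,
    so the value at 0 is read off at M by periodicity.\<close>
  have f0: "?f 0 = kronecker d M" using per[of M] Q(8)[OF M0] by simp
  have le1: "\<bar>?f n\<bar> \<le> 1" for n
  proof (cases "n = 0")
    case True thus ?thesis using f0 kronecker_values[of d M] by auto
  next
    case False thus ?thesis using Q(8)[of n] kronecker_values[of d n] by auto
  qed
  have block: "(\<Sum>n<M. ?f (n + k)) = 0" for k
  proof (induction k)
    case 0 thus ?case using zero by simp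
  next
    case (Suc k)
    have "(\<Sum>n<M. ?f (n + Suc k)) = (\<Sum>n<Suc M. ?f (n + k)) - ?f k"
      by (subst sum.lessThan_Suc_shift) simp
    also have "\<dots> = (\<Sum>n<M. ?f (n + k)) + ?f (M + k) - ?f k" by simp
    also have "?f (M + k) = ?f k" using per[of "M + k"] per[of k] by simp
    finally show ?case using Suc by simp
  qed
  have "\<bar>\<Sum>n<N. ?f (Suc n)\<bar> \<le> int M"
  proof (induction N rule: less_induct)
    case (less N)
    show ?case
    proof (cases "N < M")
      case True
      have "\<bar>\<Sum>n<N. ?f (Suc n)\<bar> \<le> (\<Sum>n<N. 1)" by (rule order_trans[OF sum_abs sum_mono]) (rule le1)
      thus ?thesis using True by simp
    next
      case False
      then obtain K where K: "N = K + M" by (metis le_add_diff_inverse2 not_less)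
      have "(\<Sum>n<N. ?f (Suc n)) = (\<Sum>n<K. ?f (Suc n)) + (\<Sum>n<M. ?f (n + Suc K))"
        unfolding K by (induction M) (simp_all add: add_ac)
      thus ?thesis using block[of "Suc K"] less.IH[of K] K M0 by simp
    qed
  qed
  also have "int M \<le> 8 * d" using Q(7) by (simp add: M_def)
  finally show "\<bar>\<Sum>n<N. kronecker d (Suc n)\<bar> \<le> 8 * d" by (simp add: Q(8))
qed

section \<open>Perron's formula\<close>


lemma closed_segment_same_Re:
  "z \<in> closed_segment (Complex c a) (Complex c b) \<Longrightarrow> Re z = c"
  by (auto simp: closed_segment_def simp flip: distrib_right)

lemma closed_segment_same_Im:
  "z \<in> closed_segment (Complex a c) (Complex b c) \<Longrightarrow> Im z = c"
  by (auto simp: closed_segment_def simp flip: distrib_right)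

lemma norm_of_real_powr: "y > 0 \<Longrightarrow> norm (complex_of_real y powr s) = y powr Re s"
  by (simp add: norm_powr_real_powr)

text \<open>The integrand is 1 / |s| on the line Re s = b.\<close>

lemma has_integral_inverse_sqrt:
  fixes b T :: real assumes "b > 0" "T > 0"
  shows "((\<lambda>t. 1 / sqrt (b\<^sup>2 + t\<^sup>2)) has_integral 2 * arsinh (T / b)) {-T..T}"
proof -
  have "((\<lambda>t. 1 / sqrt (b\<^sup>2 + t\<^sup>2)) has_integral arsinh (T / b) - arsinh (-T / b)) {-T..T}"
  proof (rule fundamental_theorem_of_calculus)
    fix t :: real assume "t \<in> {-T..T}"
    have "sqrt (b\<^sup>2 + t\<^sup>2) = b * sqrt ((t / b)\<^sup>2 + 1)"
    proof -
      have "b\<^sup>2 + t\<^sup>2 = b\<^sup>2 * ((t / b)\<^sup>2 + 1)" using assms by (simp add: field_simps)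
      thus ?thesis using assms by (simp add: real_sqrt_mult)
    qed
    hence "1 / sqrt ((t / b)\<^sup>2 + 1) * (1 / b) = 1 / sqrt (b\<^sup>2 + t\<^sup>2)" by simp
    moreover have "((\<lambda>t. arsinh (t / b)) has_real_derivative 1 / sqrt ((t / b)\<^sup>2 + 1) * (1 / b)) (at t within {-T..T})"
    proof (rule DERIV_chain2[where f = arsinh and g = "\<lambda>t. t / b"])
      show "(arsinh has_real_derivative 1 / sqrt ((t / b)\<^sup>2 + 1)) (at (t / b))"
        by (rule arsinh_real_has_field_derivative)
      show "((\<lambda>t. t / b) has_real_derivative 1 / b) (at t within {-T..T})"
        using assms by (auto intro!: derivative_eq_intros)
    qed
    ultimately show "((\<lambda>t. arsinh (t / b)) has_vector_derivative 1 / sqrt (b\<^sup>2 + t\<^sup>2)) (at t within {-T..T})"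
      by (simp add: has_real_derivative_iff_has_vector_derivative)
  qed (use assms in auto)
  thus ?thesis by simp
qed

lemma norm_vertical_integral_le:
  assumes "b > 0" "T > 0" "y > 0" "B \<ge> 0"
    and f: "continuous_on (closed_segment (Complex b (-T)) (Complex b T)) f"
    and B: "\<And>t. \<bar>t\<bar> \<le> T \<Longrightarrow> norm (f (Complex b t)) \<le> B"
  shows "norm (contour_integral (linepath (Complex b (-T)) (Complex b T)) (\<lambda>s. f s * of_real y powr s / s))
     \<le> B * y powr b * (2 * arsinh (T / b))"
proof -
  let ?g = "\<lambda>s. f s * of_real y powr s / s"
  have eq: "contour_integral (linepath (Complex b (-T)) (Complex b T)) ?g = \<i> * integral {-T..T} (\<lambda>t. ?g (Complex b t))"
    by (rule contour_integral_linepath_same_Re) (use assms in auto)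
  have "continuous_on (closed_segment (Complex b (-T)) (Complex b T)) ?g"
    using assms closed_segment_same_Re[of 0 b "-T" T] by (intro continuous_intros f) auto
  hence "?g contour_integrable_on (linepath (Complex b (-T)) (Complex b T))"
    by (rule contour_integrable_continuous_linepath)
  hence int: "(\<lambda>t. ?g (Complex b t)) integrable_on {-T..T}"
    using has_contour_integral_linepath_same_Re_iff[of "Complex b (-T)" b "Complex b T" "-T" T ?g] assms
    unfolding contour_integrable_on_def integrable_on_def by auto
  have "norm (integral {-T..T} (\<lambda>t. ?g (Complex b t))) \<le> integral {-T..T} (\<lambda>t. B * y powr b * (1 / sqrt (b\<^sup>2 + t\<^sup>2)))"
  proof (rule integral_norm_bound_integral[OF int])
    show "(\<lambda>t. B * y powr b * (1 / sqrt (b\<^sup>2 + t\<^sup>2))) integrable_on {-T..T}"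
      using has_integral_mult_right[OF has_integral_inverse_sqrt[OF assms(1,2)]] by (rule has_integral_integrable)
  next
    fix t assume "t \<in> {-T..T}"
    hence "norm (f (Complex b t)) \<le> B" by (intro B) auto
    thus "norm (?g (Complex b t)) \<le> B * y powr b * (1 / sqrt (b\<^sup>2 + t\<^sup>2))"
      using assms by (simp add: norm_mult norm_divide norm_of_real_powr complex_norm divide_right_mono mult_right_mono)
  qed
  also have "\<dots> = B * y powr b * (2 * arsinh (T / b))"
    using has_integral_mult_right[OF has_integral_inverse_sqrt[OF assms(1,2)]] by (rule integral_unique)
  finally show ?thesis unfolding eq by (simp add: norm_mult)
qed

lemma norm_horizontal_integral_le:
  assumes "a \<le> b" "h \<noteq> 0" "y > 0" "B \<ge> 0"
    and f: "continuous_on (closed_segment (Complex a h) (Complex b h)) f"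
    and B: "\<And>x. a \<le> x \<Longrightarrow> x \<le> b \<Longrightarrow> norm (f (Complex x h)) \<le> B"
    and y: "\<And>x. a \<le> x \<Longrightarrow> x \<le> b \<Longrightarrow> y powr x \<le> Y"
  shows "norm (contour_integral (linepath (Complex a h) (Complex b h)) (\<lambda>s. f s * of_real y powr s / s))
     \<le> B * Y / \<bar>h\<bar> * (b - a)"
proof -
  have "Y \<ge> 0" using y[of a] assms(1) powr_ge_zero[of y a] by linarith
  have "norm (contour_integral (linepath (Complex a h) (Complex b h)) (\<lambda>s. f s * of_real y powr s / s))
     \<le> B * Y / \<bar>h\<bar> * norm (Complex b h - Complex a h)"
  proof (rule contour_integral_bound_linepath)
    show "(\<lambda>s. f s * of_real y powr s / s) contour_integrable_on linepath (Complex a h) (Complex b h)"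
      using assms closed_segment_same_Im[of 0 a h b]
      by (intro contour_integrable_continuous_linepath continuous_intros f) auto
    show "0 \<le> B * Y / \<bar>h\<bar>" using assms \<open>Y \<ge> 0\<close> by simp
    fix s assume "s \<in> closed_segment (Complex a h) (Complex b h)"
    then obtain u where u: "0 \<le> u" "u \<le> 1" "s = Complex ((1 - u) * a + u * b) h"
      by (auto simp: closed_segment_def complex_eq_iff algebra_simps)
    define x where "x = (1 - u) * a + u * b"
    have x: "a \<le> x" "x \<le> b"
      using convex_bound_le[of a b b "1-u" u] convex_bound_le[of "-a" "-a" "-b" "1-u" u] u assms(1) by (auto simp: x_def)
    have s: "s = Complex x h" using u x_def by simp
    have "norm (f s) * (y powr x) / norm s \<le> B * Y / \<bar>h\<bar>"
      using B[OF x] y[OF x] abs_Im_le_cmod[of s] assms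
      using \<open>Y \<ge> 0\<close> by (intro frac_le mult_mono) (auto simp: s)
    thus "norm (f s * of_real y powr s / s) \<le> B * Y / \<bar>h\<bar>"
      using assms by (simp add: norm_mult norm_divide norm_of_real_powr s)
  qed
  also have "Complex b h - Complex a h = of_real (b - a)" by (simp add: complex_eq_iff)
  finally show ?thesis using assms(1) by (simp add: norm_of_real del: of_real_diff)
qed

lemma rectpath_integral_eq:
  assumes "f contour_integrable_on rectpath (Complex a (-T)) (Complex b T)"
  shows "contour_integral (rectpath (Complex a (-T)) (Complex b T)) f =
     contour_integral (linepath (Complex a (-T)) (Complex b (-T))) f
   + contour_integral (linepath (Complex b (-T)) (Complex b T)) f
   - contour_integral (linepath (Complex a T) (Complex b T)) f
   - contour_integral (linepath (Complex a (-T)) (Complex a T)) f"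
proof -
  let ?l1 = "linepath (Complex a (-T)) (Complex b (-T))" and ?l2 = "linepath (Complex b (-T)) (Complex b T)"
  let ?l3 = "linepath (Complex b T) (Complex a T)" and ?l4 = "linepath (Complex a T) (Complex a (-T))"
  have rp: "rectpath (Complex a (-T)) (Complex b T) = ?l1 +++ ?l2 +++ ?l3 +++ ?l4"
    by (simp add: rectpath_def Let_def)
  have "contour_integral (rectpath (Complex a (-T)) (Complex b T)) f =
    contour_integral ?l1 f + (contour_integral ?l2 f + (contour_integral ?l3 f + contour_integral ?l4 f))"
    using assms unfolding rp
    by (subst contour_integral_join; (subst contour_integral_join; (subst contour_integral_join)?)?) auto
  also have "contour_integral ?l3 f = - contour_integral (linepath (Complex a T) (Complex b T)) f"
    using contour_integral_reversepath[of "linepath (Complex a T) (Complex b T)" f] by simp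
  also have "contour_integral ?l4 f = - contour_integral (linepath (Complex a (-T)) (Complex a T)) f"
    using contour_integral_reversepath[of "linepath (Complex a (-T)) (Complex a T)" f] by simp
  finally show ?thesis by simp
qed

lemma rectpath_subset_halfplane:
  assumes "c < a" "a \<le> b" "T > 0"
  shows "path_image (rectpath (Complex a (-T)) (Complex b T)) \<subseteq> {s. Re s > c}"
  using path_image_rectpath_subset_cbox[of "Complex a (-T)" "Complex b T"] assms
  by (force simp: in_cbox_complex_iff)

lemma shift_vertical_line:
  assumes hol: "f holomorphic_on {s. Re s > c}" and "c < a" "a \<le> b" "T > 0"
  shows "contour_integral (linepath (Complex b (-T)) (Complex b T)) f
     - contour_integral (linepath (Complex a (-T)) (Complex a T)) f
   = contour_integral (linepath (Complex a T) (Complex b T)) f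
   - contour_integral (linepath (Complex a (-T)) (Complex b (-T))) f"
proof -
  have "(f has_contour_integral 0) (rectpath (Complex a (-T)) (Complex b T))"
    by (rule Cauchy_theorem_convex_simple[OF hol convex_halfspace_Re_gt])
       (use assms rectpath_subset_halfplane[of c a b T] in auto)
  from contour_integral_unique[OF this] has_contour_integral_integrable[OF this] show ?thesis
    using rectpath_integral_eq[of f a T b] by (simp add: algebra_simps)
qed

text \<open>Since y >= 1, the factor y powr x on the horizontal sides is largest at x = b.\<close>

lemma norm_shift_vertical_line_le:
  assumes hol: "f holomorphic_on {s. Re s > c}" and "0 \<le> c" "c < a" "a \<le> b" "T > 0" "y \<ge> 1" "B \<ge> 0"
    and B: "\<And>x. a \<le> x \<Longrightarrow> x \<le> b \<Longrightarrow> norm (f (Complex x T)) \<le> B \<and> norm (f (Complex x (-T))) \<le> B"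
  shows "norm (contour_integral (linepath (Complex b (-T)) (Complex b T)) (\<lambda>s. f s * of_real y powr s / s)
     - contour_integral (linepath (Complex a (-T)) (Complex a T)) (\<lambda>s. f s * of_real y powr s / s))
     \<le> 2 * (B * y powr b / T * (b - a))"
proof -
  let ?g = "\<lambda>s. f s * of_real y powr s / s"
  have "?g holomorphic_on {s. Re s > c}" using assms by (intro holomorphic_intros hol) auto
  note eq = shift_vertical_line[OF this assms(3-5)]
  have cont: "continuous_on (closed_segment (Complex a h) (Complex b h)) f" for h
  proof (rule continuous_on_subset[OF holomorphic_on_imp_continuous_on[OF hol]])
    show "closed_segment (Complex a h) (Complex b h) \<subseteq> {s. Re s > c}"
      by (rule closed_segment_subset[OF _ _ convex_halfspace_Re_gt]) (use assms in auto)
  qed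
  have h: "norm (contour_integral (linepath (Complex a h) (Complex b h)) ?g) \<le> B * y powr b / \<bar>h\<bar> * (b - a)"
    if "h = T \<or> h = -T" for h
    by (rule norm_horizontal_integral_le[OF _ _ _ _ cont]) (use assms that in \<open>auto intro: powr_mono\<close>)
  show ?thesis unfolding eq
    using norm_triangle_le_diff[OF add_mono[OF h[of T] h[of "-T"]]] assms by (simp add: mult_ac)
qed

text \<open>Integrating the modulus of y powr s exactly, instead of taking maximum times length,
  avoids the factor b - a, so that one end of the segment may go to infinity.\<close>

lemma norm_horizontal_powr_le:
  assumes "a < b" "h \<noteq> 0" "y > 0" "y \<noteq> 1"
  shows "norm (contour_integral (linepath (Complex a h) (Complex b h)) (\<lambda>s. of_real y powr s / s))
     \<le> (y powr b - y powr a) / ln y / \<bar>h\<bar>"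
proof -
  let ?g = "\<lambda>s. of_real y powr s / s"
  define l where "l = linepath (Complex a h) (Complex b h)"
  have path: "l u = Complex (linepath a b u) h" for u
    by (simp add: l_def linepath_def complex_eq_iff algebra_simps)
  have "?g contour_integrable_on l" unfolding l_def
    using assms closed_segment_same_Im[of 0 a h b] by (intro contour_integrable_continuous_linepath continuous_intros) auto
  then obtain J where J: "(?g has_contour_integral J) l" by (auto simp: contour_integrable_on_def)
  hence "((\<lambda>u. ?g (l u) * (Complex b h - Complex a h)) has_integral J) {0..1}"
    unfolding l_def by (simp add: has_contour_integral_linepath)
  moreover have diff: "Complex b h - Complex a h = of_real (b - a)" by (simp add: complex_eq_iff)
  ultimately have int: "((\<lambda>u. ?g (l u) * of_real (b - a)) has_integral J) {0..1}"
    by (simp only: diff)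
  have int2: "((\<lambda>u. y powr (a + u * (b - a)) * (b - a) / \<bar>h\<bar>) has_integral
      y powr (a + 1 * (b - a)) / ln y / \<bar>h\<bar> - y powr (a + 0 * (b - a)) / ln y / \<bar>h\<bar>) {0..1}"
  proof (rule fundamental_theorem_of_calculus)
    fix u :: real assume "u \<in> {0..1}"
    have "((\<lambda>u. y powr (a + u * (b - a)) / ln y / \<bar>h\<bar>) has_real_derivative
        y powr (a + u * (b - a)) * (b - a) / \<bar>h\<bar>) (at u within {0..1})"
      using assms by (auto intro!: derivative_eq_intros simp: powr_def)
    thus "((\<lambda>u. y powr (a + u * (b - a)) / ln y / \<bar>h\<bar>) has_vector_derivative
        y powr (a + u * (b - a)) * (b - a) / \<bar>h\<bar>) (at u within {0..1})"
      by (simp add: has_real_derivative_iff_has_vector_derivative)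
  qed simp
  have "norm (integral {0..1} (\<lambda>u. ?g (l u) * of_real (b - a))) \<le>
     integral {0..1} (\<lambda>u. y powr (a + u * (b - a)) * (b - a) / \<bar>h\<bar>)"
  proof (rule integral_norm_bound_integral[OF has_integral_integrable[OF int] has_integral_integrable[OF int2]])
    fix u :: real assume "u \<in> {0..1}"
    have lab: "linepath a b u = a + u * (b - a)" by (simp add: linepath_def algebra_simps)
    have "\<bar>h\<bar> \<le> norm (l u)" using abs_Im_le_cmod[of "l u"] by (simp add: path)
    moreover from this have "norm (l u) > 0" using assms by linarith
    ultimately have "y powr (a + u * (b - a)) * (b - a) / norm (l u) \<le> y powr (a + u * (b - a)) * (b - a) / \<bar>h\<bar>"
      using assms by (intro divide_left_mono mult_nonneg_nonneg) auto
    thus "norm (?g (l u) * of_real (b - a)) \<le> y powr (a + u * (b - a)) * (b - a) / \<bar>h\<bar>"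
      using assms by (simp add: norm_mult norm_divide norm_of_real_powr path lab del: of_real_diff)
  qed
  hence "norm J \<le> (y powr b - y powr a) / ln y / \<bar>h\<bar>"
    using integral_unique[OF int] integral_unique[OF int2] by (simp add: diff_divide_distrib)
  thus ?thesis using contour_integral_unique[OF J] by (simp add: l_def)
qed

text \<open>Meant for the far side of a rectangle, where the decay of y powr c outweighs the length;
  c may be negative.\<close>

lemma norm_vertical_powr_crude:
  assumes "c \<noteq> 0" "y > 0" "T > 0"
  shows "norm (contour_integral (linepath (Complex c (-T)) (Complex c T)) (\<lambda>s. of_real y powr s / s))
     \<le> y powr c / \<bar>c\<bar> * (2 * T)"
proof -
  have "norm (contour_integral (linepath (Complex c (-T)) (Complex c T)) (\<lambda>s. of_real y powr s / s))
     \<le> y powr c / \<bar>c\<bar> * norm (Complex c T - Complex c (-T))"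
  proof (rule contour_integral_bound_linepath)
    show "(\<lambda>s. of_real y powr s / s) contour_integrable_on linepath (Complex c (-T)) (Complex c T)"
      using assms closed_segment_same_Re[of 0 c "-T" T]
      by (intro contour_integrable_continuous_linepath continuous_intros) auto
    fix s assume "s \<in> closed_segment (Complex c (-T)) (Complex c T)"
    hence s: "Re s = c" by (rule closed_segment_same_Re)
    have "\<bar>c\<bar> \<le> norm s" using abs_Re_le_cmod[of s] s by simp
    hence "y powr c / norm s \<le> y powr c / \<bar>c\<bar>" using assms by (intro divide_left_mono mult_pos_pos) auto
    thus "norm (of_real y powr s / s) \<le> y powr c / \<bar>c\<bar>"
      using assms s by (simp add: norm_divide norm_of_real_powr)
  qed auto
  also have "Complex c T - Complex c (-T) = of_real (2 * T) * \<i>" by (simp add: complex_eq_iff)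
  finally show ?thesis using assms(3) by (simp add: norm_mult)
qed

text \<open>For y < 1 the line is pushed to Re s = U, with U tending to infinity, and meets no pole.
  For y > 1 it is pushed to Re s = -U across the pole at 0, whose residue is 1. Either way only the
  two horizontal sides remain.\<close>

lemma perron_kernel:
  assumes "b > 0" "T > 0" "y > 0" "y \<noteq> 1"
  shows "norm (contour_integral (linepath (Complex b (-T)) (Complex b T)) (\<lambda>s. of_real y powr s / s)
          - (if y > 1 then 2 * pi * \<i> else 0)) \<le> 2 * y powr b / (T * \<bar>ln y\<bar>)"
proof (cases "y > 1")
  case False
  hence y: "y < 1" "ln y < 0" using assms by auto
  let ?g = "\<lambda>s. of_real y powr s / s"
  let ?V = "\<lambda>c. contour_integral (linepath (Complex c (-T)) (Complex c T)) ?g"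
  let ?R = "2 * y powr b / (T * \<bar>ln y\<bar>)"
  have bd: "norm (?V b) \<le> y powr U / U * (2 * T) + ?R" if U: "U > b" for U
  proof -
    have hol: "?g holomorphic_on {s. Re s > 0}" using assms by (intro holomorphic_intros) auto
    have eq: "?V U - ?V b = contour_integral (linepath (Complex b T) (Complex U T)) ?g
        - contour_integral (linepath (Complex b (-T)) (Complex U (-T))) ?g"
      by (rule shift_vertical_line[OF hol]) (use U assms in auto)
    have h: "norm (contour_integral (linepath (Complex b h) (Complex U h)) ?g) \<le> y powr b / (T * \<bar>ln y\<bar>)"
      if "h = T \<or> h = -T" for h
    proof -
      have "norm (contour_integral (linepath (Complex b h) (Complex U h)) ?g) \<le> (y powr U - y powr b) / ln y / \<bar>h\<bar>"
        by (rule norm_horizontal_powr_le) (use U assms that in auto)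
      also have "\<dots> = (y powr b - y powr U) / \<bar>ln y\<bar> / T" using y that assms by (auto simp: field_simps)
      also have "\<dots> \<le> y powr b / \<bar>ln y\<bar> / T" using assms by (intro divide_right_mono) auto
      finally show ?thesis by (simp add: mult.commute)
    qed
    have "?V b = ?V U - (contour_integral (linepath (Complex b T) (Complex U T)) ?g
        - contour_integral (linepath (Complex b (-T)) (Complex U (-T))) ?g)" using eq by (simp add: algebra_simps)
    hence "norm (?V b) = norm (?V U - (contour_integral (linepath (Complex b T) (Complex U T)) ?g
        - contour_integral (linepath (Complex b (-T)) (Complex U (-T))) ?g))" by (rule arg_cong)
    also have "\<dots> \<le> norm (?V U) + (norm (contour_integral (linepath (Complex b T) (Complex U T)) ?g)
        + norm (contour_integral (linepath (Complex b (-T)) (Complex U (-T))) ?g))"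
      by (intro order_trans[OF norm_triangle_ineq4] add_left_mono norm_triangle_ineq4)
    finally have "norm (?V b) \<le> norm (?V U) + (norm (contour_integral (linepath (Complex b T) (Complex U T)) ?g)
        + norm (contour_integral (linepath (Complex b (-T)) (Complex U (-T))) ?g))" .
    moreover have "norm (?V U) \<le> y powr U / \<bar>U\<bar> * (2 * T)"
      by (rule norm_vertical_powr_crude) (use U assms in auto)
    ultimately show ?thesis using h[of T] h[of "-T"] U assms(1) by simp
  qed
  have "((\<lambda>U. y powr U / U * (2 * T) + ?R) \<longlongrightarrow> 0 * (2 * T) + ?R) at_top"
  proof (intro tendsto_intros)
    have "((\<lambda>U. y powr U / U) \<longlongrightarrow> 0) at_top" using y assms by real_asymp
    thus "((\<lambda>U. y powr U / U) \<longlongrightarrow> 0) at_top" .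
  qed
  hence "norm (?V b) \<le> 0 * (2 * T) + ?R"
    by (rule tendsto_lowerbound[OF _ eventually_mono[OF eventually_gt_at_top[of b]]]) (use bd in auto)
  thus ?thesis using False by simp
next
  case True
  hence y: "ln y > 0" by simp
  let ?g = "\<lambda>s. of_real y powr s / s"
  let ?V = "\<lambda>c. contour_integral (linepath (Complex c (-T)) (Complex c T)) ?g"
  let ?R = "2 * y powr b / (T * \<bar>ln y\<bar>)"
  have bd: "norm (?V b - 2 * pi * \<i>) \<le> y powr (-U) / U * (2 * T) + ?R" if U: "U > 0" for U
  proof -
    let ?r = "rectpath (Complex (-U) (-T)) (Complex b T)"
    have box: "0 \<in> box (Complex (-U) (-T)) (Complex b T)" using U assms by (auto simp: in_box_complex_iff)
    hence im: "path_image ?r \<subseteq> UNIV - {0}"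
      using path_image_rectpath_inter_box[of "Complex (-U) (-T)" "Complex b T"] U assms by auto
    have "((\<lambda>w. of_real y powr w / (w - 0)) has_contour_integral 2 * pi * \<i> * winding_number ?r 0 * of_real y powr 0) ?r"
      by (rule Cauchy_integral_formula_convex_simple[OF convex_UNIV]) (use im assms in \<open>auto intro!: holomorphic_intros\<close>)
    moreover have "winding_number ?r 0 = 1" using winding_number_rectpath[OF box] .
    ultimately have I: "(?g has_contour_integral 2 * pi * \<i>) ?r" using assms by simp
    from contour_integral_unique[OF this] rectpath_integral_eq[OF has_contour_integral_integrable[OF I]]
    have eq: "?V b - 2 * pi * \<i> = ?V (-U) + (contour_integral (linepath (Complex (-U) T) (Complex b T)) ?g
        - contour_integral (linepath (Complex (-U) (-T)) (Complex b (-T))) ?g)" by (simp add: algebra_simps)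
    have h: "norm (contour_integral (linepath (Complex (-U) h) (Complex b h)) ?g) \<le> y powr b / (T * \<bar>ln y\<bar>)"
      if "h = T \<or> h = -T" for h
    proof -
      have "norm (contour_integral (linepath (Complex (-U) h) (Complex b h)) ?g) \<le> (y powr b - y powr (-U)) / ln y / \<bar>h\<bar>"
        by (rule norm_horizontal_powr_le) (use U assms that in auto)
      also have "\<dots> = (y powr b - y powr (-U)) / \<bar>ln y\<bar> / T" using y that assms by auto
      also have "\<dots> \<le> y powr b / \<bar>ln y\<bar> / T" using assms by (intro divide_right_mono) auto
      finally show ?thesis by (simp add: mult.commute)
    qed
    have "norm (?V b - 2 * pi * \<i>) \<le> norm (?V (-U)) + (norm (contour_integral (linepath (Complex (-U) T) (Complex b T)) ?g)
        + norm (contour_integral (linepath (Complex (-U) (-T)) (Complex b (-T))) ?g))"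
      unfolding eq by (intro order_trans[OF norm_triangle_ineq] add_left_mono norm_triangle_ineq4)
    moreover have "norm (?V (-U)) \<le> y powr (-U) / \<bar>-U\<bar> * (2 * T)"
      by (rule norm_vertical_powr_crude) (use U assms in auto)
    ultimately show ?thesis using h[of T] h[of "-T"] U by simp
  qed
  have "((\<lambda>U. y powr (-U) / U * (2 * T) + ?R) \<longlongrightarrow> 0 * (2 * T) + ?R) at_top"
  proof (intro tendsto_intros)
    have "((\<lambda>U. y powr (-U) / U) \<longlongrightarrow> 0) at_top" using True by real_asymp
    thus "((\<lambda>U. y powr (-U) / U) \<longlongrightarrow> 0) at_top" .
  qed
  hence "norm (?V b - 2 * pi * \<i>) \<le> 0 * (2 * T) + ?R"
    by (rule tendsto_lowerbound[OF _ eventually_mono[OF eventually_gt_at_top[of 0]]]) (use bd in auto)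
  thus ?thesis using True by simp
qed


section \<open>Elementary estimates for the truncation error\<close>

lemma arsinh_bound:
  assumes "b > 0" "\<epsilon> > 0"
  obtains C where "C > 0" "\<And>T. T \<ge> 1 \<Longrightarrow> 2 * arsinh (T / b) \<le> C * T powr (\<epsilon>::real)"
proof
  \<comment> \<open>From arsinh x <= ln (2 x + 1) with x = T / b, and 2 T / b + 1 <=
    \<open>?k * T\<close> for T >= 1.\<close>
  let ?k = "1 + 2 / b"
  show "2 * (?k powr \<epsilon> / \<epsilon>) > 0" using assms add_pos_pos[of 1 "2 / b"] by simp
  fix T :: real assume T: "T \<ge> 1"
  define x where "x = T / b"
  have x: "x > 0" using T assms by (simp add: x_def)
  have "x\<^sup>2 + 1 \<le> (x + 1)\<^sup>2" using x by (simp add: power2_eq_square algebra_simps)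
  hence "sqrt (x\<^sup>2 + 1) \<le> x + 1" using x by (intro real_le_lsqrt) auto
  moreover have "1 + 2 * x \<le> ?k * T" using T assms by (simp add: x_def field_simps)
  ultimately have "x + sqrt (x\<^sup>2 + 1) \<le> ?k * T" by linarith
  moreover have "x + sqrt (x\<^sup>2 + 1) > 0" by (rule arsinh_real_aux)
  ultimately have "arsinh x \<le> ln (?k * T)" unfolding arsinh_real_def by (subst ln_le_cancel_iff) auto
  also have "\<dots> \<le> (?k * T) powr \<epsilon> / \<epsilon>"
  proof (rule ln_powr_bound)
    show "1 \<le> ?k * T" using T assms mult_mono[of 1 ?k 1 T] by simp
  qed fact
  also have "\<dots> = ?k powr \<epsilon> / \<epsilon> * T powr \<epsilon>" using T assms by (simp add: powr_mult)
  finally show "2 * arsinh (T / b) \<le> 2 * (?k powr \<epsilon> / \<epsilon>) * T powr \<epsilon>" by (simp add: x_def)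
qed

lemma ln_2X_bound:
  assumes "\<epsilon> > 0"
  obtains C where "C > 0" "\<And>X. X \<ge> 1 \<Longrightarrow> ln (2 * X) + 1 \<le> C * X powr (\<epsilon>::real)"
proof
  show "2 powr \<epsilon> / \<epsilon> + 1 > 0" using assms by (intro add_pos_pos) auto
  fix X :: real assume X: "X \<ge> 1"
  have "ln (2 * X) \<le> (2 * X) powr \<epsilon> / \<epsilon>" by (rule ln_powr_bound) (use X assms in auto)
  moreover have "(2 * X) powr \<epsilon> = 2 powr \<epsilon> * X powr \<epsilon>" using X by (simp add: powr_mult)
  moreover have "1 \<le> X powr \<epsilon>" using X assms by (simp add: ge_one_powr_ge_zero)
  ultimately show "ln (2 * X) + 1 \<le> (2 powr \<epsilon> / \<epsilon> + 1) * X powr \<epsilon>" by (simp add: algebra_simps)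
qed

lemma ln_powr_neg_summable:
  assumes "\<epsilon> > 0" shows "summable (\<lambda>n::nat. ln (real n) * real n powr (-(1 + \<epsilon>)))"
proof (rule summable_comparison_test')
  show "summable (\<lambda>n. real n powr (-(1 + \<epsilon>/2)) / (\<epsilon>/2))"
    using assms by (intro summable_divide) (simp add: summable_real_powr_iff)
  fix n :: nat assume "n \<ge> 1"
  hence n: "real n \<ge> 1" by simp
  have "ln (real n) * real n powr (-(1 + \<epsilon>)) \<le> real n powr (\<epsilon>/2) / (\<epsilon>/2) * real n powr (-(1 + \<epsilon>))"
    by (intro mult_right_mono ln_powr_bound) (use n assms in auto)
  also have "\<dots> = real n powr (\<epsilon>/2 + -(1 + \<epsilon>)) / (\<epsilon>/2)" by (simp only: powr_add times_divide_eq_left)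
  also have "\<epsilon>/2 + -(1 + \<epsilon>) = -(1 + \<epsilon>/2)" by simp
  finally show "norm (ln (real n) * real n powr (-(1 + \<epsilon>))) \<le> real n powr (-(1 + \<epsilon>/2)) / (\<epsilon>/2)"
    using n by simp
qed

text \<open>The inequality ln u <= u - 1, applied to the quotient of the smaller number by the
  larger.\<close>

lemma inverse_abs_ln_le:
  assumes "X > 0" "x > 0" "X \<noteq> (x::real)"
  shows "1 / \<bar>ln (X / x)\<bar> \<le> max X x / \<bar>X - x\<bar>"
proof (cases "x < X")
  case True
  have "ln (x / X) \<le> x / X - 1" using assms by (intro ln_le_minus_one) auto
  hence "(X - x) / X \<le> ln (X / x)" using assms by (simp add: ln_div field_simps)
  moreover have "0 < (X - x) / X" using True assms by simp
  ultimately have "1 / ln (X / x) \<le> 1 / ((X - x) / X)" by (intro frac_le) auto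
  thus ?thesis using True assms \<open>0 < (X - x) / X\<close> \<open>(X - x) / X \<le> ln (X / x)\<close> by (simp add: max_def)
next
  case False
  hence l: "x > X" using assms by simp
  have "ln (X / x) \<le> X / x - 1" using assms by (intro ln_le_minus_one) auto
  hence "(x - X) / x \<le> - ln (X / x)" using assms by (simp add: field_simps)
  moreover have "0 < (x - X) / x" using l assms by simp
  ultimately have "1 / (- ln (X / x)) \<le> 1 / ((x - X) / x)" by (intro frac_le) auto
  thus ?thesis using l assms \<open>0 < (x - X) / x\<close> \<open>(x - X) / x \<le> - ln (X / x)\<close> by (simp add: max_def)
qed

text \<open>The contribution \<open>1/\<bar>X - n\<bar>\<close> of the terms with \<open>X/2 \<le> n \<le> 2X\<close>, where \<open>m\<close> is the integer part
  of \<open>X\<close>; the two integers next to \<open>X\<close> are excluded.\<close>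

definition near_weight :: "real \<Rightarrow> nat \<Rightarrow> real" where
  "near_weight X n = (let m = nat \<lfloor>X\<rfloor> in
     if 1 \<le> n \<and> n < m then 1 / real (m - n)
     else if m + 1 < n \<and> real n \<le> 2 * X then 1 / real (n - (m + 1)) else 0)"

lemma near_weight_nonneg: "near_weight X n \<ge> 0"
  unfolding near_weight_def Let_def by (simp split: if_split) linarith

lemma near_weight_eq_0: "real n > 2 * X \<Longrightarrow> X > 1 \<Longrightarrow> near_weight X n = 0"
proof -
  assume *: "real n > 2 * X" "X > 1"
  hence "\<not> n < nat \<lfloor>X\<rfloor>" by linarith
  moreover have "\<not> real n \<le> 2 * X" using * by linarith
  ultimately show "near_weight X n = 0" unfolding near_weight_def Let_def by presburger
qed

lemma harm_le: "k > 0 \<Longrightarrow> harm k \<le> ln (real k) + 1"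
  using decseqD[OF decseq_harm_diff_ln, of 0 "k - 1"] by (simp add: harm_def)

text \<open>On either side of X the distances run through 1, 2, 3, ..., which makes two harmonic
  sums.\<close>

lemma sum_near_weight_le:
  assumes "X > 2"
  shows "(\<Sum>n\<le>nat \<lfloor>2 * X\<rfloor>. near_weight X n) \<le> 2 * (ln (2 * X) + 1)"
proof -
  define m where "m = nat \<lfloor>X\<rfloor>"
  define M where "M = nat \<lfloor>2 * X\<rfloor>"
  have m: "m \<ge> 2" "real m \<le> X" "real M \<le> 2 * X" "m + 1 \<le> M" unfolding m_def M_def using assms by linarith+
  have harm_bd: "harm k \<le> ln (2 * X) + 1" if "k \<le> M" for k
  proof (cases "k = 0")
    case False
    hence "harm k \<le> ln (real k) + 1" by (intro harm_le) simp
    also have "ln (real k) \<le> ln (2 * X)" using that m False by (subst ln_le_cancel_iff) (auto simp: order_trans[of "real k" "real M"])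
    finally show ?thesis by simp
  qed (use assms in \<open>simp add: harm_def\<close>)
  have "(\<Sum>n\<le>M. near_weight X n) = (\<Sum>n\<in>{1..<m} \<union> {m+2..M}. near_weight X n)"
    by (rule sum.mono_neutral_right) (use m in \<open>auto simp: near_weight_def Let_def m_def[symmetric]\<close>)
  also have "\<dots> = (\<Sum>n\<in>{1..<m}. near_weight X n) + (\<Sum>n\<in>{m+2..M}. near_weight X n)"
    by (rule sum.union_disjoint) auto
  also have "(\<Sum>n\<in>{1..<m}. near_weight X n) = (\<Sum>n\<in>{1..<m}. 1 / real (m - n))"
    by (rule sum.cong) (auto simp: near_weight_def Let_def m_def[symmetric])
  also have "\<dots> = harm (m - 1)"
    unfolding harm_def
    by (rule sum.reindex_bij_witness[where i = "\<lambda>j. m - j" and j = "\<lambda>n. m - n"]) (auto simp: inverse_eq_divide)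
  also have "(\<Sum>n\<in>{m+2..M}. near_weight X n) = (\<Sum>n\<in>{m+2..M}. 1 / real (n - (m + 1)))"
    by (rule sum.cong) (use m in \<open>auto simp: near_weight_def Let_def m_def[symmetric]\<close>)
  also have "\<dots> = harm (M - (m + 1))"
    unfolding harm_def
    by (rule sum.reindex_bij_witness[where i = "\<lambda>j. j + (m + 1)" and j = "\<lambda>n. n - (m + 1)"]) (auto simp: inverse_eq_divide)
  also have "harm (m - 1) + harm (M - (m + 1)) \<le> (ln (2 * X) + 1) + (ln (2 * X) + 1)"
    by (intro add_mono harm_bd) (use m in auto)
  finally show ?thesis by (simp add: M_def)
qed

text \<open>For n outside [X/2, 2 X] the quotient in \<open>inverse_abs_ln_le\<close> is at most 2.
  Inside, |X - n| is at least the distance from n to the nearer of the two integers around X, which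
  is positive as those two are excluded.\<close>

lemma far_near_bound:
  assumes X: "X > 2" "X \<notin> \<int>" and n: "n \<ge> 1" "n \<noteq> nat \<lfloor>X\<rfloor>" "n \<noteq> nat \<lfloor>X\<rfloor> + 1" and b: "b > 0"
  shows "(X / real n) powr b / \<bar>ln (X / real n)\<bar> \<le> 2 * (X / real n) powr b + 2 powr b * (2 * X) * near_weight X n"
proof -
  define m where "m = nat \<lfloor>X\<rfloor>"
  have ne: "X \<noteq> real n" using X by auto
  let ?y = "X / real n" let ?q = "max X (real n) / \<bar>X - real n\<bar>"
  have "?y powr b / \<bar>ln ?y\<bar> = ?y powr b * (1 / \<bar>ln ?y\<bar>)" by simp
  also have "\<dots> \<le> ?y powr b * ?q"
    using inverse_abs_ln_le[of X "real n"] X n ne by (intro mult_left_mono) auto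
  also have "\<dots> \<le> 2 * ?y powr b + 2 powr b * (2 * X) * near_weight X n"
  proof (cases "real n < X / 2 \<or> real n > 2 * X")
    case True
    hence "?q \<le> 2" using X by (auto simp: field_simps max_def)
    hence "?y powr b * ?q \<le> ?y powr b * 2" by (intro mult_left_mono) auto
    moreover have "0 \<le> 2 powr b * (2 * X) * near_weight X n" using X near_weight_nonneg by simp
    ultimately show ?thesis by linarith
  next
    case False
    have "?y \<le> 2" using False n by (simp add: field_simps)
    hence y: "?y powr b \<le> 2 powr b" using X n b by (intro powr_mono2) auto
    have "1 / \<bar>X - real n\<bar> \<le> near_weight X n"
    proof (cases "n < m")
      case True
      hence "real (m - n) \<le> X - real n" using X unfolding m_def by (simp add: of_nat_diff)
      moreover have "real (m - n) > 0" using True by simp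
      ultimately have "1 / \<bar>X - real n\<bar> \<le> 1 / real (m - n)" by (intro frac_le) auto
      thus ?thesis using True n by (simp add: near_weight_def Let_def m_def)
    next
      case nm: False
      hence "n > m + 1" using n by (simp add: m_def)
      moreover from this have "real (n - (m + 1)) \<le> real n - X" using X unfolding m_def by (simp add: of_nat_diff) linarith
      moreover have "real (n - (m + 1)) > 0" using \<open>n > m + 1\<close> by simp
      ultimately have "1 / \<bar>X - real n\<bar> \<le> 1 / real (n - (m + 1))" by (intro frac_le) auto
      thus ?thesis using nm False n \<open>n > m + 1\<close> by (simp add: near_weight_def Let_def m_def[symmetric])
    qed
    hence "?q \<le> (2 * X) * near_weight X n"
      using False X mult_mono[of "max X (real n)" "2 * X" "1 / \<bar>X - real n\<bar>" "near_weight X n"] by auto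
    hence "?y powr b * ?q \<le> 2 powr b * ((2 * X) * near_weight X n)"
      by (intro mult_mono y) (use X in auto)
    moreover have "2 powr b * ((2 * X) * near_weight X n) = 2 powr b * (2 * X) * near_weight X n" by simp
    moreover have "0 \<le> 2 * ?y powr b" by simp
    ultimately show ?thesis by linarith
  qed
  finally show ?thesis .
qed

lemma of_real_divide_powr:
  assumes "X > 0" "n > 0"
  shows "complex_of_real (X / real n) powr s = of_nat n powr (-s) * of_real X powr s"
proof -
  have "complex_of_real (X / real n) * of_nat n = of_real X" using assms by simp
  hence "complex_of_real X powr s = of_real (X / real n) powr s * of_nat n powr s"
    using powr_times_real[of "of_real (X / real n)" "of_nat n" s] assms by simp
  thus ?thesis using assms by (simp add: powr_minus field_simps)
qed

definition perron_line :: "real \<Rightarrow> real \<Rightarrow> (complex \<Rightarrow> complex) \<Rightarrow> real \<Rightarrow> complex" where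
  "perron_line b T f X = contour_integral (linepath (Complex b (-T)) (Complex b T)) (\<lambda>s. f s * of_real X powr s / s)"

lemma dirichlet_abs_summable:
  assumes a: "\<And>n. norm (a n :: complex) \<le> ln (real n)" and "\<epsilon> > 0" and s: "Re s \<ge> 1 + \<epsilon>"
  shows "summable (\<lambda>n. norm (a n * of_nat n powr (-s)))"
    and "norm (a n * of_nat n powr (-s)) \<le> ln (real n) * real n powr (-(1 + \<epsilon>))"
proof -
  show bd: "norm (a n * of_nat n powr (-s)) \<le> ln (real n) * real n powr (-(1 + \<epsilon>))" for n
  proof (cases "n = 0")
    case False
    have "norm (of_nat n powr (-s) :: complex) = real n powr (- Re s)"
      using norm_powr_real_powr[of "of_nat n" "-s"] by simp
    also have "\<dots> \<le> real n powr (-(1 + \<epsilon>))" using False s by (intro powr_mono) auto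
    finally show ?thesis unfolding norm_mult using a[of n] by (intro mult_mono) (use False in auto)
  qed (use a[of 0] in auto)
  show "summable (\<lambda>n. norm (a n * of_nat n powr (-s)))"
    by (rule summable_comparison_test'[OF ln_powr_neg_summable[OF assms(2)], of 0]) (use bd in auto)
qed

text \<open>C depends on \<epsilon> only. The coefficients enter through |a n| <= ln n, and the two
  integers next to X, for which 1 / |ln (X / n)| can be arbitrarily large, are handled by the
  absolute bound for the vertical integral instead of \<open>perron_kernel\<close>.\<close>

lemma perron_formula:
  fixes \<epsilon> :: real assumes \<epsilon>: "\<epsilon> > 0"
  obtains C where "C > 0"
    "\<And>X T a. 2 < T \<Longrightarrow> T < X \<Longrightarrow> X \<notin> \<int> \<Longrightarrow> (\<And>n. norm (a n :: complex) \<le> ln (real n)) \<Longrightarrow>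
       norm (perron_line (1 + \<epsilon>) T (\<lambda>s. \<Sum>n. a n * of_nat n powr (-s)) X
             - 2 * pi * \<i> * (\<Sum>n | real n < X. a n)) \<le> C * (X powr (1 + \<epsilon>) * T powr (-1 + \<epsilon>))"
proof -
  define b where "b = 1 + \<epsilon>"
  have b: "b > 0" using \<epsilon> by (simp add: b_def)
  define S where "S = (\<Sum>n. ln (real n) * real n powr (-b))"
  have summS: "summable (\<lambda>n. ln (real n) * real n powr (-b))" unfolding b_def by (rule ln_powr_neg_summable[OF \<epsilon>])
  have lnn: "ln (real n) \<ge> 0" for n by (cases "n = 0") auto
  have S0: "S \<ge> 0" unfolding S_def by (intro suminf_nonneg summS) (use lnn in auto)
  \<comment> \<open>Half of \<epsilon>, because two logarithms get multiplied: the harmonic sum and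
    the size of the coefficients.\<close>
  obtain C1 where C1: "C1 > 0" "\<And>X. X \<ge> 1 \<Longrightarrow> ln (2 * X) + 1 \<le> C1 * X powr (\<epsilon>/2)"
    using ln_2X_bound[of "\<epsilon>/2"] \<epsilon> by auto
  obtain C2 where C2: "C2 > 0" "\<And>T. T \<ge> 1 \<Longrightarrow> 2 * arsinh (T / b) \<le> C2 * T powr \<epsilon>"
    using arsinh_bound[OF b \<epsilon>] by auto
  define C where "C = 4 * S + 2 * 2 powr b * 2 * C1 * (2 * C1) + 2 * C1 * (2 powr b * C2 + 2 * pi)"
  have "2 * C1 * (2 powr b * C2 + 2 * pi) > 0" using C1(1) C2(1) by (intro mult_pos_pos add_pos_pos) auto
  hence Cpos: "C > 0" unfolding C_def using S0 C1(1) by (intro add_nonneg_pos) auto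
  show thesis
  proof (rule that[OF Cpos])
    fix X T :: real and a :: "nat \<Rightarrow> complex"
    assume T: "2 < T" "T < X" and X: "X \<notin> \<int>" and a: "\<And>n. norm (a n) \<le> ln (real n)"
    have X2: "X > 2" using T by simp
    define F where "F = (\<lambda>s. \<Sum>n. a n * of_nat n powr (-s))"
    let ?seg = "closed_segment (Complex b (-T)) (Complex b T)"
    let ?l = "linepath (Complex b (-T)) (Complex b T)"
    define f where "f = (\<lambda>n s. a n * of_nat n powr (-s) * of_real X powr s / s)"
    define ker where "ker = (\<lambda>n. contour_integral ?l (\<lambda>s. of_real (X / real n) powr s / s))"
    define ind where "ind = (\<lambda>n. if real n < X then 2 * pi * \<i> else 0)"
    define m where "m = nat \<lfloor>X\<rfloor>"
    have a0: "a n = 0" if "n = 0 \<or> n = 1" for n using a[of n] that by auto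
    have Re: "s \<in> ?seg \<Longrightarrow> Re s = b" for s by (rule closed_segment_same_Re)
    have sne: "s \<in> ?seg \<Longrightarrow> s \<noteq> 0" for s using Re b by fastforce
    have ul: "uniform_limit ?seg (\<lambda>N s. \<Sum>n<N. f n s) (\<lambda>s. \<Sum>n. f n s) sequentially"
    proof (rule Weierstrass_m_test)
      show "summable (\<lambda>n. ln (real n) * real n powr (-b) * (X powr b / b))" by (intro summable_mult2 summS)
      fix n s assume s: "s \<in> ?seg"
      have "norm (a n * of_nat n powr (-s)) \<le> ln (real n) * real n powr (-b)"
        using dirichlet_abs_summable(2)[of a \<epsilon> s n] a \<epsilon> Re[OF s] by (simp add: b_def)
      moreover have "norm (of_real X powr s / s) \<le> X powr b / b"
        using Re[OF s] abs_Re_le_cmod[of s] b X2 by (auto simp: norm_divide norm_of_real_powr intro!: divide_left_mono mult_pos_pos)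
      ultimately have "norm ((a n * of_nat n powr (-s)) * (of_real X powr s / s)) \<le> ln (real n) * real n powr (-b) * (X powr b / b)"
        unfolding norm_mult[of "a n * of_nat n powr (-s)"] by (intro mult_mono) (use lnn b in auto)
      thus "norm (f n s) \<le> ln (real n) * real n powr (-b) * (X powr b / b)" by (simp add: f_def)
    qed
    have Feq: "(\<Sum>n. f n s) = F s * of_real X powr s / s" if s: "s \<in> ?seg" for s
    proof -
      have "summable (\<lambda>n. a n * of_nat n powr (-s))"
        using dirichlet_abs_summable(1)[of a \<epsilon> s] a \<epsilon> Re[OF s] by (auto simp: b_def intro: summable_norm_cancel)
      from suminf_mult2[OF this, of "of_real X powr s / s"] show ?thesis by (simp add: f_def F_def)
    qed
    have ul': "uniform_limit ?seg (\<lambda>N s. \<Sum>n<N. f n s) (\<lambda>s. F s * of_real X powr s / s) sequentially"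
      using ul by (rule uniform_limit_cong'[THEN iffD1, rotated 2]) (use Feq in auto)
    have "continuous_on ?seg (f n)" for n
    proof (cases "n = 0")
      case False
      thus ?thesis unfolding f_def using X2 sne by (intro continuous_intros) auto
    qed (simp add: f_def a0)
    from contour_integral_sums_linepath[OF ul' this] obtain J where
      J: "((\<lambda>s. F s * of_real X powr s / s) has_contour_integral J) ?l" "(\<lambda>n. contour_integral ?l (f n)) sums J" by blast
    have fker: "contour_integral ?l (f n) = a n * ker n" for n
    proof (cases "n = 0")
      case True thus ?thesis by (simp add: f_def a0)
    next
      case False
      have "contour_integral ?l (f n) = contour_integral ?l (\<lambda>s. a n * (of_real (X / real n) powr s / s))"
      proof (rule contour_integral_eq)
        fix s assume "s \<in> path_image ?l"
        have "of_real (X / real n) powr s = of_nat n powr (-s) * of_real X powr s"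
          using X2 False by (intro of_real_divide_powr) auto
        thus "f n s = a n * (of_real (X / real n) powr s / s)" by (simp add: f_def)
      qed
      also have "\<dots> = a n * ker n" unfolding ker_def
        using X2 False sne by (intro contour_integral_lmul contour_integrable_continuous_linepath continuous_intros) auto
      finally show ?thesis .
    qed
    \<comment> \<open>The three summands account for the n far from X, for the n near X, and for the
      two integers next to X.\<close>
    define e where "e = (\<lambda>n. ln (real n) * real n powr (-b) * (4 / T * X powr b)
         + (if n \<le> nat \<lfloor>2 * X\<rfloor> then near_weight X n else 0) * (2 / T * 2 powr b * (2 * X) * ln (2 * X))
         + (if n \<in> {m, m + 1} then ln (2 * X) * (2 powr b * (2 * arsinh (T / b)) + 2 * pi) else 0))"
    have ln0: "ln (2 * X) \<ge> 0" using X2 by simp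
    have Z0: "arsinh (T / b) \<ge> 0" using T b by (simp add: order_less_imp_le)
    have ebound: "norm (a n * (ker n - ind n)) \<le> e n" for n
    proof (cases "n \<le> 1")
      case True
      hence "a n = 0" using a0[of n] by (cases n) auto
      moreover have "e n \<ge> 0" unfolding e_def using T near_weight_nonneg lnn ln0 Z0 by (intro add_nonneg_nonneg mult_nonneg_nonneg) auto
      ultimately show ?thesis by simp
    next
      case n1: False
      hence n: "real n > 1" by simp
      show ?thesis
      proof (cases "n \<in> {m, m + 1}")
        case True
        hence nX: "real n \<ge> X / 2" "real n \<le> 2 * X" using X2 unfolding m_def by (auto; linarith)+
        have "norm (ker n) \<le> (X / real n) powr b * (2 * arsinh (T / b))"
          using norm_vertical_integral_le[of b T "X / real n" 1 "\<lambda>_. 1"] b T X2 n unfolding ker_def by simp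
        also have "(X / real n) powr b \<le> 2 powr b" using nX X2 n b by (intro powr_mono2) (auto simp: field_simps)
        finally have "norm (ker n) \<le> 2 powr b * (2 * arsinh (T / b))" using Z0 by (simp add: mult_right_mono)
        moreover have "norm (ind n) \<le> 2 * pi" by (simp add: ind_def norm_mult)
        ultimately have "norm (ker n - ind n) \<le> 2 powr b * (2 * arsinh (T / b)) + 2 * pi"
          by (intro order_trans[OF norm_triangle_ineq4] add_mono)
        moreover have "norm (a n) \<le> ln (2 * X)" using a[of n] n nX by (smt (verit) ln_mono)
        ultimately have "norm (a n * (ker n - ind n)) \<le> ln (2 * X) * (2 powr b * (2 * arsinh (T / b)) + 2 * pi)"
          unfolding norm_mult by (intro mult_mono) (use ln0 in auto)
        moreover have "0 \<le> ln (real n) * real n powr (-b) * (4 / T * X powr b)" using lnn T by simp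
        moreover have "0 \<le> (if n \<le> nat \<lfloor>2 * X\<rfloor> then near_weight X n else 0) * (2 / T * 2 powr b * (2 * X) * ln (2 * X))"
          using T X2 near_weight_nonneg ln0 by simp
        ultimately show ?thesis using True unfolding e_def by simp
      next
        case False
        have ne: "X \<noteq> real n" using X by auto
        have "norm (ker n - ind n) \<le> 2 * (X / real n) powr b / (T * \<bar>ln (X / real n)\<bar>)"
          using perron_kernel[of b T "X / real n"] b T X2 n ne unfolding ker_def ind_def by simp
        also have "\<dots> = 2 / T * ((X / real n) powr b / \<bar>ln (X / real n)\<bar>)" by simp
        also have "\<dots> \<le> 2 / T * (2 * (X / real n) powr b + 2 powr b * (2 * X) * near_weight X n)"
          by (intro mult_left_mono far_near_bound) (use X2 X n1 False b T in \<open>auto simp: m_def\<close>)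
        finally have "norm (a n * (ker n - ind n)) \<le> ln (real n) * (2 / T * (2 * (X / real n) powr b + 2 powr b * (2 * X) * near_weight X n))"
          unfolding norm_mult by (intro mult_mono a) (use lnn in auto)
        also have "\<dots> = ln (real n) * real n powr (-b) * (4 / T * X powr b) + near_weight X n * (2 / T * 2 powr b * (2 * X)) * ln (real n)"
        proof -
          have "(X / real n) powr b = X powr b * real n powr (-b)" using X2 n by (simp add: powr_divide powr_minus_divide)
          thus ?thesis using T by (simp add: field_simps)
        qed
        also have "near_weight X n * (2 / T * 2 powr b * (2 * X)) * ln (real n) \<le>
           (if n \<le> nat \<lfloor>2 * X\<rfloor> then near_weight X n else 0) * (2 / T * 2 powr b * (2 * X) * ln (2 * X))"
        proof (cases "real n \<le> 2 * X")
          case True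
          hence "n \<le> nat \<lfloor>2 * X\<rfloor>" by linarith
          moreover have "ln (real n) \<le> ln (2 * X)" using True n by (subst ln_le_cancel_iff) auto
          moreover have "0 \<le> near_weight X n * (2 / T * 2 powr b * (2 * X))" using near_weight_nonneg[of X n] T X2 by simp
          ultimately show ?thesis
            using mult_left_mono[of "ln (real n)" "ln (2 * X)" "near_weight X n * (2 / T * 2 powr b * (2 * X))"]
            by (simp add: mult_ac)
        next
          case False
          thus ?thesis using near_weight_eq_0[of X n] X2 by simp
        qed
        finally show ?thesis using False unfolding e_def by simp
      qed
    qed
    have esum: "e sums (S * (4 / T * X powr b)
        + (\<Sum>n\<le>nat \<lfloor>2 * X\<rfloor>. near_weight X n) * (2 / T * 2 powr b * (2 * X) * ln (2 * X))
        + 2 * (ln (2 * X) * (2 powr b * (2 * arsinh (T / b)) + 2 * pi)))"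
      unfolding e_def
    proof (intro sums_add sums_mult2)
      show "(\<lambda>n. ln (real n) * real n powr (-b)) sums S" unfolding S_def by (rule summable_sums[OF summS])
      show "(\<lambda>n. if n \<le> nat \<lfloor>2 * X\<rfloor> then near_weight X n else 0) sums (\<Sum>n\<le>nat \<lfloor>2 * X\<rfloor>. near_weight X n)"
        using sums_If_finite[of "\<lambda>n. n \<le> nat \<lfloor>2 * X\<rfloor>" "near_weight X"] by (simp add: atMost_def)
      show "(\<lambda>n. if n \<in> {m, m + 1} then ln (2 * X) * (2 powr b * (2 * arsinh (T / b)) + 2 * pi) else 0) sums
         (2 * (ln (2 * X) * (2 powr b * (2 * arsinh (T / b)) + 2 * pi)))"
        using sums_If_finite_set[of "{m, m + 1}" "\<lambda>_. ln (2 * X) * (2 powr b * (2 * arsinh (T / b)) + 2 * pi)"] by simp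
    qed
    have fin: "finite {n. real n < X}" by (rule finite_subset[of _ "{..m}"]) (auto simp: m_def, linarith)
    have "(\<lambda>n. if real n < X then a n * (2 * pi * \<i>) else 0) sums (\<Sum>n | real n < X. a n * (2 * pi * \<i>))"
      using sums_If_finite[OF fin] .
    moreover have "(\<lambda>n. if real n < X then a n * (2 * pi * \<i>) else 0) = (\<lambda>n. a n * ind n)" by (auto simp: ind_def)
    ultimately have "(\<lambda>n. a n * ind n) sums (2 * pi * \<i> * (\<Sum>n | real n < X. a n))"
      by (simp add: sum_distrib_right[symmetric] mult.commute)
    with J(2) have "(\<lambda>n. a n * (ker n - ind n)) sums (J - 2 * pi * \<i> * (\<Sum>n | real n < X. a n))"
      unfolding fker by (auto dest: sums_diff simp: right_diff_distrib)
    moreover have "J = perron_line (1 + \<epsilon>) T F X"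
      using contour_integral_unique[OF J(1)] by (simp add: perron_line_def b_def)
    ultimately have "(\<lambda>n. a n * (ker n - ind n)) sums (perron_line (1 + \<epsilon>) T F X - 2 * pi * \<i> * (\<Sum>n | real n < X. a n))"
      by simp
    moreover have "e sums suminf e" using esum by (simp add: sums_iff)
    ultimately have "norm (perron_line (1 + \<epsilon>) T F X - 2 * pi * \<i> * (\<Sum>n | real n < X. a n)) \<le> suminf e"
      using ebound by (rule norm_sums_le)
    also have "suminf e = S * (4 / T * X powr b)
        + (\<Sum>n\<le>nat \<lfloor>2 * X\<rfloor>. near_weight X n) * (2 / T * 2 powr b * (2 * X) * ln (2 * X))
        + 2 * (ln (2 * X) * (2 powr b * (2 * arsinh (T / b)) + 2 * pi))" using esum by (simp add: sums_iff)
    also have "\<dots> \<le> C * (X powr (1 + \<epsilon>) * T powr (-1 + \<epsilon>))"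
    proof -
      define W where "W = X powr (1 + \<epsilon>) * T powr (-1 + \<epsilon>)"
      have T\<epsilon>: "T powr \<epsilon> \<ge> 1" using T \<epsilon> by (simp add: ge_one_powr_ge_zero)
      have W: "W = X powr \<epsilon> * T powr \<epsilon> * (X / T)" using T X2 by (simp add: W_def powr_add powr_diff)
      have W1: "X powr b / T \<le> W" 
      proof -
        have "X powr b / T * 1 \<le> X powr b / T * T powr \<epsilon>" using T\<epsilon> T by (intro mult_left_mono) auto
        also have "\<dots> = W" using T by (simp add: W_def b_def powr_diff powr_minus field_simps powr_add)
        finally show ?thesis by simp
      qed
      have W2: "X powr \<epsilon> * T powr \<epsilon> \<le> W"
        unfolding W using T mult_left_mono[of 1 "X / T" "X powr \<epsilon> * T powr \<epsilon>"] by simp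
      have lX: "ln (2 * X) + 1 \<le> C1 * X powr (\<epsilon>/2)" using C1(2)[of X] X2 by simp
      have p1: "S * (4 / T * X powr b) \<le> 4 * S * W" using mult_left_mono[OF W1, of "4 * S"] S0 by (simp add: field_simps)
      have "(\<Sum>n\<le>nat \<lfloor>2 * X\<rfloor>. near_weight X n) * (2 / T * 2 powr b * (2 * X) * ln (2 * X)) \<le>
         2 * (C1 * X powr (\<epsilon>/2)) * (2 / T * 2 powr b * (2 * X) * (C1 * X powr (\<epsilon>/2)))"
        using sum_near_weight_le[OF X2] lX ln0 T X2 C1(1)
        by (intro mult_mono mult_nonneg_nonneg sum_nonneg near_weight_nonneg) auto
      also have "\<dots> = 2 * 2 powr b * 2 * C1 * (2 * C1) * (X powr (\<epsilon>/2) * X powr (\<epsilon>/2) * X / T)"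
        by (simp add: field_simps)
      also have "X powr (\<epsilon>/2) * X powr (\<epsilon>/2) * X / T = X powr b / T"
        using X2 by (simp add: powr_add[symmetric] b_def powr_add)
      also have "2 * 2 powr b * 2 * C1 * (2 * C1) * (X powr b / T) \<le> 2 * 2 powr b * 2 * C1 * (2 * C1) * W"
        by (intro mult_left_mono W1) (use C1(1) in auto)
      finally have p2: "(\<Sum>n\<le>nat \<lfloor>2 * X\<rfloor>. near_weight X n) * (2 / T * 2 powr b * (2 * X) * ln (2 * X)) \<le> 2 * 2 powr b * 2 * C1 * (2 * C1) * W" .
      have "2 * pi * 1 \<le> 2 * pi * T powr \<epsilon>" by (intro mult_left_mono T\<epsilon>) auto
      moreover have "2 powr b * (2 * arsinh (T / b)) \<le> 2 powr b * (C2 * T powr \<epsilon>)" using C2(2)[of T] T by (intro mult_left_mono) auto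
      ultimately have z: "2 powr b * (2 * arsinh (T / b)) + 2 * pi \<le> (2 powr b * C2 + 2 * pi) * T powr \<epsilon>"
        unfolding distrib_right mult.assoc[of _ C2] by linarith
      have "X powr (\<epsilon>/2) \<le> X powr \<epsilon>" using X2 \<epsilon> by (intro powr_mono) auto
      hence "C1 * X powr (\<epsilon>/2) \<le> C1 * X powr \<epsilon>" using C1(1) by simp
      hence lX': "ln (2 * X) \<le> C1 * X powr \<epsilon>" using lX by linarith
      have "2 * (ln (2 * X) * (2 powr b * (2 * arsinh (T / b)) + 2 * pi)) \<le> 2 * ((C1 * X powr \<epsilon>) * ((2 powr b * C2 + 2 * pi) * T powr \<epsilon>))"
        using lX' z ln0 Z0 C1(1) C2(1) by (intro mult_left_mono mult_mono) auto
      also have "\<dots> = 2 * C1 * (2 powr b * C2 + 2 * pi) * (X powr \<epsilon> * T powr \<epsilon>)" by (simp add: mult_ac)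
      also have "\<dots> \<le> 2 * C1 * (2 powr b * C2 + 2 * pi) * W" by (intro mult_left_mono W2) (use C1(1) C2(1) in auto)
      finally have p3: "2 * (ln (2 * X) * (2 powr b * (2 * arsinh (T / b)) + 2 * pi)) \<le> 2 * C1 * (2 powr b * C2 + 2 * pi) * W" .
      show ?thesis using add_mono[OF add_mono[OF p1 p2] p3] unfolding C_def W_def[symmetric] by (simp add: algebra_simps)
    qed
    finally show "norm (perron_line (1 + \<epsilon>) T (\<lambda>s. \<Sum>n. a n * of_nat n powr (-s)) X
             - 2 * pi * \<i> * (\<Sum>n | real n < X. a n)) \<le> C * (X powr (1 + \<epsilon>) * T powr (-1 + \<epsilon>))" by (simp add: F_def)
  qed
qed

section \<open>L-functions of real characters\<close>


global_interpretation kronecker_char: bounded_multiplicative "\<lambda>n. of_int (kronecker d n)" for d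
proof
  show "complex_of_int (kronecker d (Suc 0)) = 1" by (simp add: kronecker_1)
  show "0 < m \<Longrightarrow> 0 < n \<Longrightarrow> complex_of_int (kronecker d (m * n)) = of_int (kronecker d m) * of_int (kronecker d n)" for m n
    by (simp add: kronecker_mult)
  show "norm (complex_of_int (kronecker d n)) \<le> 1" for n
    using kronecker_values[of d n] by auto
qed

lemma L_kronecker_eq_dsum: "Re s > 1 \<Longrightarrow> L_kronecker d s = kronecker_char.dsum d s"
  unfolding L_kronecker_def
  by (subst kronecker_char.dsum_eq_suminf) (auto simp: kronecker_char.dterm_def powr_minus_divide)

section \<open>Abel summation: the L-series for Re s > 0\<close>

lemma summation_by_parts:
  fixes u k :: "nat \<Rightarrow> 'a::comm_ring"
  defines "S \<equiv> \<lambda>n. \<Sum>i<n. k i"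
  shows "(\<Sum>n<N. k n * u n) = S N * u N + (\<Sum>n<N. S (Suc n) * (u n - u (Suc n)))"
  by (induction N) (simp_all add: S_def algebra_simps)

definition kronecker_sum :: "int \<Rightarrow> nat \<Rightarrow> complex" where
  "kronecker_sum d n = (\<Sum>i<n. of_int (kronecker d (Suc i)))"

lemma norm_kronecker_sum_le:
  assumes "fundamental_discriminant d" "d > 1"
  shows "norm (kronecker_sum d n) \<le> 8 * real_of_int d"
proof -
  have "kronecker_sum d n = of_int (\<Sum>i<n. kronecker d (Suc i))" by (simp add: kronecker_sum_def)
  also have "norm \<dots> = real_of_int \<bar>\<Sum>i<n. kronecker d (Suc i)\<bar>" by (metis norm_of_int of_int_abs)
  also have "\<dots> \<le> real_of_int (8 * d)" using kronecker_partial_sums[OF assms] by (subst of_int_le_iff)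
  finally show ?thesis by simp
qed

text \<open>Consecutive differences of n powr (-s) are Taylor remainders of order 0 with s + 1 in
  place of s, so the bound from the continuation of zeta applies.\<close>

lemma norm_taylor_rem_0_le:
  assumes "Re s > 0"
  shows "norm (taylor_rem 0 n (s + 1)) \<le> norm s * real (Suc n) powr (- Re s - 1)"
proof -
  have "taylor_coeff (Suc 0) (s + 1) = - s" by (simp add: taylor_coeff_def)
  thus ?thesis using norm_taylor_rem_le[of 0 "s + 1" n] assms by simp
qed

text \<open>Summation by parts against the bounded character sums turns the series into an
  absolutely convergent one, with terms O(n powr (- Re s - 1)).\<close>

lemma L_kronecker_sums:
  assumes d: "fundamental_discriminant d" "d > 1" and s: "Re s > 0"
  shows "(\<lambda>n. kronecker_sum d (Suc n) * (- taylor_rem 0 n (s + 1))) sums L_kronecker d s"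
proof -
  define u where "u = (\<lambda>n. of_nat (Suc n) powr (-s) :: complex)"
  have du: "u n - u (Suc n) = - taylor_rem 0 n (s + 1)" for n
    by (simp add: u_def taylor_rem_def taylor_coeff_def)
  let ?t = "\<lambda>n. kronecker_sum d (Suc n) * (- taylor_rem 0 n (s + 1))"
  have "summable (\<lambda>n. 8 * real_of_int d * (norm s * real (Suc n) powr (- Re s - 1)))"
    using s by (intro summable_mult, subst summable_Suc_iff) (auto simp: summable_real_powr_iff)
  moreover have "norm (?t n) \<le> 8 * real_of_int d * (norm s * real (Suc n) powr (- Re s - 1))" for n
    unfolding norm_mult norm_minus_cancel
    by (intro mult_mono norm_kronecker_sum_le d norm_taylor_rem_0_le s) (use d in auto)
  ultimately have summ: "summable ?t" by (rule summable_comparison_test'[of _ 0])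
  have "(\<lambda>N. kronecker_sum d N * u N) \<longlonglongrightarrow> 0"
  proof (rule Lim_null_comparison[OF always_eventually])
    show "\<forall>N. norm (kronecker_sum d N * u N) \<le> 8 * real_of_int d * real (Suc N) powr (- Re s)"
    proof
      fix N
      have "norm (u N) = real (Suc N) powr (- Re s)"
        using norm_powr_real_powr[of "of_nat (Suc N)" "-s"] by (simp add: u_def)
      thus "norm (kronecker_sum d N * u N) \<le> 8 * real_of_int d * real (Suc N) powr (- Re s)"
        unfolding norm_mult by (intro mult_mono norm_kronecker_sum_le d) (use d in auto)
    qed
    have "(\<lambda>N. real (Suc N) powr (- Re s)) \<longlonglongrightarrow> 0"
      using s by (intro tendsto_neg_powr filterlim_compose[OF filterlim_real_sequentially] filterlim_Suc) auto
    from tendsto_mult_right_zero[OF this] show "(\<lambda>N. 8 * real_of_int d * real (Suc N) powr (- Re s)) \<longlonglongrightarrow> 0" .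
  qed
  moreover have "(\<lambda>N. \<Sum>n<N. ?t n) \<longlonglongrightarrow> suminf ?t" using summ by (simp add: summable_sums[unfolded sums_def])
  ultimately have "(\<lambda>N. kronecker_sum d N * u N + (\<Sum>n<N. ?t n)) \<longlonglongrightarrow> 0 + suminf ?t" by (rule tendsto_add)
  moreover have "kronecker_sum d N * u N + (\<Sum>n<N. ?t n) = (\<Sum>n<N. of_int (kronecker d (Suc n)) * u n)" for N
    unfolding kronecker_sum_def du[symmetric]
    by (rule summation_by_parts[of "\<lambda>n. of_int (kronecker d (Suc n))" u N, symmetric])
  ultimately have "(\<lambda>n. of_int (kronecker d (Suc n)) * u n) sums suminf ?t" by (simp add: sums_def)
  hence "L_kronecker d s = suminf ?t"
    by (simp add: L_kronecker_def u_def powr_minus_divide sums_iff)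
  thus ?thesis using summ by (simp add: summable_sums)
qed

lemma L_kronecker_holomorphic:
  assumes d: "fundamental_discriminant d" "d > 1"
  shows "L_kronecker d holomorphic_on {s. Re s > 0}"
proof -
  let ?t = "\<lambda>n s. kronecker_sum d (Suc n) * (- taylor_rem 0 n (s + 1))"
  have "(\<lambda>s. \<Sum>n. ?t n s) holomorphic_on {s. Re s > 0}"
  proof (rule holomorphic_on_suminf[OF open_Re_gt])
    show "?t n holomorphic_on {s. Re s > 0}" for n
      unfolding taylor_rem_def taylor_coeff_def by (intro holomorphic_intros) auto
  next
    fix x assume x: "x \<in> {s. Re s > 0}"
    let ?r = "(Re x - 0) / 2"
    let ?M = "\<lambda>n. 8 * real_of_int d * ((norm x + ?r) * real (Suc n) powr (- (Re x - ?r) - 1))"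
    have "summable ?M" using x
      by (intro summable_mult, subst summable_Suc_iff) (auto simp: summable_real_powr_iff)
    moreover have "norm (?t n z) \<le> ?M n" if z: "z \<in> cball x ?r" for z n
    proof -
      have "Re z > 0" using cball_subset_Re_gt[of 0 x] x z by auto
      moreover have "norm z \<le> norm x + ?r" using z norm_triangle_sub[of z x] by (simp add: dist_norm norm_minus_commute)
      moreover have "real (Suc n) powr (- Re z - 1) \<le> real (Suc n) powr (- (Re x - ?r) - 1)"
        using cball_Re_bound[OF z] by (intro powr_mono) auto
      ultimately have "norm (taylor_rem 0 n (z + 1)) \<le> (norm x + ?r) * real (Suc n) powr (- (Re x - ?r) - 1)"
        by (intro order_trans[OF norm_taylor_rem_0_le] mult_mono) (auto intro: order_trans[OF norm_ge_zero])
      thus ?thesis unfolding norm_mult norm_minus_cancel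
        by (intro mult_mono norm_kronecker_sum_le d) (use d in auto)
    qed
    ultimately show "\<exists>r M. 0 < r \<and> cball x r \<subseteq> {s. Re s > 0} \<and> summable M
       \<and> (\<forall>n. \<forall>z\<in>cball x r. norm (?t n z) \<le> M n)"
      using x cball_subset_Re_gt[of 0 x] by (intro exI[of _ ?r] exI[of _ ?M]) auto
  qed
  thus ?thesis by (rule holomorphic_transform) (use L_kronecker_sums[OF d] in \<open>simp add: sums_iff\<close>)
qed

text \<open>The value zeta(3/2): the sum of n powr (- Re s - 1) at Re s = 1/2.\<close>

definition zeta_three_halves :: real where
  "zeta_three_halves = (\<Sum>n. real (Suc n) powr (- (3/2)))"

lemma zeta_three_halves_ge_1: "zeta_three_halves \<ge> 1"
proof -
  have "(\<Sum>n<1. real (Suc n) powr (- (3/2))) \<le> zeta_three_halves" unfolding zeta_three_halves_def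
    by (intro sum_le_suminf, subst summable_Suc_iff) (auto simp: summable_real_powr_iff)
  thus ?thesis by simp
qed

text \<open>Linear growth in d and |s| is enough, since only its logarithm survives in
  \<open>borel_caratheodory_logderiv\<close>.\<close>

lemma norm_L_kronecker_le:
  assumes d: "fundamental_discriminant d" "d > 1" and s: "Re s \<ge> 1/2"
  shows "norm (L_kronecker d s) \<le> 8 * real_of_int d * norm s * zeta_three_halves"
proof -
  have "(\<lambda>n. 8 * real_of_int d * norm s * real (Suc n) powr (- (3/2))) sums (8 * real_of_int d * norm s * zeta_three_halves)"
    unfolding zeta_three_halves_def
    by (intro sums_mult summable_sums, subst summable_Suc_iff) (auto simp: summable_real_powr_iff)
  moreover have "norm (kronecker_sum d (Suc n) * (- taylor_rem 0 n (s + 1))) \<le> 8 * real_of_int d * norm s * real (Suc n) powr (- (3/2))" for n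
  proof -
    have "norm (taylor_rem 0 n (s + 1)) \<le> norm s * real (Suc n) powr (- Re s - 1)"
      by (rule norm_taylor_rem_0_le) (use s in auto)
    also have "\<dots> \<le> norm s * real (Suc n) powr (- (3/2))"
      by (intro mult_left_mono powr_mono) (use s in auto)
    finally have "norm (kronecker_sum d (Suc n)) * norm (taylor_rem 0 n (s + 1)) \<le>
       8 * real_of_int d * (norm s * real (Suc n) powr (- (3/2)))"
      by (intro mult_mono norm_kronecker_sum_le d) (use d in auto)
    thus ?thesis by (simp add: norm_mult mult.assoc)
  qed
  moreover have "(\<lambda>n. kronecker_sum d (Suc n) * (- taylor_rem 0 n (s + 1))) sums L_kronecker d s"
    using L_kronecker_sums[OF d] s by simp
  ultimately show ?thesis using norm_sums_le by blast
qed

text \<open>Comparison with the telescoping 1 / (n - 1) - 1 / n from n = 3 on. What matters is a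
  value below 1: it keeps L(s, chi_d) away from 0 on Re s = 2.\<close>

lemma sum_inverse_squares_from_2: "(\<Sum>\<^sub>\<infinity>n\<in>{2..}. real n powr (-2)) \<le> 3/4"
proof (rule infsum_le_finite_sums)
  show "(\<lambda>n. real n powr (-2)) summable_on {2..}" by (rule powr_neg_summable_on) auto
  fix F :: "nat set" assume F: "finite F" "F \<subseteq> {2..}"
  have bd: "(\<Sum>n\<in>{2..N+2}. real n powr (-2)) \<le> 3/4 - 1 / real (N + 2)" for N
  proof (induction N)
    case 0 show ?case by (simp add: powr_minus powr_numeral)
  next
    case (Suc N)
    have "1 / (real N + 3)^2 \<le> 1 / ((real N + 2) * (real N + 3))"
      unfolding power2_eq_square by (intro frac_le mult_right_mono) auto
    also have "\<dots> = 1 / real (N + 2) - 1 / real (N + 3)" by (simp add: field_simps)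
    finally have "1 / (real N + 3)^2 \<le> 1 / real (N + 2) - 1 / real (N + 3)" .
    hence "real (Suc N + 2) powr (-2) \<le> 1 / real (N + 2) - 1 / real (Suc N + 2)"
      by (simp add: powr_minus_divide powr_numeral add_ac)
    thus ?case using Suc.IH by simp
  qed
  obtain N where N: "F \<subseteq> {..N}" using F finite_nat_set_iff_bounded_le[of F] by auto
  have "(\<Sum>n\<in>F. real n powr (-2)) \<le> (\<Sum>n\<in>{2..N+2}. real n powr (-2))"
  proof (rule sum_mono2)
    show "F \<subseteq> {2..N + 2}" using F(2) N by fastforce
  qed auto
  also have "\<dots> \<le> 3/4" by (rule order_trans[OF bd]) simp
  finally show "(\<Sum>n\<in>F. real n powr (-2)) \<le> 3/4" .
qed

text \<open>With N = 2 no prime has been sieved out, and the error of the Euler product is just the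
  sum over n >= 2.\<close>

lemma norm_L_kronecker_2_ge:
  assumes "Re s = 2" shows "norm (L_kronecker d s) \<ge> 1/4"
proof -
  have e: "{p. p < 2 \<and> prime p} = ({} :: nat set)" by (auto dest: prime_ge_2_nat)
  hence "norm (L_kronecker d s - 1) \<le> (\<Sum>\<^sub>\<infinity>n\<in>{2..}. real n powr (-2))"
    using kronecker_char.euler_product_error[of 2 s d 2] assms unfolding e by (simp add: L_kronecker_eq_dsum)
  hence "norm (L_kronecker d s - 1) \<le> 3/4" using sum_inverse_squares_from_2 by linarith
  thus ?thesis using norm_triangle_ineq2[of 1 "1 - L_kronecker d s"] by (simp add: norm_minus_commute)
qed

text \<open>Let g be a logarithm of f. The real part of g - g(s0) stays below M, so the Schwarz
  lemma bounds g - g(s0) itself, and Cauchy's inequality on a circle of radius (R - r) / 2 bounds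
  its derivative f'/f. Only the logarithm of the growth of f enters, so a polynomial bound for L
  yields a logarithmic one for L'/L.\<close>

lemma borel_caratheodory_logderiv:
  assumes R: "0 < r" "r < R" and M: "M > 0"
    and hol: "f holomorphic_on ball s0 R" and nz: "\<And>z. z \<in> ball s0 R \<Longrightarrow> f z \<noteq> 0"
    and bd: "\<And>z. z \<in> ball s0 R \<Longrightarrow> norm (f z) < exp M * norm (f s0)"
    and z: "norm (z - s0) \<le> r"
  shows "norm (deriv f z / f z) \<le> 8 * R / (R - r)\<^sup>2 * M"
proof -
  obtain g where g: "g holomorphic_on ball s0 R" "\<And>z. z \<in> ball s0 R \<Longrightarrow> f z = exp (g z)"
    using contractible_imp_holomorphic_log[OF hol convex_imp_contractible[OF convex_ball]] nz by metis
  define h where "h = (\<lambda>\<xi>. g (s0 + of_real R * \<xi>) - g s0)"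
  have inb: "s0 + of_real R * \<xi> \<in> ball s0 R" if "norm \<xi> < 1" for \<xi>
    using that R by (simp add: dist_norm norm_mult)
  have Reh: "Re (h \<xi>) < M" if "norm \<xi> < 1" for \<xi>
  proof -
    have "norm (f (s0 + of_real R * \<xi>)) < exp M * norm (f s0)" by (rule bd[OF inb[OF that]])
    hence "exp (Re (g (s0 + of_real R * \<xi>))) < exp (M + Re (g s0))"
      using g(2)[OF inb[OF that]] g(2)[of s0] R by (simp add: exp_add)
    thus ?thesis by (simp add: h_def)
  qed
  have ne: "2 * of_real M - h \<xi> \<noteq> 0" if "norm \<xi> < 1" for \<xi>
  proof
    assume "2 * of_real M - h \<xi> = 0"
    hence "Re (h \<xi>) = 2 * M" by (metis Re_complex_of_real eq_iff_diff_eq_0 of_real_mult of_real_numeral)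
    thus False using Reh[OF that] M by simp
  qed
  \<comment> \<open>This Moebius map sends the half-plane of real part below M to the unit disc and
    0 to 0.\<close>
  define \<phi> where "\<phi> = (\<lambda>\<xi>. h \<xi> / (2 * of_real M - h \<xi>))"
  have h_hol: "h holomorphic_on ball 0 1" unfolding h_def
    by (intro holomorphic_intros holomorphic_on_compose_gen[OF _ g(1), unfolded o_def]) (use inb in auto)
  have \<phi>_hol: "\<phi> holomorphic_on ball 0 1" unfolding \<phi>_def
    by (intro holomorphic_intros h_hol) (use ne in auto)
  have \<phi>_lt: "norm (\<phi> \<xi>) < 1" if "norm \<xi> < 1" for \<xi>
  proof -
    have "(norm (h \<xi>))\<^sup>2 < (norm (2 * of_real M - h \<xi>))\<^sup>2"
    proof -
      have "(norm (2 * of_real M - h \<xi>))\<^sup>2 = (norm (h \<xi>))\<^sup>2 + 4 * M * (M - Re (h \<xi>))"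
        by (simp only: cmod_power2) (simp add: power2_eq_square algebra_simps)
      moreover have "4 * M * (M - Re (h \<xi>)) > 0" using Reh[OF that] M by simp
      ultimately show ?thesis by simp
    qed
    hence "norm (h \<xi>) < norm (2 * of_real M - h \<xi>)" using power2_less_imp_less norm_ge_zero by blast
    thus ?thesis using ne[OF that] by (simp add: \<phi>_def norm_divide)
  qed
  have \<phi>_le: "norm (\<phi> \<xi>) \<le> norm \<xi>" if "norm \<xi> < 1" for \<xi>
    by (rule Schwarz_Lemma(1)[OF \<phi>_hol _ _ that]) (use \<phi>_lt in \<open>auto simp: \<phi>_def h_def\<close>)
  have h_le: "norm (h \<xi>) \<le> 2 * M * norm \<xi> / (1 - norm \<xi>)" if "norm \<xi> < 1" for \<xi>
  proof -
    have "h \<xi> * (1 + \<phi> \<xi>) = 2 * of_real M * \<phi> \<xi>" using ne[OF that] by (simp add: \<phi>_def field_simps)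
    hence "norm (h \<xi>) * norm (1 + \<phi> \<xi>) = 2 * M * norm (\<phi> \<xi>)" using M by (metis (no_types) norm_mult norm_of_real norm_numeral abs_of_pos)
    moreover have "norm (1 + \<phi> \<xi>) \<ge> 1 - norm \<xi>"
      using norm_triangle_ineq2[of 1 "- \<phi> \<xi>"] \<phi>_le[OF that] by simp
    hence "norm (h \<xi>) * (1 - norm \<xi>) \<le> norm (h \<xi>) * norm (1 + \<phi> \<xi>)" by (intro mult_left_mono) auto
    moreover have "2 * M * norm (\<phi> \<xi>) \<le> 2 * M * norm \<xi>" using \<phi>_le[OF that] M by simp
    ultimately have "norm (h \<xi>) * (1 - norm \<xi>) \<le> 2 * M * norm \<xi>" by linarith
    thus ?thesis using that by (simp add: field_simps)
  qed
  define \<rho> where "\<rho> = (R - r) / 2"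
  have \<rho>: "\<rho> > 0" using R by (simp add: \<rho>_def)
  have sub: "cball z \<rho> \<subseteq> ball s0 R"
  proof
    fix w assume "w \<in> cball z \<rho>"
    hence "norm (w - s0) \<le> \<rho> + r" using norm_triangle_ineq[of "w - z" "z - s0"] z by (simp add: dist_norm norm_minus_commute)
    thus "w \<in> ball s0 R" using R by (simp add: dist_norm norm_minus_commute \<rho>_def field_simps)
  qed
  have gb: "norm (g w - g s0) \<le> 4 * M * R / (R - r)" if w: "norm (z - w) = \<rho>" for w
  proof -
    let ?\<xi> = "(w - s0) / of_real R"
    have "norm (w - s0) \<le> \<rho> + r" using norm_triangle_ineq[of "w - z" "z - s0"] z w by (simp add: norm_minus_commute)
    hence n: "norm ?\<xi> \<le> (R + r) / (2 * R)" using R by (simp add: norm_divide \<rho>_def field_simps)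
    have "(R + r) / (2 * R) < 1" using R by (simp add: field_simps)
    hence n1: "norm ?\<xi> < 1" using n by linarith
    have "norm (h ?\<xi>) \<le> 2 * M * norm ?\<xi> / (1 - norm ?\<xi>)" by (rule h_le[OF n1])
    also have "\<dots> \<le> 2 * M * 1 / (1 - (R + r) / (2 * R))"
      using n n1 M \<open>(R + r) / (2 * R) < 1\<close> by (intro frac_le mult_mono) auto
    also have "\<dots> = 4 * M * R / (R - r)" using R by (simp add: field_simps)
    finally show ?thesis using R by (simp add: h_def)
  qed
  have "norm ((deriv ^^ 1) (\<lambda>w. g w - g s0) z) \<le> fact 1 * (4 * M * R / (R - r)) / \<rho> ^ 1"
  proof (rule Cauchy_inequality)
    show "(\<lambda>w. g w - g s0) holomorphic_on ball z \<rho>"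
      using sub by (intro holomorphic_intros holomorphic_on_subset[OF g(1)]) auto
    show "continuous_on (cball z \<rho>) (\<lambda>w. g w - g s0)"
      using sub by (intro continuous_intros continuous_on_subset[OF holomorphic_on_imp_continuous_on[OF g(1)]]) auto
  qed (use \<rho> gb in auto)
  moreover have zin: "z \<in> ball s0 R" using z R by (simp add: dist_norm norm_minus_commute)
  hence gd: "(g has_field_derivative deriv g z) (at z)" using g(1) holomorphic_derivI[OF g(1) open_ball] by blast
  have "deriv (\<lambda>w. g w - g s0) z = deriv g z"
    by (rule DERIV_imp_deriv) (use gd in \<open>auto intro!: derivative_eq_intros\<close>)
  moreover have "deriv f z = exp (g z) * deriv g z"
  proof -
    have "((\<lambda>z. exp (g z)) has_field_derivative exp (g z) * deriv g z) (at z)"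
      using gd by (auto intro!: derivative_eq_intros)
    moreover have "\<forall>\<^sub>F w in nhds z. f w = exp (g w)"
      using eventually_nhds_in_open[OF open_ball zin] by (rule eventually_mono) (use g(2) in auto)
    ultimately show ?thesis using deriv_cong_ev[of f "\<lambda>z. exp (g z)" z z] DERIV_imp_deriv by metis
  qed
  hence "deriv f z / f z = deriv g z" using g(2)[OF zin] by simp
  ultimately show ?thesis using R by (simp add: \<rho>_def power2_eq_square field_simps)
qed

lemma ln_conductor_ge_1:
  assumes "d > (1::int)"
  shows "real_of_int d * (\<bar>t\<bar> + 2) \<ge> 4" "ln (real_of_int d * (\<bar>t\<bar> + 2)) \<ge> 1"
proof -
  show Q: "real_of_int d * (\<bar>t\<bar> + 2) \<ge> 4"
    using assms mult_mono[of 2 "real_of_int d" 2 "\<bar>t\<bar> + 2"] by auto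
  have "exp 1 \<le> (3::real)" by (rule exp_le)
  thus "ln (real_of_int d * (\<bar>t\<bar> + 2)) \<ge> 1" using Q by (subst ln_ge_iff) auto
qed

text \<open>Discs about 2 + i Im s: radius R reaches down to Re = 1/2 + \<epsilon>/2, inside the
  region without zeros, and radius r to Re = 1/2 + \<epsilon>.\<close>

lemma logderiv_L_kronecker_bound:
  assumes grh: "\<And>d s. fundamental_discriminant d \<Longrightarrow> d > 1 \<Longrightarrow> Re s > 1/2 \<Longrightarrow> L_kronecker d s \<noteq> 0"
    and \<epsilon>: "0 < \<epsilon>" "\<epsilon> < 1"
  obtains C where "C > 0" "\<And>d s. fundamental_discriminant d \<Longrightarrow> d > 1 \<Longrightarrow> 1/2 + \<epsilon> \<le> Re s \<Longrightarrow> Re s \<le> 2 \<Longrightarrow>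
     norm (deriv (L_kronecker d) s / L_kronecker d s) \<le> C * ln (real_of_int d * (\<bar>Im s\<bar> + 2))"
proof -
  define R where "R = 3/2 - \<epsilon>/2"
  define r where "r = 3/2 - \<epsilon>"
  have Rr: "0 < r" "r < R" using \<epsilon> by (auto simp: R_def r_def)
  \<comment> \<open>On the disc |L| is at most 8 d times 2 (|Im s| + 2) times zeta(3/2), and at the
    centre |L| exceeds 1/8; the product of 8, 2 and 8 is 128.\<close>
  define k where "k = ln (128 * zeta_three_halves)"
  have k0: "k \<ge> 0" using zeta_three_halves_ge_1 by (simp add: k_def)
  define C where "C = 8 * R / (R - r)\<^sup>2 * (k + 2)"
  have "C > 0" unfolding C_def using Rr k0 by (intro mult_pos_pos divide_pos_pos) auto
  thus thesis
  proof (rule that)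
    fix d s assume d: "fundamental_discriminant d" "d > 1" and s: "1/2 + \<epsilon> \<le> Re s" "Re s \<le> 2"
    define s0 where "s0 = Complex 2 (Im s)"
    let ?Q = "real_of_int d * (\<bar>Im s\<bar> + 2)"
    note Q = ln_conductor_ge_1(1)[OF d(2), of "Im s"] and lnQ = ln_conductor_ge_1(2)[OF d(2), of "Im s"]
    define M where "M = k + 1 + ln ?Q"
    have M: "M > 0" using k0 lnQ by (simp add: M_def)
    have Reball: "Re z > 1/2" if "z \<in> ball s0 R" for z
      using that abs_Re_le_cmod[of "s0 - z"] \<epsilon> by (auto simp: dist_norm s0_def R_def)
    have "norm (deriv (L_kronecker d) s / L_kronecker d s) \<le> 8 * R / (R - r)\<^sup>2 * M"
    proof (rule borel_caratheodory_logderiv[OF Rr M, of _ s0])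
      show "L_kronecker d holomorphic_on ball s0 R"
        by (rule holomorphic_on_subset[OF L_kronecker_holomorphic[OF d]]) (use Reball in force)
      show "L_kronecker d z \<noteq> 0" if "z \<in> ball s0 R" for z using grh[OF d Reball[OF that]] .
      have "s - s0 = of_real (Re s - 2)" by (simp add: s0_def complex_eq_iff)
      hence "norm (s - s0) = \<bar>Re s - 2\<bar>" by (metis norm_of_real)
      thus "norm (s - s0) \<le> r" using s by (simp add: r_def)
      fix z assume z: "z \<in> ball s0 R"
      have "norm z \<le> norm s0 + R" using z norm_triangle_ineq2[of z s0] by (simp add: dist_norm norm_minus_commute)
      moreover have "norm s0 \<le> 2 + \<bar>Im s\<bar>" using cmod_le[of s0] by (simp add: s0_def)
      ultimately have nz: "norm z \<le> 2 * (\<bar>Im s\<bar> + 2)" using \<epsilon> by (simp add: R_def)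
      have "norm (L_kronecker d z) \<le> 8 * real_of_int d * norm z * zeta_three_halves"
        by (rule norm_L_kronecker_le[OF d]) (use Reball[OF z] in auto)
      also have "\<dots> \<le> 8 * real_of_int d * (2 * (\<bar>Im s\<bar> + 2)) * zeta_three_halves"
        using nz d zeta_three_halves_ge_1 by (intro mult_right_mono mult_left_mono) auto
      also have "\<dots> = 128 * zeta_three_halves * ?Q * (1/8)" by simp
      also have "\<dots> < 128 * zeta_three_halves * ?Q * norm (L_kronecker d s0)"
        using norm_L_kronecker_2_ge[of s0 d] Q zeta_three_halves_ge_1 d by (intro mult_strict_left_mono mult_pos_pos) (auto simp: s0_def)
      also have "\<dots> \<le> exp M * norm (L_kronecker d s0)"
      proof (intro mult_right_mono)
        have "exp M = exp k * exp 1 * exp (ln ?Q)" by (simp add: M_def exp_add)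
        also have "\<dots> = 128 * zeta_three_halves * ?Q * exp 1"
          using zeta_three_halves_ge_1 Q by (simp add: k_def)
        finally show "128 * zeta_three_halves * ?Q \<le> exp M"
          using mult_left_mono[of 1 "exp 1 :: real" "128 * zeta_three_halves * ?Q"] zeta_three_halves_ge_1 Q by simp
      qed auto
      finally show "norm (L_kronecker d z) < exp M * norm (L_kronecker d s0)" .
    qed
    also have "M \<le> (k + 2) * ln ?Q" using mult_left_mono[OF lnQ, of "k + 1"] k0 by (simp add: M_def algebra_simps)
    hence "8 * R / (R - r)\<^sup>2 * M \<le> 8 * R / (R - r)\<^sup>2 * ((k + 2) * ln ?Q)" using Rr by (intro mult_left_mono) auto
    finally show "norm (deriv (L_kronecker d) s / L_kronecker d s) \<le> C * ln ?Q" by (simp add: C_def mult.assoc)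
  qed
qed

section \<open>Nonvanishing from the ratios conjecture\<close>


lemma norm_inverse_prime_powr_le:
  assumes p: "prime (p::nat)" and s: "Re s \<ge> \<sigma>" "\<sigma> > 0"
  shows "norm (1 / (of_nat p powr (2 * s) - 1)) \<le> real p powr (-2 * \<sigma>) / (1 - 2 powr (-2 * \<sigma>))"
    and "of_nat p powr (2 * s) - 1 \<noteq> (0::complex)"
proof -
  have p2: "real p \<ge> 2" using prime_ge_2_nat[OF p] by simp
  have c: "1 - 2 powr (-2 * \<sigma>) > (0::real)" using s by (simp add: powr_less_one)
  have "real p powr (2 * \<sigma>) \<le> norm (of_nat p powr (2 * s) :: complex)"
    using norm_powr_real_powr[of "of_nat p" "2 * s"] p2 s by (simp add: powr_mono)
  hence "real p powr (2 * \<sigma>) - 1 \<le> norm (of_nat p powr (2 * s) - 1 :: complex)"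
    using norm_triangle_ineq2[of "of_nat p powr (2 * s)" "1 :: complex"] by simp
  moreover have "real p powr (2 * \<sigma>) * (1 - 2 powr (-2 * \<sigma>)) \<le> real p powr (2 * \<sigma>) * (1 - real p powr (-2 * \<sigma>))"
    using powr_mono2'[of "-2 * \<sigma>" 2 "real p"] p2 s by (intro mult_left_mono) auto
  moreover have "real p powr (2 * \<sigma>) * (1 - real p powr (-2 * \<sigma>)) = real p powr (2 * \<sigma>) - 1"
    using p2 by (simp add: right_diff_distrib powr_add[symmetric])
  ultimately have le: "real p powr (2 * \<sigma>) * (1 - 2 powr (-2 * \<sigma>)) \<le> norm (of_nat p powr (2 * s) - 1 :: complex)" by linarith
  have pos: "real p powr (2 * \<sigma>) * (1 - 2 powr (-2 * \<sigma>)) > 0" using p2 c by simp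
  thus "of_nat p powr (2 * s) - 1 \<noteq> (0::complex)" using le by auto
  have "1 / norm (of_nat p powr (2 * s) - 1 :: complex) \<le> 1 / (real p powr (2 * \<sigma>) * (1 - 2 powr (-2 * \<sigma>)))"
    using le pos by (intro frac_le) auto
  also have "\<dots> = real p powr (-2 * \<sigma>) / (1 - 2 powr (-2 * \<sigma>))" using p2 by (simp add: powr_minus_divide)
  finally show "norm (1 / (of_nat p powr (2 * s) - 1)) \<le> real p powr (-2 * \<sigma>) / (1 - 2 powr (-2 * \<sigma>))"
    by (simp add: norm_divide)
qed

text \<open>The factor 1 / (p + 1) is the asymptotic proportion of fundamental discriminants
  divisible by p. It makes the series converge for Re s > 0, whereas that of zeta'/zeta(2 s) needs
  Re s > 1/2.\<close>

definition density_term :: "nat \<Rightarrow> complex \<Rightarrow> complex" where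
  "density_term p s = (if prime p then of_real (ln (real p)) / ((of_nat p + 1) * (of_nat p powr (2 * s) - 1)) else 0)"

definition density_series :: "complex \<Rightarrow> complex" where
  "density_series s = (\<Sum>p. density_term p s)"

definition density_majorant :: "real \<Rightarrow> nat \<Rightarrow> real" where
  "density_majorant \<sigma> p = ln (real p) * real p powr (-(1 + 2 * \<sigma>)) / (1 - 2 powr (-2 * \<sigma>))"

lemma density_majorant_summable: "\<sigma> > 0 \<Longrightarrow> summable (density_majorant \<sigma>)"
  unfolding density_majorant_def by (intro summable_divide ln_powr_neg_summable) simp

lemma norm_density_term_le:
  assumes "Re s \<ge> \<sigma>" "\<sigma> > 0" shows "norm (density_term p s) \<le> density_majorant \<sigma> p"
proof (cases "prime p")
  case True
  have p2: "real p \<ge> 2" using prime_ge_2_nat[OF True] by simp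
  have n1: "norm (of_nat p + 1 :: complex) = real p + 1" by (metis norm_of_nat of_nat_Suc add.commute)
  have "norm (density_term p s) = ln (real p) / (real p + 1) * norm (1 / (of_nat p powr (2 * s) - 1) :: complex)"
    using True p2 by (simp add: density_term_def norm_mult norm_divide n1)
  also have "\<dots> \<le> ln (real p) / real p * (real p powr (-2 * \<sigma>) / (1 - 2 powr (-2 * \<sigma>)))"
    by (intro mult_mono norm_inverse_prime_powr_le True assms frac_le) (use p2 in auto)
  also have "\<dots> = density_majorant \<sigma> p"
  proof -
    have "real p powr (-1 + -2 * \<sigma>) = real p powr (-1) * real p powr (-2 * \<sigma>)" by (rule powr_add)
    moreover have "-(1 + 2 * \<sigma>) = -1 + -2 * \<sigma>" by simp
    moreover have "real p powr (-1) = 1 / real p" using p2 by (simp add: powr_minus_divide)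
    ultimately show ?thesis by (simp only: density_majorant_def times_divide_eq_right times_divide_eq_left mult_1 mult.assoc)
  qed
  finally show ?thesis .
next
  case False
  have "2 powr (-2 * \<sigma>) < (1::real)" using assms by (simp add: powr_less_one)
  moreover have "ln (real p) \<ge> 0" by (cases "p = 0") auto
  ultimately show ?thesis using False by (simp add: density_term_def density_majorant_def)
qed

lemma density_term_summable:
  assumes "Re s > 0" shows "summable (\<lambda>p. norm (density_term p s))"
  by (rule summable_comparison_test'[OF density_majorant_summable[of "Re s"], of 0])
     (use assms norm_density_term_le in auto)

lemma norm_density_series_le:
  assumes "\<sigma> > 0" obtains B where "B \<ge> 0" "\<And>s. Re s \<ge> \<sigma> \<Longrightarrow> norm (density_series s) \<le> B"
proof
  have bd: "norm (density_series s) \<le> suminf (density_majorant \<sigma>)" if "Re s \<ge> \<sigma>" for s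
    unfolding density_series_def
    by (rule norm_suminf_le) (use that assms norm_density_term_le density_majorant_summable in auto)
  thus "Re s \<ge> \<sigma> \<Longrightarrow> norm (density_series s) \<le> suminf (density_majorant \<sigma>)" for s .
  show "suminf (density_majorant \<sigma>) \<ge> 0" by (rule order_trans[OF norm_ge_zero bd[of "of_real \<sigma>"]]) simp
qed

lemma density_series_holomorphic: "density_series holomorphic_on {s. Re s > 0}"
  unfolding density_series_def
proof (rule holomorphic_on_suminf[OF open_Re_gt])
  show "density_term n holomorphic_on {s. Re s > 0}" for n
  proof (cases "prime n")
    case True
    have "(of_nat n + 1 :: complex) \<noteq> 0" using of_nat_neq_0[of n, where 'a = complex] by (simp add: add.commute)
    hence "(\<lambda>s. of_real (ln (real n)) / ((of_nat n + 1) * (of_nat n powr (2 * s) - 1))) holomorphic_on {s. Re s > 0}"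
      using norm_inverse_prime_powr_le(2)[OF True order_refl] True prime_gt_0_nat[OF True]
      by (intro holomorphic_intros) auto
    thus ?thesis using True by (simp add: density_term_def[abs_def])
  qed (simp add: density_term_def[abs_def])
next
  fix x assume x: "x \<in> {s. Re s > 0}"
  let ?r = "(Re x - 0) / 2"
  have "\<forall>n. \<forall>z\<in>cball x ?r. norm (density_term n z) \<le> density_majorant ?r n"
    using x cball_Re_bound[of _ x ?r] by (auto intro!: norm_density_term_le)
  thus "\<exists>r M. 0 < r \<and> cball x r \<subseteq> {s. Re s > 0} \<and> summable M
       \<and> (\<forall>n. \<forall>z\<in>cball x r. norm (density_term n z) \<le> M n)"
    using x cball_subset_Re_gt[of 0 x] density_majorant_summable[of ?r]
    by (intro exI[of _ ?r] exI[of _ "density_majorant ?r"]) auto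
qed

lemma infsum_primes_eq_density_series:
  assumes "Re s > 0"
  shows "(\<Sum>\<^sub>\<infinity>p\<in>{p::nat. prime p}. of_real (ln (real p)) / ((of_nat p + 1) * (of_nat p powr (2 * s) - 1)))
     = density_series s"
proof -
  have "(\<Sum>\<^sub>\<infinity>p\<in>{p::nat. prime p}. of_real (ln (real p)) / ((of_nat p + 1) * (of_nat p powr (2 * s) - 1)))
     = (\<Sum>\<^sub>\<infinity>p. density_term p s)"
    by (rule infsum_cong_neutral) (auto simp: density_term_def)
  also have "\<dots> = density_series s" unfolding density_series_def
    using norm_summable_imp_has_sum[OF density_term_summable[OF assms]] summable_norm_cancel[OF density_term_summable[OF assms]]
    by (intro infsumI) (simp add: summable_sums)
  finally show ?thesis .
qed

text \<open>Here k is the order of vanishing at z0. It is stated as a limit so that it can be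
  inserted into the ratios formula, multiplied by z - z0, as z tends to z0. The point w rules out f
  = 0.\<close>

lemma logderiv_residue:
  assumes hol: "f holomorphic_on S" and S: "open S" "connected S" "z0 \<in> S" and w: "w \<in> S" "f w \<noteq> 0"
  shows "\<exists>k::nat. ((\<lambda>z. (z - z0) * (deriv f z / f z)) \<longlongrightarrow> of_nat k) (at z0) \<and> (f z0 = 0 \<longrightarrow> k > 0)"
proof (cases "f z0 = 0")
  case False
  have "isCont f z0" using hol S holomorphic_on_imp_continuous_on continuous_on_eq_continuous_at by blast
  moreover have "isCont (deriv f) z0"
    using holomorphic_deriv[OF hol S(1)] S holomorphic_on_imp_continuous_on continuous_on_eq_continuous_at by blast
  ultimately have "((\<lambda>z. (z - z0) * (deriv f z / f z)) \<longlongrightarrow> (z0 - z0) * (deriv f z0 / f z0)) (at z0)"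
    using False unfolding isCont_def by (intro tendsto_intros) auto
  thus ?thesis using False by (intro exI[of _ 0]) auto
next
  case True
  have "\<not> f constant_on S" using True w S unfolding constant_on_def by metis
  note factor = holomorphic_factor_zero_nonconstant[OF hol S True this]
  show ?thesis
  proof (rule factor)
  fix g r and n :: nat
  assume n: "0 < n" "0 < r" "ball z0 r \<subseteq> S" "g holomorphic_on ball z0 r"
      "\<And>w. w \<in> ball z0 r \<Longrightarrow> f w = (w - z0) ^ n * g w" "\<And>w. w \<in> ball z0 r \<Longrightarrow> g w \<noteq> 0"
  have z0: "z0 \<in> ball z0 r" using n by simp
  have eq: "(z - z0) * (deriv f z / f z) = of_nat n + (z - z0) * (deriv g z / g z)" if z: "z \<in> ball z0 r" "z \<noteq> z0" for z
  proof -
    have gd: "(g has_field_derivative deriv g z) (at z)" using n(4) z holomorphic_derivI open_ball by blast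
    have "((\<lambda>z. (z - z0) ^ n * g z) has_field_derivative of_nat n * (z - z0) ^ (n - 1) * g z + (z - z0) ^ n * deriv g z) (at z)"
      using gd by (auto intro!: derivative_eq_intros)
    moreover have "\<forall>\<^sub>F w in nhds z. f w = (w - z0) ^ n * g w"
      using eventually_nhds_in_open[OF open_ball z(1)] by (rule eventually_mono) (use n(5) in auto)
    ultimately have "deriv f z = of_nat n * (z - z0) ^ (n - 1) * g z + (z - z0) ^ n * deriv g z"
      using deriv_cong_ev[of f "\<lambda>z. (z - z0) ^ n * g z" z z] DERIV_imp_deriv by metis
    moreover have "(z - z0) ^ n = (z - z0) * (z - z0) ^ (n - 1)" using n(1) by (cases n) auto
    moreover have "w * ((m * P * G + w * P * G') / (w * P * G)) = m + w * (G' / G)"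
      if "w \<noteq> 0" "P \<noteq> 0" "G \<noteq> 0" for w m P G G' :: complex using that by (simp add: field_simps)
    from this[of "z - z0" "(z - z0) ^ (n - 1)" "g z" "of_nat n" "deriv g z"]
    have "(z - z0) * ((of_nat n * (z - z0) ^ (n - 1) * g z + (z - z0) * (z - z0) ^ (n - 1) * deriv g z) /
        ((z - z0) * (z - z0) ^ (n - 1) * g z)) = of_nat n + (z - z0) * (deriv g z / g z)"
      using n(6)[OF z(1)] z(2) by simp
    ultimately show ?thesis using n(5)[OF z(1)] by simp
  qed
  have "isCont g z0" "isCont (deriv g) z0"
    using n(4) z0 holomorphic_deriv[OF n(4) open_ball] holomorphic_on_imp_continuous_on continuous_on_eq_continuous_at open_ball by blast+
  hence "((\<lambda>z. of_nat n + (z - z0) * (deriv g z / g z)) \<longlongrightarrow> of_nat n + (z0 - z0) * (deriv g z0 / g z0)) (at z0)"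
    using n(6)[OF z0] unfolding isCont_def by (intro tendsto_intros) auto
  moreover have "\<forall>\<^sub>F z in at z0. of_nat n + (z - z0) * (deriv g z / g z) = (z - z0) * (deriv f z / f z)"
    using eventually_at_in_open[OF open_ball z0] by (rule eventually_mono) (use eq in auto)
  ultimately have "((\<lambda>z. (z - z0) * (deriv f z / f z)) \<longlongrightarrow> of_nat n) (at z0)"
    by (subst (asm) tendsto_cong) auto
  thus ?thesis using n(1) by blast
  qed
qed

text \<open>An odd prime p is itself a fundamental discriminant if p = 1 mod 4; otherwise 4 p is
  one.\<close>

lemma fundamental_discriminant_unbounded: "\<exists>d. fundamental_discriminant d \<and> real_of_int d > x"
proof -
  obtain p :: nat where p: "prime p" "nat \<lceil>\<bar>x\<bar>\<rceil> + 2 < p" using bigger_prime by blast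
  have px: "real p > x" using p(2) by linarith
  have sq: "squarefree (int p)" using p(1) squarefree_prime[of "int p"] by simp
  have "odd p" using p prime_odd_nat by simp
  show ?thesis
  proof (cases "p mod 4 = 1")
    case True
    have "int p mod 4 = 1" using True by presburger
    thus ?thesis using sq px by (intro exI[of _ "int p"]) (auto simp: fundamental_discriminant_def)
  next
    case False
    hence "int p mod 4 = 3" using \<open>odd p\<close> by presburger
    hence "fundamental_discriminant (4 * int p)" unfolding fundamental_discriminant_def using sq by blast
    moreover have "real_of_int (4 * int p) > x" using px by simp
    ultimately show ?thesis by blast
  qed
qed

lemma finite_discs_between: "finite (discs_between a b)"
proof (rule finite_subset)
  show "discs_between a b \<subseteq> {\<lfloor>a\<rfloor>..\<lceil>b\<rceil>}" unfolding discs_between_def by (auto; linarith)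
qed simp

text \<open>The part of the dual term common to all d. The nonvanishing proof allows it to be
  singular at the point considered.\<close>

definition dual_factor :: "complex \<Rightarrow> complex" where
  "dual_factor r = Gamma (1/4 - r/2) / Gamma (1/4 + r/2) * zeta (1 - 2 * r) * dual_euler_product r"

lemma ratios_main_term_eq:
  assumes "Re z > 1/2"
  shows "ratios_main_term d (z - 1/2) = deriv zeta (2 * z) / zeta (2 * z) + density_series z
           - of_real (real_of_int d / pi) powr (1/2 - z) * dual_factor (z - 1/2)"
proof -
  have e: "1 + 2 * (z - 1/2) = 2 * z" "- (z - 1/2) = 1/2 - z" by (simp_all add: algebra_simps)
  have "Re z > 0" using assms by simp
  from infsum_primes_eq_density_series[OF this] show ?thesis
    unfolding ratios_main_term_def e dual_factor_def by (simp only: mult.assoc)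
qed

text \<open>Multiply the ratios formula by \<open>z - s\<close> and let \<open>z \<rightarrow> s\<close>. The order \<open>k d\<close> of vanishing of
  \<open>L(\<cdot>, \<chi>_d)\<close> at \<open>s\<close> must be cancelled by the dual term, whose residue has modulus proportional
  to \<open>d powr (1/2 - Re s)\<close>. As this tends to 0 while \<open>k d\<close> is an integer, both vanish.\<close>

lemma L_kronecker_nonzero:
  assumes rc: "ratios_conjecture" and d: "fundamental_discriminant d" "d > 1" and s: "Re s > 1/2"
  shows "L_kronecker d s \<noteq> 0"
proof (cases "Re s > 1")
  case True
  thus ?thesis by (simp add: L_kronecker_eq_dsum kronecker_char.dsum_nonzero)
next
  case False
  define \<rho> where "\<rho> = Re s - 1/2"
  have \<rho>: "0 < \<rho>" "\<rho> \<le> 1/2" using s False by (auto simp: \<rho>_def)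
  define ld where "ld = (\<lambda>d z. deriv (L_kronecker d) z / L_kronecker d z)"
  define Q where "Q = (\<lambda>d z. of_real (real_of_int d / pi) powr (1/2 - z) :: complex)"
  \<comment> \<open>This does not depend on d. Its limit at s is the residue that would have to
    cancel the zeros.\<close>
  define A where "A = (\<lambda>z. (z - s) * dual_factor (z - 1/2))"
  have "\<exists>k::nat. ((\<lambda>z. (z - s) * ld d z) \<longlongrightarrow> of_nat k) (at s) \<and> (L_kronecker d s = 0 \<longrightarrow> k > 0)"
    if "fundamental_discriminant d" "d > 1" for d
    unfolding ld_def
  proof (rule logderiv_residue[OF L_kronecker_holomorphic[OF that] open_Re_gt])
    show "connected {s. Re s > 0}" by (intro convex_connected convex_halfspace_Re_gt)
    show "(2::complex) \<in> {s. Re s > 0}" by simp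
    show "L_kronecker d 2 \<noteq> 0" using norm_L_kronecker_2_ge[of 2 d] by auto
  qed (use s in auto)
  then obtain k :: "int \<Rightarrow> nat" where
    k: "\<And>d. fundamental_discriminant d \<Longrightarrow> d > 1 \<Longrightarrow> ((\<lambda>z. (z - s) * ld d z) \<longlongrightarrow> of_nat (k d)) (at s)"
       "\<And>d. fundamental_discriminant d \<Longrightarrow> d > 1 \<Longrightarrow> L_kronecker d s = 0 \<Longrightarrow> k d > 0" by metis
  \<comment> \<open>A bound near s for each fixed D is all that is needed, so \<delta> = 1 will do;
    \<eta> = 1/8 leaves room to the right of Re r = 1/2.\<close>
  have rc': "\<exists>B. \<forall>D>1. \<forall>r\<in>ratios_range 1 1 (1/8) (1/2) D. norm (ratios_remainder D r) \<le> B * D powr (1/2 + 1)"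
    using rc unfolding ratios_conjecture_def by (metis zero_less_one zero_less_divide_1_iff zero_less_numeral half_gt_zero_iff divide_less_eq_1_pos one_less_numeral_iff semiring_norm(76))
  then obtain B where B: "\<And>D r. D > 1 \<Longrightarrow> r \<in> ratios_range 1 1 (1/8) (1/2) D \<Longrightarrow> norm (ratios_remainder D r) \<le> B * D powr (1/2 + 1)"
    by blast
  \<comment> \<open>The first entry gives 1 / ln D <= \<rho> / 2 and the second |Im s| + 1 <= D powr
    (1/2), so that a punctured neighbourhood of s maps into \<open>ratios_range\<close>.\<close>
  define D0 where "D0 = max (exp (2 / \<rho>)) ((\<bar>Im s\<bar> + 1)\<^sup>2) + 2"
  have D02: "D0 \<ge> 2" using exp_gt_zero[of "2 / \<rho>"] by (simp add: D0_def le_max_iff_disj less_imp_le)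
  have lim: "((\<lambda>z. \<Sum>d\<in>discs_between 1 D. Q d z * A z) \<longlongrightarrow> - of_nat (\<Sum>d\<in>discs_between 1 D. k d)) (at s)"
    if D: "D \<ge> D0" for D
  proof -
    let ?F = "discs_between 1 D"
    have D1: "D > 1" using D D02 by simp
    have "2 / \<rho> = ln (exp (2 / \<rho>))" by simp
    also have "\<dots> \<le> ln D" using D D1 by (subst ln_le_cancel_iff) (auto simp: D0_def)
    finally have lnD: "1 / ln D \<le> \<rho> / 2" using \<rho> D1 by (simp add: field_simps)
    have "\<bar>Im s\<bar> + 1 = sqrt ((\<bar>Im s\<bar> + 1)\<^sup>2)" by simp
    also have "\<dots> \<le> sqrt D" using D by (intro real_sqrt_le_mono) (simp add: D0_def)
    finally have ImD: "\<bar>Im s\<bar> + 1 \<le> D powr (1 - 1/2)" using D1 by (simp add: powr_half_sqrt)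
    have "\<forall>\<^sub>F z in at s. dist z s < \<rho> / 4 \<and> z \<noteq> s \<and> z \<noteq> 1"
    proof -
      have "\<forall>\<^sub>F z in at s. dist z s < \<rho> / 4" using \<rho> by (auto simp: eventually_at intro: exI[of _ "\<rho>/4"])
      moreover have "\<forall>\<^sub>F z in at s. z \<noteq> s" by (simp add: eventually_at_filter)
      moreover have "\<forall>\<^sub>F z in at s. z \<noteq> 1" by (rule eventually_neq_at_within)
      ultimately show ?thesis by eventually_elim auto
    qed
    hence near: "\<forall>\<^sub>F z in at s. z - 1/2 \<in> ratios_range 1 1 (1/8) (1/2) D \<and> Re z > 1/2"
    proof eventually_elim
      case (elim z)
      have re: "\<bar>Re z - Re s\<bar> < \<rho> / 4" using abs_Re_le_cmod[of "z - s"] elim by (simp add: dist_norm)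
      have im: "\<bar>Im z - Im s\<bar> < \<rho> / 4" using abs_Im_le_cmod[of "z - s"] elim by (simp add: dist_norm)
      have rz: "Re (z - 1/2) = Re z - 1/2" by simp
      have rs: "Re s - 1/2 = \<rho>" by (simp add: \<rho>_def)
      have re1: "Re z - Re s < \<rho> / 4" and re2: "- (\<rho> / 4) < Re z - Re s"
        using re by (simp_all only: abs_less_iff) linarith+
      have "\<rho> / 2 \<le> Re (z - 1/2)" using rz rs re2 \<rho>(1) by linarith
      hence "1 / ln D \<le> Re (z - 1/2)" using lnD by linarith
      moreover have "Re (z - 1/2) \<le> 3/4 - 1/8" using rz rs re1 \<rho>(2) by linarith
      moreover have "\<bar>Im z\<bar> \<le> \<bar>Im s\<bar> + \<bar>Im z - Im s\<bar>" by linarith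
      hence "\<bar>Im z\<bar> \<le> D powr (1 - 1/2)" using im ImD \<rho>(2) by linarith
      hence "\<bar>Im (z - 1/2)\<bar> \<le> 1 * D powr (1 - 1/2)" by simp
      moreover have "z - 1/2 \<noteq> 1/2" using elim by (auto simp: field_simps)
      moreover have "Re z > 1/2" using rs re2 \<rho>(1) by linarith
      ultimately show ?case by (simp add: ratios_range_def)
    qed
    have rem0: "((\<lambda>z. (z - s) * ratios_remainder D (z - 1/2)) \<longlongrightarrow> 0) (at s)"
    proof (rule Lim_null_comparison)
      show "\<forall>\<^sub>F z in at s. norm ((z - s) * ratios_remainder D (z - 1/2)) \<le> norm (z - s) * (B * D powr (1/2 + 1))"
        unfolding norm_mult using near by eventually_elim (intro mult_left_mono B D1 norm_ge_zero, blast)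
      have "((\<lambda>z. norm (z - s) * (B * D powr (1/2 + 1))) \<longlongrightarrow> norm (s - s) * (B * D powr (1/2 + 1))) (at s)"
        by (intro tendsto_intros)
      thus "((\<lambda>z. norm (z - s) * (B * D powr (1/2 + 1))) \<longlongrightarrow> 0) (at s)" by simp
    qed
    define Z where "Z = (\<lambda>z. deriv zeta (2 * z) / zeta (2 * z) + density_series z)"
    have "isCont Z s"
    proof -
      have "density_series holomorphic_on {z. Re z > 1/2}"
        by (rule holomorphic_on_subset[OF density_series_holomorphic]) auto
      hence "Z holomorphic_on {z. Re z > 1/2}"
        unfolding Z_def by (intro holomorphic_on_add logderiv_zeta_holomorphic)
      thus ?thesis using s open_Re_gt holomorphic_on_imp_continuous_on continuous_on_eq_continuous_at by blast
    qed
    hence Z0: "((\<lambda>z. (z - s) * Z z) \<longlongrightarrow> (s - s) * Z s) (at s)" unfolding isCont_def by (intro tendsto_intros)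
    have "((\<lambda>z. (z - s) * ratios_remainder D (z - 1/2) + of_nat (card ?F) * ((z - s) * Z z) - (\<Sum>d\<in>?F. (z - s) * ld d z))
       \<longlongrightarrow> 0 + of_nat (card ?F) * ((s - s) * Z s) - (\<Sum>d\<in>?F. of_nat (k d))) (at s)"
      by (intro tendsto_intros rem0 Z0 k(1)) (auto simp: discs_between_def)
    moreover have "\<forall>\<^sub>F z in at s. (z - s) * ratios_remainder D (z - 1/2) + of_nat (card ?F) * ((z - s) * Z z) - (\<Sum>d\<in>?F. (z - s) * ld d z)
        = (\<Sum>d\<in>?F. Q d z * A z)"
      using near
    proof eventually_elim
      case (elim z)
      have "ratios_remainder D (z - 1/2) = (\<Sum>d\<in>?F. ld d z) - (\<Sum>d\<in>?F. Z z - Q d z * dual_factor (z - 1/2))"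
        using elim by (simp add: ratios_remainder_def ld_def ratios_main_term_eq Z_def Q_def)
      hence R: "ratios_remainder D (z - 1/2) = (\<Sum>d\<in>?F. ld d z) - (of_nat (card ?F) * Z z - (\<Sum>d\<in>?F. Q d z * dual_factor (z - 1/2)))"
        by (simp add: sum_subtractf)
      have a: "(\<Sum>d\<in>?F. (z - s) * ld d z) = (z - s) * (\<Sum>d\<in>?F. ld d z)" by (simp add: sum_distrib_left)
      have b: "(\<Sum>d\<in>?F. Q d z * A z) = (z - s) * (\<Sum>d\<in>?F. Q d z * dual_factor (z - 1/2))"
        by (simp add: A_def sum_distrib_left mult_ac)
      show ?case unfolding a b R by (simp add: algebra_simps)
    qed
    ultimately show ?thesis by (simp add: tendsto_cong)
  qed
  \<comment> \<open>The families below d + 1 and below d differ by d alone.\<close>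
  have single: "((\<lambda>z. Q d z * A z) \<longlongrightarrow> - of_nat (k d)) (at s)"
    if d: "fundamental_discriminant d" "real_of_int d \<ge> D0" for d
  proof -
    have d1: "real_of_int d > 1" using d D02 by simp
    have F: "discs_between 1 (real_of_int d + 1) = insert d (discs_between 1 (real_of_int d))"
      using d d1 by (auto simp: discs_between_def)
    have nin: "d \<notin> discs_between 1 (real_of_int d)" by (simp add: discs_between_def)
    have "((\<lambda>z. (\<Sum>d\<in>discs_between 1 (real_of_int d + 1). Q d z * A z) - (\<Sum>d\<in>discs_between 1 (real_of_int d). Q d z * A z))
      \<longlongrightarrow> - of_nat (\<Sum>d\<in>discs_between 1 (real_of_int d + 1). k d) - - of_nat (\<Sum>d\<in>discs_between 1 (real_of_int d). k d)) (at s)"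
      by (intro tendsto_diff lim) (use d in auto)
    thus ?thesis unfolding F using nin finite_discs_between by simp
  qed
  have Qnorm: "norm (Q d s) = (real_of_int d / pi) powr (- \<rho>)" if "d > 0" for d
    using that norm_of_real_powr[of "real_of_int d / pi" "1/2 - s"] by (simp add: Q_def \<rho>_def)
  have Qlim: "(Q d \<longlongrightarrow> Q d s) (at s)" if "d > 0" for d
  proof -
    define c where "c = real_of_int d / pi"
    have "c \<noteq> 0" using that by (simp add: c_def)
    hence "(\<lambda>z. of_real c powr (1/2 - z)) holomorphic_on UNIV" by (intro holomorphic_intros) auto
    hence "Q d holomorphic_on UNIV" by (simp add: Q_def[abs_def] c_def)
    thus ?thesis using holomorphic_on_imp_continuous_on continuous_on_def by (metis UNIV_I)
  qed
  have Acts: "(A \<longlongrightarrow> - of_nat (k d) / Q d s) (at s)" if d: "fundamental_discriminant d" "real_of_int d \<ge> D0" for d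
  proof -
    have d0: "d > 0" using d D02 by linarith
    have Qne: "Q d z \<noteq> 0" for z using d0 by (simp add: Q_def)
    have "(Q d \<longlongrightarrow> Q d s) (at s)" by (rule Qlim[OF d0])
    with single[OF d] have "((\<lambda>z. Q d z * A z / Q d z) \<longlongrightarrow> - of_nat (k d) / Q d s) (at s)"
      by (rule tendsto_divide) (rule Qne)
    thus ?thesis using Qne by simp
  qed
  obtain d1 where d1: "fundamental_discriminant d1" "real_of_int d1 > D0"
    using fundamental_discriminant_unbounded by blast
  define a where "a = - of_nat (k d1) / Q d1 s"
  have Aa: "(A \<longlongrightarrow> a) (at s)" unfolding a_def by (rule Acts) (use d1 in auto)
  \<comment> \<open>Since |a| equals \<open>k d2\<close> times (d2 / pi) powr \<rho>, a d2 with (d2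
    / pi) powr \<rho> > |a| forces \<open>k d2\<close> to be 0.\<close>
  obtain d2 where d2: "fundamental_discriminant d2" "real_of_int d2 > max D0 (pi * (norm a + 1) powr (1 / \<rho>))"
    using fundamental_discriminant_unbounded by blast
  have d20: "d2 > 0" using d2 D02 by linarith
  have "(A \<longlongrightarrow> - of_nat (k d2) / Q d2 s) (at s)" by (rule Acts) (use d2 in auto)
  hence a2: "a = - of_nat (k d2) / Q d2 s" using Aa tendsto_unique[OF trivial_limit_at] by blast
  have "(norm a + 1) powr (1 / \<rho>) < real_of_int d2 / pi" using d2 by (simp add: field_simps)
  hence "((norm a + 1) powr (1 / \<rho>)) powr \<rho> < (real_of_int d2 / pi) powr \<rho>" using \<rho> by (intro powr_less_mono2) auto
  hence big: "norm a < (real_of_int d2 / pi) powr \<rho>" using \<rho> by (simp add: powr_powr)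
  have "norm a = real (k d2) * (real_of_int d2 / pi) powr \<rho>"
    unfolding a2 using Qnorm[OF d20] by (simp add: norm_divide powr_minus_divide)
  hence "real (k d2) * (real_of_int d2 / pi) powr \<rho> < 1 * (real_of_int d2 / pi) powr \<rho>" using big by simp
  hence "k d2 = 0" by (subst (asm) mult_less_cancel_right_pos) (use d20 in auto)
  hence "a = 0" using a2 by simp
  \<comment> \<open>The residue \<open>a\<close> is 0 by now, so the orders over any family with
    cutoff at least D0 sum to 0. The given d may lie below D0 but belongs to this family.\<close>
  define D where "D = max D0 (real_of_int d + 1)"
  have "((\<lambda>z. \<Sum>d\<in>discs_between 1 D. Q d z * A z) \<longlongrightarrow> (\<Sum>d\<in>discs_between 1 D. Q d s * 0)) (at s)"
    using Aa \<open>a = 0\<close> by (intro tendsto_intros Qlim) (auto simp: discs_between_def)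
  moreover have "((\<lambda>z. \<Sum>d\<in>discs_between 1 D. Q d z * A z) \<longlongrightarrow> - of_nat (\<Sum>d\<in>discs_between 1 D. k d)) (at s)"
    by (rule lim) (simp add: D_def)
  ultimately have "of_nat (\<Sum>d\<in>discs_between 1 D. k d) = (0 :: complex)"
    using tendsto_unique[OF trivial_limit_at] by fastforce
  hence "(\<Sum>d\<in>discs_between 1 D. k d) = 0" by (simp only: of_nat_eq_0_iff)
  moreover have "d \<in> discs_between 1 D" using d by (simp add: discs_between_def D_def)
  ultimately have "k d = 0" using finite_discs_between by simp
  thus ?thesis using k(2)[OF d] by auto
qed

section \<open>Odd prime powers\<close>


text \<open>Coefficients indexed by n, the form that Perron's formula needs.
  \<open>aprimedivisor n\<close> is the base prime when n is a prime power; other n are cut off by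
  the guard.\<close>

definition odd_coeff :: "int \<Rightarrow> nat \<Rightarrow> complex" where
  "odd_coeff d n = (let p = aprimedivisor n in
     if primepow n \<and> odd (multiplicity p n) then of_int (kronecker d p) * of_real (ln (real p)) else 0)"

lemma odd_coeff_prime_power:
  assumes "prime p" "k > 0"
  shows "odd_coeff d (p ^ k) = (if odd k then of_int (kronecker d p) * of_real (ln (real p)) else 0)"
proof -
  have "multiplicity p (p ^ k) = k"
    using assms by (intro multiplicity_same_power) (auto simp: prime_gt_0_nat)
  thus ?thesis using assms by (simp add: odd_coeff_def aprimedivisor_prime_power primepow_prime_power)
qed

lemma odd_coeff_nonzeroD:
  assumes "odd_coeff d n \<noteq> 0" obtains p k where "prime p" "odd k" "n = p ^ k"
proof -
  have "primepow n" using assms by (auto simp: odd_coeff_def Let_def split: if_splits)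
  then obtain p k where pk: "prime p" "k > 0" "n = p ^ k" by (auto simp: primepow_def)
  hence "odd k" using assms odd_coeff_prime_power[of p k d] by (auto split: if_splits)
  thus thesis using pk that by blast
qed

lemma norm_odd_coeff_le: "norm (odd_coeff d n) \<le> ln (real n)"
proof (cases "odd_coeff d n = 0")
  case True thus ?thesis by (cases "n = 0") auto
next
  case False
  then obtain p k where pk: "prime p" "odd k" "n = p ^ k" by (rule odd_coeff_nonzeroD)
  have k: "k > 0" using pk(2) by (cases k) auto
  have p: "p \<ge> 2" using prime_ge_2_nat[OF pk(1)] .
  have "p ^ 1 \<le> p ^ k" using p k by (intro power_increasing) auto
  hence "ln (real p) \<le> ln (real n)" using p pk by (subst ln_le_cancel_iff) auto
  moreover have "norm (odd_coeff d n) \<le> ln (real p)"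
    using odd_coeff_prime_power[OF pk(1) k] pk p kronecker_values[of d p] by (auto simp: norm_mult)
  ultimately show ?thesis by linarith
qed

lemma inj_on_prime_powers: "inj_on (\<lambda>(p, k). p ^ k) {(p::nat, k). prime p \<and> k > 0}"
  by (auto simp: inj_on_def dest: prime_power_inj')

lemma sum_odd_coeff:
  "(\<Sum>n | real n < X. odd_coeff d n) =
     of_real (\<Sum>(p, k)\<in>{(p::nat, k::nat). prime p \<and> odd k \<and> real (p ^ k) < X}. real_of_int (kronecker d p) * ln (real p))"
proof -
  let ?S = "{(p::nat, k::nat). prime p \<and> odd k \<and> real (p ^ k) < X}"
  let ?\<phi> = "\<lambda>(p::nat, k::nat). p ^ k"
  have odd_pos: "odd k \<Longrightarrow> k > 0" for k :: nat by (cases k) auto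
  have inj: "inj_on ?\<phi> ?S" by (rule inj_on_subset[OF inj_on_prime_powers]) (auto simp: odd_pos)
  have "finite {n::nat. real n < X}"
    by (rule finite_subset[of _ "{..nat \<lceil>X\<rceil>}"]) (auto, linarith)
  moreover have "?\<phi> ` ?S \<subseteq> {n. real n < X}" by auto
  moreover have "\<forall>n\<in>{n. real n < X} - ?\<phi> ` ?S. odd_coeff d n = 0"
  proof (rule ballI, rule ccontr)
    fix n assume n: "n \<in> {n. real n < X} - ?\<phi> ` ?S" and nz: "odd_coeff d n \<noteq> 0"
    from odd_coeff_nonzeroD[OF nz] obtain p k where pk: "prime p" "odd k" "n = p ^ k" .
    hence "(p, k) \<in> ?S" using n by simp
    hence "?\<phi> (p, k) \<in> ?\<phi> ` ?S" by (rule imageI)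
    thus False using n pk by simp
  qed
  ultimately have "sum (odd_coeff d) {n. real n < X} = sum (odd_coeff d) (?\<phi> ` ?S)"
    by (rule sum.mono_neutral_right)
  also have "\<dots> = (\<Sum>(p, k)\<in>?S. odd_coeff d (p ^ k))"
    by (subst sum.reindex[OF inj]) (simp add: case_prod_unfold o_def)
  also have "\<dots> = (\<Sum>(p, k)\<in>?S. of_real (real_of_int (kronecker d p) * ln (real p)))"
    by (intro sum.cong refl) (auto simp: odd_coeff_prime_power odd_pos)
  finally show ?thesis by (simp add: case_prod_unfold)
qed

text \<open>zeta'/zeta(2 s) runs over all primes, while those dividing d, where chi_d vanishes,
  contribute nothing to the odd powers. This term takes them out again.\<close>

definition local_sum :: "int \<Rightarrow> complex \<Rightarrow> complex" where
  "local_sum d s = (\<Sum>p\<in>prime_factors (nat d). of_real (ln (real p)) / (of_nat p powr (2 * s) - 1))"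

definition odd_logderiv :: "int \<Rightarrow> complex \<Rightarrow> complex" where
  "odd_logderiv d s = deriv zeta (2 * s) / zeta (2 * s) + local_sum d s - deriv (L_kronecker d) s / L_kronecker d s"

lemma kronecker_eq_0_iff:
  assumes "prime p" "d > 0" shows "kronecker d p = 0 \<longleftrightarrow> p \<in> prime_factors (nat d)"
proof -
  have "kronecker d p = 0 \<longleftrightarrow> int p dvd d"
    using assms by (auto simp: kronecker_of_prime kronecker_prime_def Legendre_def cong_0_iff)
  also have "\<dots> \<longleftrightarrow> p dvd nat d" using assms(2) by (metis int_dvd_int_iff int_nat_eq order_less_imp_le)
  also have "\<dots> \<longleftrightarrow> p \<in> prime_factors (nat d)" using assms by (auto simp: in_prime_factors_iff)
  finally show ?thesis .
qed

lemma powr_power_nat: "p > 0 \<Longrightarrow> of_nat (p ^ m) powr s = (of_nat p powr s :: complex) ^ m"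
proof (induction m)
  case (Suc m)
  have "of_nat (p ^ Suc m) powr s = (of_nat p * of_nat (p ^ m) :: complex) powr s" by simp
  also have "\<dots> = of_nat p powr s * of_nat (p ^ m) powr s" by (rule powr_times_real) auto
  finally show ?case using Suc by (simp del: of_nat_power)
qed simp

text \<open>The odd powers of one prime form a geometric series with ratio p powr (-2 s). Its sum is
  matched, prime by prime, with the terms of -L'/L(s), zeta'/zeta(2 s) and
  \<open>local_sum\<close>.\<close>

lemma odd_dirichlet_series:
  assumes d: "fundamental_discriminant d" "d > 1" and s: "Re s > 1"
  shows "(\<Sum>n. odd_coeff d n * of_nat n powr (-s)) = odd_logderiv d s"
proof -
  let ?g = "\<lambda>n. odd_coeff d n * of_nat n powr (-s)"
  let ?\<phi> = "\<lambda>(p::nat, j::nat). p ^ (2 * j + 1)"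
  let ?P = "{p::nat. prime p}"
  define h where "h = (\<lambda>p. of_real (ln (real p)) * of_int (kronecker d p) * of_nat p powr s / (of_nat p powr (2 * s) - 1) :: complex)"
  have "summable (\<lambda>n. norm (?g n))"
    by (rule dirichlet_abs_summable(1)[of _ "Re s - 1"]) (use norm_odd_coeff_le s in auto)
  hence "(?g has_sum suminf ?g) UNIV"
    by (intro norm_summable_imp_has_sum) (auto intro: summable_norm_cancel)
  also have "(?g has_sum suminf ?g) UNIV \<longleftrightarrow> (?g has_sum suminf ?g) (?\<phi> ` (?P \<times> UNIV))"
  proof (rule has_sum_cong_neutral)
    fix n assume n: "n \<in> UNIV - ?\<phi> ` (?P \<times> UNIV)"
    have "odd_coeff d n = 0"
    proof (rule ccontr)
      assume "odd_coeff d n \<noteq> 0"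
      then obtain p k where pk: "prime p" "odd k" "n = p ^ k" by (rule odd_coeff_nonzeroD)
      from pk(2) obtain j where "k = 2 * j + 1" by (rule oddE)
      thus False using n pk by (auto simp: image_iff)
    qed
    thus "?g n = 0" by simp
  qed auto
  also have "\<dots> \<longleftrightarrow> ((?g \<circ> ?\<phi>) has_sum suminf ?g) (?P \<times> UNIV)"
  proof (rule has_sum_reindex, rule inj_onI)
    fix x y assume xy: "x \<in> ?P \<times> UNIV" "y \<in> ?P \<times> UNIV" "?\<phi> x = ?\<phi> y"
    obtain p i q j where e: "x = (p, i)" "y = (q, j)" by (cases x; cases y)
    have pq: "prime p" "prime q" "p ^ (2 * i + 1) = q ^ (2 * j + 1)"
      using xy unfolding e by (simp_all only: mem_Sigma_iff mem_Collect_eq prod.case)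
    from prime_power_inj'[OF this] show "x = y" by (simp add: e)
  qed
  finally have sig: "((?g \<circ> ?\<phi>) has_sum suminf ?g) (?P \<times> UNIV)" .
  have inner: "((\<lambda>j. (?g \<circ> ?\<phi>) (p, j)) has_sum h p) UNIV" if p: "p \<in> ?P" for p
  proof -
    have p2: "p \<ge> 2" using prime_ge_2_nat p by auto
    define q where "q = (of_nat p powr (-s) :: complex)"
    define c where "c = (of_int (kronecker d p) * of_real (ln (real p)) :: complex)"
    have "norm q = real p powr (- Re s)" using norm_powr_real_powr[of "of_nat p" "-s"] by (simp add: q_def)
    also have "\<dots> < 1" using p2 s by (intro powr_less_one) auto
    finally have q: "norm q < 1" .
    hence q2: "norm (q\<^sup>2) < 1" by (simp add: norm_power power_less_one_iff)
    have g: "(?g \<circ> ?\<phi>) (p, j) = c * q * (q\<^sup>2) ^ j" for j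
    proof -
      have "odd_coeff d (p ^ (2 * j + 1)) = c" using p by (subst odd_coeff_prime_power) (auto simp: c_def)
      moreover have "of_nat (p ^ (2 * j + 1)) powr (-s) = q ^ (2 * j + 1)" unfolding q_def by (rule powr_power_nat) (use p2 in simp)
      ultimately show ?thesis by (simp add: power_mult power_add)
    qed
    have "(\<lambda>j. c * q * (q\<^sup>2) ^ j) sums (c * q * (1 / (1 - q\<^sup>2)))" by (intro sums_mult geometric_sums q2)
    moreover have "summable (\<lambda>j. norm (c * q * (q\<^sup>2) ^ j))"
      using q2 by (simp add: norm_mult norm_power summable_geometric summable_mult)
    ultimately have "((\<lambda>j. c * q * (q\<^sup>2) ^ j) has_sum (c * q * (1 / (1 - q\<^sup>2)))) UNIV"
      by (intro norm_summable_imp_has_sum)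
    moreover have "c * q * (1 / (1 - q\<^sup>2)) = h p"
    proof -
      define P where "P = (of_nat p powr s :: complex)"
      have P: "P \<noteq> 0" using p2 by (simp add: P_def)
      have qP: "q = 1 / P" by (simp add: q_def P_def powr_minus_divide)
      have P2: "of_nat p powr (2 * s) = P\<^sup>2" by (simp add: P_def power2_eq_square powr_add[symmetric])
      have "P\<^sup>2 - 1 \<noteq> 0" using norm_inverse_prime_powr_le(2)[of p 1 s] p s P2 by auto
      hence "1 - 1 / P\<^sup>2 \<noteq> 0" using P by (simp add: field_simps)
      have "1 / P * (1 / (1 - (1 / P)\<^sup>2)) = P / (P\<^sup>2 - 1)"
        using P \<open>P\<^sup>2 - 1 \<noteq> 0\<close> \<open>1 - 1 / P\<^sup>2 \<noteq> 0\<close> by (simp add: field_simps power2_eq_square)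
      hence "c * q * (1 / (1 - q\<^sup>2)) = c * (P / (P\<^sup>2 - 1))" unfolding qP by (simp only: mult.assoc)
      also have "\<dots> = h p" unfolding h_def P2 P_def[symmetric] c_def by simp
      finally show ?thesis .
    qed
    ultimately show ?thesis unfolding g by simp
  qed
  from has_sum_SigmaD[OF sig inner] have "(h has_sum suminf ?g) ?P" .
  also have "(h has_sum suminf ?g) ?P \<longleftrightarrow> ((\<lambda>p. if prime p then h p else 0) has_sum suminf ?g) UNIV"
    by (rule has_sum_cong_neutral) auto
  finally have sum1: "(\<lambda>p. if prime p then h p else 0) sums suminf ?g" by (rule has_sum_imp_sums)
  let ?Q = "prime_factors (nat d)"
  have s2: "Re (2 * s) > 1" using s by simp
  have Ld: "- deriv (kronecker_char.dsum d) s / kronecker_char.dsum d s = - deriv (L_kronecker d) s / L_kronecker d s"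
  proof -
    have "\<forall>\<^sub>F z in nhds s. L_kronecker d z = kronecker_char.dsum d z"
      using eventually_nhds_in_open[OF open_Re_gt[of 1], of s] s
      by (auto elim!: eventually_mono intro!: L_kronecker_eq_dsum)
    hence "deriv (L_kronecker d) s = deriv (kronecker_char.dsum d) s" by (intro deriv_cong_ev refl)
    thus ?thesis by (simp add: L_kronecker_eq_dsum s)
  qed
  have fin: "(\<lambda>p. if p \<in> ?Q then of_real (ln (real p)) / (of_nat p powr (2 * s) - 1) else (0::complex)) sums local_sum d s"
    unfolding local_sum_def by (rule sums_If_finite_set) simp
  have "(\<lambda>p. (if prime p then of_real (ln (real p)) * of_int (kronecker d p) / (of_nat p powr s - of_int (kronecker d p)) else 0)
       - (if prime p then of_real (ln (real p)) / (of_nat p powr (2 * s) - 1) else 0)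
       + (if p \<in> ?Q then of_real (ln (real p)) / (of_nat p powr (2 * s) - 1) else (0::complex)))
     sums (- deriv (L_kronecker d) s / L_kronecker d s - (- deriv zeta (2 * s) / zeta (2 * s)) + local_sum d s)"
    using kronecker_char.logderiv_dsum[OF s, of d] logderiv_zeta[OF s2] fin unfolding Ld
    by (intro sums_add sums_diff)
  moreover have "(if prime p then of_real (ln (real p)) * of_int (kronecker d p) / (of_nat p powr s - of_int (kronecker d p)) else 0)
       - (if prime p then of_real (ln (real p)) / (of_nat p powr (2 * s) - 1) else 0)
       + (if p \<in> ?Q then of_real (ln (real p)) / (of_nat p powr (2 * s) - 1) else (0::complex))
     = (if prime p then h p else 0)" for p
  proof (cases "prime p")
    case True
    define P where "P = (of_nat p powr s :: complex)"
    define c where "c = (of_int (kronecker d p) :: complex)"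
    define l where "l = complex_of_real (ln (real p))"
    have P2: "of_nat p powr (2 * s) = P\<^sup>2" by (simp add: P_def power2_eq_square powr_add[symmetric])
    have ne: "P\<^sup>2 - 1 \<noteq> 0" using norm_inverse_prime_powr_le(2)[of p 1 s] True s P2 by auto
    have hp: "h p = l * c * P / (P\<^sup>2 - 1)" unfolding h_def P2 P_def[symmetric] c_def l_def by simp
    have pq: "p \<in> ?Q \<longleftrightarrow> c = 0" using kronecker_eq_0_iff[OF True, of d] d by (simp add: c_def)
    \<comment> \<open>For c = 1 or c = -1 this is c / (P - c) = (c P + 1) / (P^2 - 1); for c = 0 the
      last two terms cancel.\<close>
    have "l * c / (P - c) - l / (P\<^sup>2 - 1) + (if c = 0 then l / (P\<^sup>2 - 1) else 0) = l * c * P / (P\<^sup>2 - 1)"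
    proof (cases "c = 0")
      case False
      hence c: "c = 1 \<or> c = -1" using kronecker_values[of d p] by (auto simp: c_def)
      have f: "P\<^sup>2 - 1 = (P - 1) * (P + 1)" by (simp add: power2_eq_square algebra_simps)
      hence "P - 1 \<noteq> 0" "P + 1 \<noteq> 0" using ne by auto
      thus ?thesis unfolding f using c by (auto simp: divide_simps) (simp_all add: algebra_simps)
    qed simp
    thus ?thesis using True pq unfolding hp P2 P_def[symmetric] c_def[symmetric] l_def[symmetric] by simp
  next
    case False
    hence "p \<notin> ?Q" by auto
    thus ?thesis using False by simp
  qed
  ultimately have "(\<lambda>p. if prime p then h p else 0) sums
    (- deriv (L_kronecker d) s / L_kronecker d s - (- deriv zeta (2 * s) / zeta (2 * s)) + local_sum d s)" by simp
  from sums_unique2[OF sum1 this] show ?thesis by (simp add: odd_logderiv_def algebra_simps)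
qed

lemma local_sum_holomorphic: "local_sum d holomorphic_on {s. Re s > 0}"
proof -
  have "(\<lambda>s. of_real (ln (real p)) / (of_nat p powr (2 * s) - 1)) holomorphic_on {s. Re s > 0}"
    if "p \<in> prime_factors (nat d)" for p
  proof -
    have p: "prime p" using that by auto
    show ?thesis using norm_inverse_prime_powr_le(2)[OF p order_refl] prime_gt_0_nat[OF p]
      by (intro holomorphic_intros) auto
  qed
  thus ?thesis unfolding local_sum_def[abs_def] by (rule holomorphic_on_sum)
qed

lemma sum_ln_prime_factors_le:
  assumes "n > 0" shows "(\<Sum>p\<in>prime_factors n. ln (real p)) \<le> ln (real n)"
proof -
  have "(\<Sum>p\<in>prime_factors n. ln (real p)) \<le> (\<Sum>p\<in>prime_factors n. real (multiplicity p n) * ln (real p))"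
  proof (rule sum_mono)
    fix p assume p: "p \<in> prime_factors n"
    hence "multiplicity p n \<ge> 1" by (simp add: prime_factors_multiplicity)
    moreover have "prime p" using p by auto
    hence "ln (real p) \<ge> 0" using prime_ge_2_nat[of p] by simp
    ultimately show "ln (real p) \<le> real (multiplicity p n) * ln (real p)"
      using mult_right_mono[of 1 "real (multiplicity p n)" "ln (real p)"] by simp
  qed
  also have "\<dots> = ln (\<Prod>p\<in>prime_factors n. real p ^ multiplicity p n)"
    by (subst ln_prod) (auto simp: ln_realpow prime_gt_0_nat dest: in_prime_factors_imp_prime)
  also have "(\<Prod>p\<in>prime_factors n. real p ^ multiplicity p n) = real n"
    using prime_factorization_nat[of n] assms by (metis (no_types, lifting) of_nat_power of_nat_prod prod.cong)
  finally show ?thesis .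
qed

lemma norm_local_sum_le:
  assumes "\<sigma> > 0" "d > 1" "Re s \<ge> \<sigma>"
  shows "norm (local_sum d s) \<le> ln (real_of_int d) / (1 - 2 powr (-2 * \<sigma>))"
proof -
  have c: "1 - 2 powr (-2 * \<sigma>) > (0::real)" using assms by (simp add: powr_less_one)
  have "norm (local_sum d s) \<le> (\<Sum>p\<in>prime_factors (nat d). ln (real p) * (1 / (1 - 2 powr (-2 * \<sigma>))))"
    unfolding local_sum_def
  proof (rule sum_norm_le)
    fix p assume "p \<in> prime_factors (nat d)"
    hence p: "prime p" by auto
    have p2: "real p \<ge> 2" using prime_ge_2_nat[OF p] by simp
    have "norm (1 / (of_nat p powr (2 * s) - 1)) \<le> real p powr (-2 * \<sigma>) / (1 - 2 powr (-2 * \<sigma>))"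
      by (rule norm_inverse_prime_powr_le[OF p]) (use assms in auto)
    also have "\<dots> \<le> 1 / (1 - 2 powr (-2 * \<sigma>))"
      using c p2 assms powr_mono[of "-2 * \<sigma>" 0 "real p"] by (intro divide_right_mono) auto
    finally have "ln (real p) * norm (1 / (of_nat p powr (2 * s) - 1)) \<le> ln (real p) * (1 / (1 - 2 powr (-2 * \<sigma>)))"
      using p2 by (intro mult_left_mono) auto
    thus "norm (of_real (ln (real p)) / (of_nat p powr (2 * s) - 1)) \<le> ln (real p) * (1 / (1 - 2 powr (-2 * \<sigma>)))"
      using p2 by (simp add: norm_divide)
  qed
  also have "\<dots> = (\<Sum>p\<in>prime_factors (nat d). ln (real p)) * (1 / (1 - 2 powr (-2 * \<sigma>)))"
    by (rule sum_distrib_right[symmetric])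
  also have "\<dots> \<le> ln (real (nat d)) * (1 / (1 - 2 powr (-2 * \<sigma>)))"
    by (intro mult_right_mono sum_ln_prime_factors_le) (use assms c in auto)
  finally show ?thesis using assms by simp
qed

lemma norm_logderiv_zeta_le:
  assumes "\<sigma> > 1/2" obtains B where "B \<ge> 0" "\<And>s. Re s \<ge> \<sigma> \<Longrightarrow> norm (deriv zeta (2 * s) / zeta (2 * s)) \<le> B"
proof -
  let ?M = "\<lambda>p::nat. ln (real p) * real p powr (-(1 + (2 * \<sigma> - 1))) / (1 - 2 powr (-2 * \<sigma>))"
  have summ: "summable ?M" by (intro summable_divide ln_powr_neg_summable) (use assms in auto)
  have c: "1 - 2 powr (-2 * \<sigma>) > (0::real)" using assms by (simp add: powr_less_one)
  have bd: "norm (deriv zeta (2 * s) / zeta (2 * s)) \<le> suminf ?M" if s: "Re s \<ge> \<sigma>" for s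
  proof -
    have "norm (- deriv zeta (2 * s) / zeta (2 * s)) \<le> suminf ?M"
    proof (rule norm_sums_le[OF logderiv_zeta summable_sums[OF summ]])
      show "Re (2 * s) > 1" using s assms by simp
      fix p
      show "norm (if prime p then of_real (ln (real p)) / (of_nat p powr (2 * s) - 1) else (0::complex)) \<le> ?M p"
      proof (cases "prime p")
        case True
        have p2: "real p \<ge> 2" using prime_ge_2_nat[OF True] by simp
        have "norm (1 / (of_nat p powr (2 * s) - 1)) \<le> real p powr (-2 * \<sigma>) / (1 - 2 powr (-2 * \<sigma>))"
          by (rule norm_inverse_prime_powr_le[OF True]) (use assms s in auto)
        hence "ln (real p) * norm (1 / (of_nat p powr (2 * s) - 1)) \<le> ln (real p) * (real p powr (-2 * \<sigma>) / (1 - 2 powr (-2 * \<sigma>)))"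
          using p2 by (intro mult_left_mono) auto
        thus ?thesis using True p2 by (simp add: norm_divide)
      next
        case False
        have "ln (real p) \<ge> 0" by (cases "p = 0") auto
        thus ?thesis using False c by simp
      qed
    qed
    thus ?thesis by (simp add: norm_divide)
  qed
  show thesis by (rule that[of "suminf ?M"]) (use bd order_trans[OF norm_ge_zero bd[of "of_real \<sigma>"]] in auto)
qed

lemma odd_logderiv_holomorphic:
  assumes "ratios_conjecture" "fundamental_discriminant d" "d > 1"
  shows "odd_logderiv d holomorphic_on {s. Re s > 1/2}"
proof -
  have "L_kronecker d holomorphic_on {s. Re s > 1/2}"
    by (rule holomorphic_on_subset[OF L_kronecker_holomorphic[OF assms(2,3)]]) auto
  moreover from this have "deriv (L_kronecker d) holomorphic_on {s. Re s > 1/2}"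
    by (rule holomorphic_deriv) (rule open_Re_gt)
  moreover have "local_sum d holomorphic_on {s. Re s > 1/2}"
    by (rule holomorphic_on_subset[OF local_sum_holomorphic]) auto
  ultimately have "(\<lambda>s. deriv (L_kronecker d) s / L_kronecker d s) holomorphic_on {s. Re s > 1/2}"
      "local_sum d holomorphic_on {s. Re s > 1/2}"
    using L_kronecker_nonzero[OF assms] by (auto intro!: holomorphic_on_divide)
  thus ?thesis unfolding odd_logderiv_def[abs_def]
    by (intro holomorphic_on_diff holomorphic_on_add logderiv_zeta_holomorphic)
qed

lemma norm_odd_logderiv_le:
  assumes rc: "ratios_conjecture" and \<epsilon>: "0 < \<epsilon>" "\<epsilon> < 1"
  obtains C where "C > 0" "\<And>d s. fundamental_discriminant d \<Longrightarrow> d > 1 \<Longrightarrow> 1/2 + \<epsilon> \<le> Re s \<Longrightarrow> Re s \<le> 2 \<Longrightarrow>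
     norm (odd_logderiv d s) \<le> C * ln (real_of_int d * (\<bar>Im s\<bar> + 2))"
proof -
  obtain C1 where C1: "C1 > 0" "\<And>d s. fundamental_discriminant d \<Longrightarrow> d > 1 \<Longrightarrow> 1/2 + \<epsilon> \<le> Re s \<Longrightarrow> Re s \<le> 2 \<Longrightarrow>
     norm (deriv (L_kronecker d) s / L_kronecker d s) \<le> C1 * ln (real_of_int d * (\<bar>Im s\<bar> + 2))"
    using logderiv_L_kronecker_bound[of \<epsilon>, OF L_kronecker_nonzero[OF rc] \<epsilon>] by metis
  obtain B where B: "B \<ge> 0" "\<And>s. Re s \<ge> 1/2 + \<epsilon> \<Longrightarrow> norm (deriv zeta (2 * s) / zeta (2 * s)) \<le> B"
    using norm_logderiv_zeta_le[of "1/2 + \<epsilon>"] \<epsilon> by auto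
  define k where "k = 1 / (1 - 2 powr (-2 * (1/2 + \<epsilon>)) :: real)"
  have k: "k > 0" using \<epsilon> unfolding k_def by (simp add: powr_less_one)
  show thesis
  proof (rule that[of "C1 + B + k"])
    show "C1 + B + k > 0" using C1(1) B(1) k by simp
    fix d s assume d: "fundamental_discriminant d" "d > 1" and s: "1/2 + \<epsilon> \<le> Re s" "Re s \<le> 2"
    let ?Q = "real_of_int d * (\<bar>Im s\<bar> + 2)"
    note lnQ = ln_conductor_ge_1(2)[OF d(2), of "Im s"]
    have "ln (real_of_int d) \<le> ln ?Q" using d mult_left_mono[of 1 "\<bar>Im s\<bar> + 2" "real_of_int d"] by (subst ln_le_cancel_iff) auto
    hence "k * ln (real_of_int d) \<le> k * ln ?Q" using k by simp
    hence "norm (local_sum d s) \<le> k * ln ?Q"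
      using norm_local_sum_le[of "1/2 + \<epsilon>" d s] d s \<epsilon> by (simp add: k_def)
    moreover have "norm (deriv zeta (2 * s) / zeta (2 * s)) \<le> B * ln ?Q"
      using B(2)[OF s(1)] mult_left_mono[OF lnQ B(1)] by simp
    ultimately have "norm (odd_logderiv d s) \<le> B * ln ?Q + k * ln ?Q + C1 * ln ?Q"
      unfolding odd_logderiv_def using C1(2)[OF d s]
      by (intro order_trans[OF norm_triangle_ineq4] order_trans[OF add_mono[OF norm_triangle_ineq order_refl]] add_mono)
    thus "norm (odd_logderiv d s) \<le> (C1 + B + k) * ln ?Q" by (simp add: algebra_simps)
  qed
qed

section \<open>Estimates on the critical line\<close>


lemma perron_line_integrable:
  assumes "\<sigma> > 0" "X > 0" "continuous_on (closed_segment (Complex \<sigma> (-T)) (Complex \<sigma> T)) f"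
  shows "(\<lambda>s. f s * of_real X powr s / s) contour_integrable_on linepath (Complex \<sigma> (-T)) (Complex \<sigma> T)"
  using assms closed_segment_same_Re[of 0 \<sigma> "-T" T]
  by (intro contour_integrable_continuous_linepath continuous_intros) auto

lemma perron_line_diff:
  assumes "\<sigma> > 0" "X > 0" "continuous_on (closed_segment (Complex \<sigma> (-T)) (Complex \<sigma> T)) f"
    "continuous_on (closed_segment (Complex \<sigma> (-T)) (Complex \<sigma> T)) g"
  shows "perron_line \<sigma> T (\<lambda>s. f s - g s) X = perron_line \<sigma> T f X - perron_line \<sigma> T g X"
  using contour_integral_diff[OF perron_line_integrable[OF assms(1-3)] perron_line_integrable[OF assms(1,2,4)]]
  by (simp add: perron_line_def diff_divide_distrib left_diff_distrib)

lemma perron_line_sum: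
  assumes "\<sigma> > 0" "X > 0" "finite F"
    "\<And>d. d \<in> F \<Longrightarrow> continuous_on (closed_segment (Complex \<sigma> (-T)) (Complex \<sigma> T)) (f d)"
  shows "perron_line \<sigma> T (\<lambda>s. \<Sum>d\<in>F. f d s) X = (\<Sum>d\<in>F. perron_line \<sigma> T (f d) X)"
  using contour_integral_sum[OF assms(3), of "\<lambda>d s. f d s * of_real X powr s / s" "linepath (Complex \<sigma> (-T)) (Complex \<sigma> T)"]
    perron_line_integrable[OF assms(1,2,4)]
  by (simp add: perron_line_def sum_divide_distrib sum_distrib_right)

lemma perron_line_cong:
  assumes "\<And>s. s \<in> closed_segment (Complex \<sigma> (-T)) (Complex \<sigma> T) \<Longrightarrow> f s = g s"
  shows "perron_line \<sigma> T f X = perron_line \<sigma> T g X"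
  unfolding perron_line_def by (rule contour_integral_eq) (use assms in auto)

lemma norm_perron_line_le:
  assumes "\<sigma> > 0" "T > 0" "X > 0" "B \<ge> 0"
    and "continuous_on (closed_segment (Complex \<sigma> (-T)) (Complex \<sigma> T)) f"
    and "\<And>t. \<bar>t\<bar> \<le> T \<Longrightarrow> norm (f (Complex \<sigma> t)) \<le> B"
  shows "norm (perron_line \<sigma> T f X) \<le> B * X powr \<sigma> * (2 * arsinh (T / \<sigma>))"
  unfolding perron_line_def by (rule norm_vertical_integral_le[OF assms])

lemma continuous_on_vertical_segment:
  assumes "f holomorphic_on {s. Re s > c}" "\<sigma> > c"
  shows "continuous_on (closed_segment (Complex \<sigma> (-T)) (Complex \<sigma> T)) f"
  by (rule continuous_on_subset[OF holomorphic_on_imp_continuous_on[OF assms(1)]])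
     (use closed_segment_same_Re assms(2) in force)

text \<open>The product is X powr \<epsilon> * T powr \<epsilon> * (X / T), where X / T > 1 and T
  powr \<epsilon> >= 1.\<close>

lemma error_term_lower_bounds:
  fixes X T \<epsilon> :: real
  assumes "2 < T" "T < X" "\<epsilon> > 0"
  shows "X powr (1 + \<epsilon>) / T \<le> X powr (1 + \<epsilon>) * T powr (-1 + \<epsilon>)"
    and "X powr \<epsilon> * T powr \<epsilon> \<le> X powr (1 + \<epsilon>) * T powr (-1 + \<epsilon>)"
    and "X powr (1 + \<epsilon>) / T * T powr \<epsilon> = X powr (1 + \<epsilon>) * T powr (-1 + \<epsilon>)"
    and "X powr \<epsilon> \<le> X powr (1 + \<epsilon>) * T powr (-1 + \<epsilon>)"
proof -
  have Te: "T powr \<epsilon> \<ge> 1" using assms by (simp add: ge_one_powr_ge_zero)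
  have Tm: "T powr (-1 + \<epsilon>) = T powr \<epsilon> / T" using assms by (simp add: powr_diff)
  show e: "X powr (1 + \<epsilon>) / T * T powr \<epsilon> = X powr (1 + \<epsilon>) * T powr (-1 + \<epsilon>)" unfolding Tm by simp
  show "X powr (1 + \<epsilon>) / T \<le> X powr (1 + \<epsilon>) * T powr (-1 + \<epsilon>)"
    unfolding e[symmetric] using mult_left_mono[OF Te, of "X powr (1 + \<epsilon>) / T"] assms by simp
  have "X powr (1 + \<epsilon>) = X * X powr \<epsilon>" using assms by (simp add: powr_add)
  hence "X powr (1 + \<epsilon>) * T powr (-1 + \<epsilon>) = X powr \<epsilon> * T powr \<epsilon> * (X / T)" unfolding Tm by simp
  thus 2: "X powr \<epsilon> * T powr \<epsilon> \<le> X powr (1 + \<epsilon>) * T powr (-1 + \<epsilon>)"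
    using mult_left_mono[of 1 "X / T" "X powr \<epsilon> * T powr \<epsilon>"] assms by simp
  show "X powr \<epsilon> \<le> X powr (1 + \<epsilon>) * T powr (-1 + \<epsilon>)"
    using mult_left_mono[OF Te, of "X powr \<epsilon>"] 2 by simp
qed

text \<open>This is for a single d. The bound for L'/L costs a logarithm of d T on the horizontal
  sides, which becomes the factors T powr \<epsilon> and D powr \<epsilon> of the error
  term.\<close>

lemma odd_perron:
  assumes rc: "ratios_conjecture" and \<epsilon>: "0 < \<epsilon>" "\<epsilon> < 1/4"
  obtains C where "C > 0"
    "\<And>X T D d. 2 < T \<Longrightarrow> T < X \<Longrightarrow> X \<notin> \<int> \<Longrightarrow> fundamental_discriminant d \<Longrightarrow> 1 < d \<Longrightarrow> real_of_int d < D \<Longrightarrow>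
       norm (2 * pi * \<i> * (\<Sum>n | real n < X. odd_coeff d n) - perron_line (1/2 + \<epsilon>) T (odd_logderiv d) X)
         \<le> C * (X powr (1 + \<epsilon>) * T powr (-1 + \<epsilon>) * D powr \<epsilon>)"
proof -
  obtain C1 where C1: "C1 > 0"
    "\<And>X T a. 2 < T \<Longrightarrow> T < X \<Longrightarrow> X \<notin> \<int> \<Longrightarrow> (\<And>n. norm (a n :: complex) \<le> ln (real n)) \<Longrightarrow>
       norm (perron_line (1 + \<epsilon>) T (\<lambda>s. \<Sum>n. a n * of_nat n powr (-s)) X
             - 2 * pi * \<i> * (\<Sum>n | real n < X. a n)) \<le> C1 * (X powr (1 + \<epsilon>) * T powr (-1 + \<epsilon>))"
    using perron_formula[OF \<epsilon>(1)] by blast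
  obtain C2 where C2: "C2 > 0" "\<And>d s. fundamental_discriminant d \<Longrightarrow> d > 1 \<Longrightarrow> 1/2 + \<epsilon> \<le> Re s \<Longrightarrow> Re s \<le> 2 \<Longrightarrow>
     norm (odd_logderiv d s) \<le> C2 * ln (real_of_int d * (\<bar>Im s\<bar> + 2))"
    using norm_odd_logderiv_le[OF rc \<epsilon>(1)] \<epsilon> by auto
  define C3 where "C3 = C2 * (2 powr \<epsilon> / \<epsilon>)"
  have C3: "C3 > 0" using C2(1) \<epsilon> by (simp add: C3_def)
  show thesis
  proof (rule that[of "C1 + C3"])
    show "C1 + C3 > 0" using C1(1) C3 by simp
    fix X T D :: real and d
    assume T: "2 < T" "T < X" and X: "X \<notin> \<int>" and d: "fundamental_discriminant d" "1 < d" "real_of_int d < D"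
    define W where "W = X powr (1 + \<epsilon>) * T powr (-1 + \<epsilon>)"
    have D1: "D > 1" using d by simp
    have De: "D powr \<epsilon> \<ge> 1" using D1 \<epsilon> by (simp add: ge_one_powr_ge_zero)
    have W0: "W \<ge> 0" by (simp add: W_def)
    have hol: "odd_logderiv d holomorphic_on {s. Re s > 1/2}" by (rule odd_logderiv_holomorphic[OF rc d(1,2)])
    have "perron_line (1 + \<epsilon>) T (\<lambda>s. \<Sum>n. odd_coeff d n * of_nat n powr (-s)) X = perron_line (1 + \<epsilon>) T (odd_logderiv d) X"
      by (intro perron_line_cong odd_dirichlet_series d) (use closed_segment_same_Re \<epsilon> in force)
    hence p1: "norm (perron_line (1 + \<epsilon>) T (odd_logderiv d) X - 2 * pi * \<i> * (\<Sum>n | real n < X. odd_coeff d n)) \<le> C1 * W"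
      using C1(2)[OF T X, of "odd_coeff d"] norm_odd_coeff_le by (simp add: W_def)
    define B where "B = C2 * ((2 * T * D) powr \<epsilon> / \<epsilon>)"
    have lnb: "C2 * ln (real_of_int d * (T + 2)) \<le> B"
    proof -
      have "real_of_int d * (T + 2) \<le> D * (2 * T)" using d T by (intro mult_mono) auto
      moreover have "real_of_int d * (T + 2) > 0" using d T by simp
      ultimately have "ln (real_of_int d * (T + 2)) \<le> ln (2 * T * D)" by (subst ln_le_cancel_iff) (auto simp: mult_ac)
      also have "\<dots> \<le> (2 * T * D) powr \<epsilon> / \<epsilon>"
      proof (rule ln_powr_bound)
        show "1 \<le> 2 * T * D" using T D1 mult_mono[of 1 "2 * T" 1 D] by simp
      qed (rule \<epsilon>)
      finally show ?thesis unfolding B_def using C2(1) by (intro mult_left_mono) auto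
    qed
    have B0: "B \<ge> 0" using C2(1) \<epsilon> by (simp add: B_def)
    have Beq: "B = C3 * (T powr \<epsilon> * D powr \<epsilon>)" using T D1 by (simp add: B_def C3_def powr_mult)
    have "norm (perron_line (1 + \<epsilon>) T (odd_logderiv d) X - perron_line (1/2 + \<epsilon>) T (odd_logderiv d) X)
       \<le> 2 * (B * X powr (1 + \<epsilon>) / T * ((1 + \<epsilon>) - (1/2 + \<epsilon>)))"
      unfolding perron_line_def
    proof (rule norm_shift_vertical_line_le[OF hol])
      fix x assume x: "1/2 + \<epsilon> \<le> x" "x \<le> 1 + \<epsilon>"
      show "norm (odd_logderiv d (Complex x T)) \<le> B \<and> norm (odd_logderiv d (Complex x (-T))) \<le> B"
        using C2(2)[OF d(1,2), of "Complex x T"] C2(2)[OF d(1,2), of "Complex x (-T)"] x \<epsilon> T lnb by auto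
    qed (use \<epsilon> T B0 in auto)
    also have "\<dots> = B * (X powr (1 + \<epsilon>) / T)" by simp
    also have "\<dots> = C3 * (X powr (1 + \<epsilon>) / T * T powr \<epsilon>) * D powr \<epsilon>" unfolding Beq by simp
    also have "\<dots> = C3 * (W * D powr \<epsilon>)" unfolding W_def error_term_lower_bounds(3)[OF T \<epsilon>(1)] by simp
    finally have p2: "norm (perron_line (1 + \<epsilon>) T (odd_logderiv d) X - perron_line (1/2 + \<epsilon>) T (odd_logderiv d) X) \<le> C3 * (W * D powr \<epsilon>)" .
    have "C1 * W \<le> C1 * (W * D powr \<epsilon>)" using C1(1) mult_left_mono[OF De W0] by simp
    with p1 p2 have "norm (2 * pi * \<i> * (\<Sum>n | real n < X. odd_coeff d n) - perron_line (1/2 + \<epsilon>) T (odd_logderiv d) X)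
       \<le> C1 * (W * D powr \<epsilon>) + C3 * (W * D powr \<epsilon>)"
      by (intro order_trans[OF norm_diff_triangle_le[OF _ p2]]) (auto simp: norm_minus_commute intro: order_trans)
    thus "norm (2 * pi * \<i> * (\<Sum>n | real n < X. odd_coeff d n) - perron_line (1/2 + \<epsilon>) T (odd_logderiv d) X)
         \<le> (C1 + C3) * (X powr (1 + \<epsilon>) * T powr (-1 + \<epsilon>) * D powr \<epsilon>)" by (simp add: W_def algebra_simps)
  qed
qed

text \<open>The two terms are estimated separately for each d, without any equidistribution of the
  family among the multiples of p. On Re s = \<epsilon>/2 they are O(D powr \<epsilon>) uniformly in
  Im s, and X powr s has modulus X powr (\<epsilon>/2).\<close>

lemma density_local_perron:
  assumes \<epsilon>: "0 < \<epsilon>" "\<epsilon> < 1/4"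
  obtains C where "C > 0"
    "\<And>X T D d. 2 < T \<Longrightarrow> T < X \<Longrightarrow> 1 < d \<Longrightarrow> real_of_int d < D \<Longrightarrow>
       norm (perron_line (1/2 + \<epsilon>) T (\<lambda>s. density_series s - local_sum d s) X)
         \<le> C * (X powr (1 + \<epsilon>) * T powr (-1 + \<epsilon>) * D powr \<epsilon>)"
proof -
  obtain B1 where B1: "B1 \<ge> 0" "\<And>s. Re s \<ge> \<epsilon>/2 \<Longrightarrow> norm (density_series s) \<le> B1"
    using norm_density_series_le[of "\<epsilon>/2"] \<epsilon> by auto
  obtain C2 where C2: "C2 > 0" "\<And>T. T \<ge> 1 \<Longrightarrow> 2 * arsinh (T / (\<epsilon>/2)) \<le> C2 * T powr \<epsilon>"
    using arsinh_bound[of "\<epsilon>/2" \<epsilon>] \<epsilon> by auto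
  define k where "k = 1 / (1 - 2 powr (-2 * (\<epsilon>/2)) :: real)"
  have k: "k > 0" using \<epsilon> unfolding k_def by (simp add: powr_less_one)
  define B3 where "B3 = B1 + k / \<epsilon>"
  have B3: "B3 > 0" using B1(1) k \<epsilon> by (simp add: B3_def add_nonneg_pos)
  show thesis
  proof (rule that[of "B3 * C2 + 2 * B3"])
    show "B3 * C2 + 2 * B3 > 0" using B3 C2(1) by (simp add: add_pos_pos)
    fix X T D :: real and d :: int
    assume T: "2 < T" "T < X" and d: "1 < d" "real_of_int d < D"
    define W where "W = X powr (1 + \<epsilon>) * T powr (-1 + \<epsilon>)"
    define f where "f = (\<lambda>s. density_series s - local_sum d s)"
    have D1: "D > 1" using d by simp
    have De: "D powr \<epsilon> \<ge> 1" using D1 \<epsilon> by (simp add: ge_one_powr_ge_zero)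
    have hol: "f holomorphic_on {s. Re s > 0}"
      unfolding f_def by (intro holomorphic_on_diff density_series_holomorphic local_sum_holomorphic)
    have bd: "norm (f s) \<le> B3 * D powr \<epsilon>" if s: "Re s \<ge> \<epsilon>/2" for s
    proof -
      have "ln (real_of_int d) \<le> ln D" using d by (subst ln_le_cancel_iff) auto
      also have "\<dots> \<le> D powr \<epsilon> / \<epsilon>" by (rule ln_powr_bound) (use D1 \<epsilon> in auto)
      finally have "k * ln (real_of_int d) \<le> k * (D powr \<epsilon> / \<epsilon>)" using k by (intro mult_left_mono) auto
      moreover have "norm (local_sum d s) \<le> k * ln (real_of_int d)"
        using norm_local_sum_le[of "\<epsilon>/2" d s] d s \<epsilon> by (simp add: k_def)
      moreover have "norm (density_series s) \<le> B1 * D powr \<epsilon>"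
        using B1(2)[OF s] mult_left_mono[OF De B1(1)] by simp
      ultimately have "norm (f s) \<le> B1 * D powr \<epsilon> + k * (D powr \<epsilon> / \<epsilon>)"
        unfolding f_def by (intro order_trans[OF norm_triangle_ineq4] add_mono) auto
      thus ?thesis by (simp add: B3_def algebra_simps)
    qed
    have B0: "B3 * D powr \<epsilon> \<ge> 0" using B3 by simp
    have "norm (perron_line (\<epsilon>/2) T f X) \<le> B3 * D powr \<epsilon> * X powr (\<epsilon>/2) * (2 * arsinh (T / (\<epsilon>/2)))"
      by (rule norm_perron_line_le) (use \<epsilon> T B0 bd continuous_on_vertical_segment[OF hol, of "\<epsilon>/2" T] in auto)
    also have "\<dots> \<le> B3 * D powr \<epsilon> * X powr \<epsilon> * (C2 * T powr \<epsilon>)"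
    proof (rule mult_mono)
      show "B3 * D powr \<epsilon> * X powr (\<epsilon>/2) \<le> B3 * D powr \<epsilon> * X powr \<epsilon>"
        using T \<epsilon> B0 by (intro mult_left_mono powr_mono) auto
      show "2 * arsinh (T / (\<epsilon>/2)) \<le> C2 * T powr \<epsilon>" by (rule C2(2)) (use T in simp)
    qed (use T \<epsilon> B3 in \<open>auto intro!: less_imp_le\<close>)
    also have "\<dots> = B3 * C2 * D powr \<epsilon> * (X powr \<epsilon> * T powr \<epsilon>)" by simp
    also have "\<dots> \<le> B3 * C2 * D powr \<epsilon> * W"
      unfolding W_def using error_term_lower_bounds(2)[OF T \<epsilon>(1)] B3 C2(1) by (intro mult_left_mono) auto
    finally have p1: "norm (perron_line (\<epsilon>/2) T f X) \<le> B3 * C2 * (W * D powr \<epsilon>)" by (simp add: mult_ac)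
    have "norm (perron_line (1/2 + \<epsilon>) T f X - perron_line (\<epsilon>/2) T f X) \<le> 2 * (B3 * D powr \<epsilon> * X powr (1/2 + \<epsilon>) / T * ((1/2 + \<epsilon>) - \<epsilon>/2))"
      unfolding perron_line_def
      by (rule norm_shift_vertical_line_le[OF hol]) (use \<epsilon> T B0 bd in auto)
    also have "(1/2 + \<epsilon>) - \<epsilon>/2 = (1 + \<epsilon>) / 2" by (simp add: field_simps)
    also have "2 * (B3 * D powr \<epsilon> * X powr (1/2 + \<epsilon>) / T * ((1 + \<epsilon>) / 2)) = B3 * D powr \<epsilon> * (X powr (1/2 + \<epsilon>) / T) * (1 + \<epsilon>)" by simp
    also have "\<dots> \<le> B3 * D powr \<epsilon> * W * 2"
    proof (intro mult_mono mult_nonneg_nonneg)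
      have "X powr (1/2 + \<epsilon>) / T \<le> X powr (1 + \<epsilon>) / T" using T by (intro divide_right_mono powr_mono) auto
      thus "X powr (1/2 + \<epsilon>) / T \<le> W" unfolding W_def using error_term_lower_bounds(1)[OF T \<epsilon>(1)] by linarith
    qed (use \<epsilon> T B3 in \<open>auto simp: W_def\<close>)
    finally have p2: "norm (perron_line (1/2 + \<epsilon>) T f X - perron_line (\<epsilon>/2) T f X) \<le> 2 * B3 * (W * D powr \<epsilon>)" by (simp add: mult_ac)
    have "norm (perron_line (1/2 + \<epsilon>) T f X) \<le> B3 * C2 * (W * D powr \<epsilon>) + 2 * B3 * (W * D powr \<epsilon>)"
      using norm_triangle_sub[of "perron_line (1/2 + \<epsilon>) T f X" "perron_line (\<epsilon>/2) T f X"] p1 p2 by linarith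
    thus "norm (perron_line (1/2 + \<epsilon>) T (\<lambda>s. density_series s - local_sum d s) X)
         \<le> (B3 * C2 + 2 * B3) * (X powr (1 + \<epsilon>) * T powr (-1 + \<epsilon>) * D powr \<epsilon>)" by (simp add: f_def W_def algebra_simps)
  qed
qed

text \<open>The conjecture with \<delta> = 1 bounds the set behind \<open>ratios_error\<close>; only
  then is its \<open>Sup\<close> known to be an upper bound.\<close>

lemma norm_ratios_remainder_le:
  assumes rc: "ratios_conjecture" and pos: "0 < c" "0 < K" "0 < \<eta>" "0 < \<epsilon>" "\<epsilon> < 1"
  shows "1 < D' \<Longrightarrow> D' \<le> D \<Longrightarrow> r \<in> ratios_range c K \<eta> \<epsilon> D' \<Longrightarrow> norm (ratios_remainder D' r) \<le> ratios_error c K \<eta> \<epsilon> D"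
    and "0 \<le> ratios_error c K \<eta> \<epsilon> D"
proof -
  let ?S = "insert 0 {norm (ratios_remainder D' r) | D' r. 1 < D' \<and> D' \<le> D \<and> r \<in> ratios_range c K \<eta> \<epsilon> D'}"
  have "\<exists>B. \<forall>D>1. \<forall>r\<in>ratios_range c K \<eta> \<epsilon> D. norm (ratios_remainder D r) \<le> B * D powr (1/2 + 1)"
    using rc pos unfolding ratios_conjecture_def by (metis zero_less_one)
  then obtain B where B: "\<And>D r. D > 1 \<Longrightarrow> r \<in> ratios_range c K \<eta> \<epsilon> D \<Longrightarrow> norm (ratios_remainder D r) \<le> B * D powr (1/2 + 1)"
    by blast
  have bdd: "bdd_above ?S"
  proof (rule bdd_aboveI[of _ "\<bar>B\<bar> * \<bar>D\<bar> powr (1/2 + 1)"])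
    fix x assume "x \<in> ?S"
    then consider "x = 0" | D' r where "x = norm (ratios_remainder D' r)" "1 < D'" "D' \<le> D" "r \<in> ratios_range c K \<eta> \<epsilon> D'" by blast
    thus "x \<le> \<bar>B\<bar> * \<bar>D\<bar> powr (1/2 + 1)"
    proof cases
      case 2
      have "x \<le> B * D' powr (1/2 + 1)" using B[OF 2(2,4)] 2(1) by simp
      also have "\<dots> \<le> \<bar>B\<bar> * D powr (1/2 + 1)" using 2 by (intro mult_mono powr_mono2) auto
      finally show ?thesis using 2 by simp
    qed simp
  qed
  show "0 \<le> ratios_error c K \<eta> \<epsilon> D" unfolding ratios_error_def by (rule cSup_upper[OF _ bdd]) simp
  assume "1 < D'" "D' \<le> D" "r \<in> ratios_range c K \<eta> \<epsilon> D'"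
  thus "norm (ratios_remainder D' r) \<le> ratios_error c K \<eta> \<epsilon> D"
    unfolding ratios_error_def by (intro cSup_upper[OF _ bdd]) blast
qed

text \<open>The family is the difference of the families below \<open>D\<close> and below \<open>\<lfloor>D\<^sub>1\<rfloor> + 1\<close>; the latter cutoff
  rather than \<open>D\<^sub>1\<close> is needed in case \<open>D\<^sub>1\<close> is itself a fundamental discriminant.\<close>

lemma family_remainder_bound:
  assumes rc: "ratios_conjecture" and pos: "0 < c" "0 < K" "0 < \<eta>" "0 < \<epsilon>" "\<epsilon> < 1/4" "\<eta> \<le> 1/4 - \<epsilon>"
    and D: "1 < D1" "D1 < D" "c / ln D1 \<le> \<epsilon>" and t: "\<bar>t\<bar> \<le> K * D1 powr (1 - \<epsilon>)"
  defines "s \<equiv> Complex (1/2 + \<epsilon>) t"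
  shows "norm (\<Sum>d\<in>discs_between D1 D. deriv (L_kronecker d) s / L_kronecker d s - ratios_main_term d (s - 1/2))
    \<le> 2 * ratios_error c K \<eta> \<epsilon> D"
proof (cases "D \<le> real_of_int \<lfloor>D1\<rfloor> + 1")
  \<comment> \<open>No integer lies strictly between D1 and the next integer, so the family is
    empty.\<close>
  case True
  have "\<not> (D1 < real_of_int d \<and> real_of_int d < D)" for d
  proof
    assume d: "D1 < real_of_int d \<and> real_of_int d < D"
    hence "\<lfloor>D1\<rfloor> < d" by (simp add: floor_less_iff)
    thus False using d True by linarith
  qed
  hence "discs_between D1 D = {}" by (auto simp: discs_between_def)
  thus ?thesis using norm_ratios_remainder_le(2)[OF rc pos(1-4)] pos by simp
next
  case False
  define D1' where "D1' = real_of_int \<lfloor>D1\<rfloor> + 1"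
  have D1': "D1 < D1'" "D1' < D" using False unfolding D1'_def by linarith+
  have sr: "s - 1/2 = Complex \<epsilon> t" by (simp add: s_def complex_eq_iff)
  have range: "s - 1/2 \<in> ratios_range c K \<eta> \<epsilon> D'" if D': "D1 \<le> D'" for D'
  proof -
    have "c / ln D' \<le> c / ln D1" using D' D pos by (intro divide_left_mono mult_pos_pos) auto
    moreover have "K * D1 powr (1 - \<epsilon>) \<le> K * D' powr (1 - \<epsilon>)" using D' D pos by (intro mult_left_mono powr_mono2) auto
    moreover have "Complex \<epsilon> t \<noteq> 1/2" using pos by (auto simp: complex_eq_iff)
    moreover have "\<epsilon> \<le> 3/4 - \<eta>" using pos by linarith
    ultimately have "c / ln D' \<le> \<epsilon>" "\<bar>t\<bar> \<le> K * D' powr (1 - \<epsilon>)" "Complex \<epsilon> t \<noteq> 1/2" "\<epsilon> \<le> 3/4 - \<eta>"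
      using D t by linarith+
    thus ?thesis unfolding ratios_range_def sr by simp
  qed
  have R: "norm (ratios_remainder D' (s - 1/2)) \<le> ratios_error c K \<eta> \<epsilon> D" if "D1 \<le> D'" "D' \<le> D" for D'
    by (rule norm_ratios_remainder_le(1)[OF rc pos(1-4)]) (use that range D pos in auto)
  have split: "discs_between 1 D = discs_between 1 D1' \<union> discs_between D1 D"
  proof (intro equalityI subsetI)
    fix d assume "d \<in> discs_between 1 D"
    moreover have "real_of_int d < D1' \<or> D1 < real_of_int d" using D1' by linarith
    ultimately show "d \<in> discs_between 1 D1' \<union> discs_between D1 D" by (auto simp: discs_between_def)
  next
    fix d assume "d \<in> discs_between 1 D1' \<union> discs_between D1 D"
    thus "d \<in> discs_between 1 D" using D D1' by (auto simp: discs_between_def)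
  qed
  have disj: "discs_between 1 D1' \<inter> discs_between D1 D = {}"
  proof -
    have "\<not> (D1 < real_of_int d \<and> real_of_int d < D1')" for d
    proof
      assume d: "D1 < real_of_int d \<and> real_of_int d < D1'"
      hence "\<lfloor>D1\<rfloor> < d" by (simp add: floor_less_iff)
      thus False using d unfolding D1'_def by linarith
    qed
    thus ?thesis by (auto simp: discs_between_def)
  qed
  let ?q = "\<lambda>d. deriv (L_kronecker d) s / L_kronecker d s - ratios_main_term d (s - 1/2)"
  have rem: "ratios_remainder D' (s - 1/2) = (\<Sum>d\<in>discs_between 1 D'. ?q d)" for D'
    by (simp add: ratios_remainder_def sum_subtractf)
  have "(\<Sum>d\<in>discs_between D1 D. ?q d) = ratios_remainder D (s - 1/2) - ratios_remainder D1' (s - 1/2)"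
    unfolding rem split by (subst sum.union_disjoint[OF _ _ disj]) (auto simp: finite_discs_between)
  also have "norm \<dots> \<le> ratios_error c K \<eta> \<epsilon> D + ratios_error c K \<eta> \<epsilon> D"
    by (intro order_trans[OF norm_triangle_ineq4] add_mono R) (use D D1' in auto)
  finally show ?thesis by simp
qed

section \<open>The dual term and the even prime powers\<close>

lemma dual_factor_eq:
  assumes "1/2 < Re s" "Re s < 1"
  shows "dual_factor (s - 1/2) = of_real (pi\<^sup>2 / 6) * (Gamma ((1 - s) / 2) / Gamma (s / 2)) * (zeta (2 - 2 * s) / zeta (3 - 2 * s))"
proof -
  have e: "1/4 - (s - 1/2)/2 = (1 - s)/2" "1/4 + (s - 1/2)/2 = s/2" "1 - 2 * (s - 1/2) = 2 - 2 * s"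
     "2 - 2 * (s - 1/2) = 3 - 2 * s" by (simp_all add: field_simps)
  have "dual_euler_product (s - 1/2) = zeta 2 / zeta (3 - 2 * s)"
    using dual_euler_product_eq[of "s - 1/2"] assms e(4) by simp
  thus ?thesis unfolding dual_factor_def e zeta_2 by (simp add: mult_ac)
qed

text \<open>In 1/2 < Re s < 1 every factor is regular: (1 - s) / 2 has positive real part, 2 - 2 s
  stays to the left of the pole of zeta, and 3 - 2 s lies where zeta has no zeros.\<close>

lemma dual_factor_continuous:
  assumes "0 < \<epsilon>" "\<epsilon> < 1/2"
  shows "continuous_on (closed_segment (Complex (1/2 + \<epsilon>) (-T)) (Complex (1/2 + \<epsilon>) T)) (\<lambda>s. dual_factor (s - 1/2))"
proof -
  let ?S = "{s. 1/2 < Re s \<and> Re s < 1}"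
  let ?f = "\<lambda>s. of_real (pi\<^sup>2 / 6) * (Gamma ((1 - s) / 2) / Gamma (s / 2)) * (zeta (2 - 2 * s) / zeta (3 - 2 * s))"
  have np: "z \<notin> \<int>\<^sub>\<le>\<^sub>0" if "Re z > 0" for z :: complex
    using that by (auto elim!: nonpos_Ints_cases)
  have g1: "(\<lambda>s. Gamma ((1 - s) / 2)) holomorphic_on ?S"
    by (rule holomorphic_on_compose_gen[OF _ holomorphic_Gamma[of "{z. Re z > 0}"], unfolded o_def])
       (use np in \<open>auto intro!: holomorphic_intros\<close>)
  have g2: "(\<lambda>s. Gamma (s / 2)) holomorphic_on ?S"
    by (rule holomorphic_on_compose_gen[OF _ holomorphic_Gamma[of "{z. Re z > 0}"], unfolded o_def])
       (use np in \<open>auto intro!: holomorphic_intros\<close>)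
  have z1: "(\<lambda>s. zeta (2 - 2 * s)) holomorphic_on ?S"
    by (rule holomorphic_on_compose_gen[OF _ zeta_holomorphic_on[of "{z. Re z < 1}"], unfolded o_def])
       (auto intro!: holomorphic_intros)
  have z2: "(\<lambda>s. zeta (3 - 2 * s)) holomorphic_on ?S"
    by (rule holomorphic_on_compose_gen[OF _ zeta_holomorphic_on[of "{z. Re z > 1}"], unfolded o_def])
       (auto intro!: holomorphic_intros)
  have "?f holomorphic_on ?S"
    by (intro holomorphic_on_mult holomorphic_on_divide g1 g2 z1 z2 holomorphic_on_const)
       (use np in \<open>auto simp: Gamma_eq_zero_iff zeta_nonzero\<close>)
  hence "(\<lambda>s. dual_factor (s - 1/2)) holomorphic_on ?S"
    by (rule holomorphic_transform) (simp add: dual_factor_eq)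
  thus ?thesis
    by (rule continuous_on_subset[OF holomorphic_on_imp_continuous_on])
       (use closed_segment_same_Re assms in force)
qed

lemma of_real_powr_scale:
  assumes "X > 0" "d > 0"
  shows "complex_of_real (X powr (1/2)) * of_real (pi * X / d) powr (s - 1/2) = of_real (d / pi) powr (1/2 - s) * of_real X powr s"
proof -
  have r: "complex_of_real x powr w = exp (w * of_real (ln x))" if "x > 0" for x w
    using that by (simp add: powr_def Ln_of_real)
  have l: "ln (pi * X / d) = ln X - ln (d / pi)" using assms by (simp add: ln_div ln_mult)
  have "complex_of_real (X powr (1/2)) = exp (1/2 * of_real (ln X))"
    using assms by (simp add: powr_def exp_of_real[symmetric])
  thus ?thesis using assms by (simp add: r l exp_add[symmetric] algebra_simps del: of_real_divide)
qed

text \<open>As 2 ^ k < X and ln 2 >= 1/2, there are at most 2 ln X exponents. For each of them,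
  exchanging the sums over p and d leaves an average over d of sums of ln p over primes p dividing
  d, each at most ln D.\<close>

lemma even_sum_bound:
  assumes X: "X > 1" and D: "1 < D1" "D1 < D"
  defines "F \<equiv> discs_between D1 D"
  shows "\<bar>\<Sum>(p, k)\<in>{(p::nat, k::nat). prime p \<and> 0 < k \<and> even k \<and> real (p ^ k) < X}.
      real (card {d\<in>F. int p dvd d}) / real (card F) * ln (real p)\<bar> \<le> 2 * ln X * ln D"
proof (cases "F = {}")
  case True
  thus ?thesis using X D by simp
next
  case False
  have fin: "finite F" unfolding F_def by (rule finite_discs_between)
  define N where "N = real (card F)"
  have N: "N > 0" using False fin by (simp add: N_def card_gt_0_iff)
  let ?S = "{(p::nat, k::nat). prime p \<and> 0 < k \<and> even k \<and> real (p ^ k) < X}"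
  let ?P = "{p::nat. prime p \<and> real p < X}"
  define w where "w = (\<lambda>p::nat. real (card {d\<in>F. int p dvd d}) / N * ln (real p))"
  define M where "M = nat \<lfloor>2 * ln X\<rfloor>"
  have w0: "w p \<ge> 0" for p unfolding w_def using N by (cases "p = 0") auto
  have finP: "finite ?P" by (rule finite_subset[of _ "{..nat \<lceil>X\<rceil>}"]) (auto, linarith)
  have sub: "?S \<subseteq> ?P \<times> {1..M}"
  proof
    fix x assume x: "x \<in> ?S"
    obtain p k where xpk: "x = (p, k)" by (cases x)
    have pk: "prime p" "0 < k" "real (p ^ k) < X" using x unfolding xpk by blast+
    have p2: "p \<ge> 2" using prime_ge_2_nat[OF pk(1)] .
    have "p ^ 1 \<le> p ^ k" using p2 pk(2) by (intro power_increasing) auto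
    hence "real p \<le> real (p ^ k)" by (simp only: power_one_right of_nat_le_iff)
    hence pX: "real p < X" using pk(3) by linarith
    have "(2::real) ^ k \<le> real p ^ k" using p2 by (intro power_mono) auto
    hence "2 ^ k < X" using pk(3) by simp
    hence "ln (2 ^ k) < ln X" using X by (subst ln_less_cancel_iff) auto
    hence "real k * ln 2 < ln X" by (simp add: ln_realpow)
    moreover have "ln 2 \<ge> (1/2 :: real)" using ln2_ge_two_thirds by simp
    hence "real k * (1/2) \<le> real k * ln 2" by (intro mult_left_mono) auto
    ultimately have "real k \<le> 2 * ln X" by linarith
    hence "k \<le> M" unfolding M_def by linarith
    thus "x \<in> ?P \<times> {1..M}" using pk pX unfolding xpk by auto
  qed
  have "(\<Sum>(p, k)\<in>?S. w p) \<le> (\<Sum>(p, k)\<in>?P \<times> {1..M}. w p)"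
    by (rule sum_mono2) (use sub finP w0 in auto)
  also have "\<dots> = real M * (\<Sum>p\<in>?P. w p)"
    by (simp add: sum.cartesian_product[symmetric] sum_distrib_left)
  also have "(\<Sum>p\<in>?P. w p) = (\<Sum>p\<in>?P. \<Sum>d\<in>F. if int p dvd d then ln (real p) / N else 0)"
  proof (rule sum.cong[OF refl])
    fix p
    have "(\<Sum>d\<in>F. if int p dvd d then ln (real p) / N else 0) = (\<Sum>d\<in>{d\<in>F. int p dvd d}. ln (real p) / N)"
      by (rule sum.inter_filter[symmetric, OF fin])
    thus "w p = (\<Sum>d\<in>F. if int p dvd d then ln (real p) / N else 0)" by (simp add: w_def)
  qed
  also have "\<dots> = (\<Sum>d\<in>F. \<Sum>p\<in>?P. if int p dvd d then ln (real p) / N else 0)" by (rule sum.swap)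
  also have "\<dots> \<le> (\<Sum>d\<in>F. ln D / N)"
  proof (rule sum_mono)
    fix d assume "d \<in> F"
    hence d: "d > 1" "real_of_int d < D" using D by (auto simp: F_def discs_between_def)
    have "(\<Sum>p\<in>?P. if int p dvd d then ln (real p) / N else 0) = (\<Sum>p\<in>{p\<in>?P. int p dvd d}. ln (real p) / N)"
      by (rule sum.inter_filter[symmetric, OF finP])
    also have "\<dots> \<le> (\<Sum>p\<in>prime_factors (nat d). ln (real p) / N)"
    proof (rule sum_mono2)
      show "{p\<in>?P. int p dvd d} \<subseteq> prime_factors (nat d)"
      proof
        fix p assume p: "p \<in> {p\<in>?P. int p dvd d}"
        hence "int p dvd int (nat d)" using d by simp
        hence "p dvd nat d" by (simp only: int_dvd_int_iff)
        thus "p \<in> prime_factors (nat d)" using p d by (auto simp: in_prime_factors_iff)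
      qed
      show "0 \<le> ln (real p) / N" if "p \<in> prime_factors (nat d) - {p\<in>?P. int p dvd d}" for p
        using N by (cases "p = 0") auto
    qed simp
    also have "\<dots> = (\<Sum>p\<in>prime_factors (nat d). ln (real p)) / N" by (rule sum_divide_distrib[symmetric])
    also have "\<dots> \<le> ln (real (nat d)) / N" by (intro divide_right_mono sum_ln_prime_factors_le) (use d N in auto)
    also have "\<dots> \<le> ln D / N" using d N by (intro divide_right_mono) auto
    finally show "(\<Sum>p\<in>?P. if int p dvd d then ln (real p) / N else 0) \<le> ln D / N" .
  qed
  also have "\<dots> = ln D" using N by (simp add: N_def)
  finally have "(\<Sum>(p, k)\<in>?S. w p) \<le> real M * ln D" by (simp add: mult_left_mono)
  also have "\<dots> \<le> 2 * ln X * ln D" using X D unfolding M_def by (intro mult_right_mono) auto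
  finally have "(\<Sum>(p, k)\<in>?S. w p) \<le> 2 * ln X * ln D" .
  moreover have "0 \<le> (\<Sum>(p, k)\<in>?S. w p)" by (intro sum_nonneg) (use w0 in auto)
  ultimately show ?thesis unfolding w_def N_def by simp
qed


definition dual_sum :: "int set \<Rightarrow> complex \<Rightarrow> complex" where
  "dual_sum F s = (\<Sum>d\<in>F. of_real (real_of_int d / pi) powr (1/2 - s) * dual_factor (s - 1/2))"

lemma dual_sum_continuous:
  assumes "0 < \<epsilon>" "\<epsilon> < 1/2" "\<And>d. d \<in> F \<Longrightarrow> d > 0"
  shows "continuous_on (closed_segment (Complex (1/2 + \<epsilon>) (-T)) (Complex (1/2 + \<epsilon>) T)) (dual_sum F)"
  unfolding dual_sum_def[abs_def]
proof (intro continuous_on_sum continuous_on_mult dual_factor_continuous assms(1,2))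
  fix d assume "d \<in> F"
  hence "real_of_int d / pi \<noteq> 0" using assms(3)[of d] by simp
  hence "(\<lambda>s. of_real (real_of_int d / pi) powr (1/2 - s)) holomorphic_on UNIV"
    by (intro holomorphic_intros) (simp del: of_real_divide)
  thus "continuous_on (closed_segment (Complex (1/2 + \<epsilon>) (-T)) (Complex (1/2 + \<epsilon>) T))
      (\<lambda>s. of_real (real_of_int d / pi) powr (1/2 - s))"
    by (rule continuous_on_subset[OF holomorphic_on_imp_continuous_on]) simp
qed

text \<open>X powr (1/2) * (pi X / d) powr (s - 1/2) equals (d / pi) powr (1/2 - s) * X powr s; this
  identifies the integral of the theorem with the Perron integral of the dual terms.\<close>

lemma perron_line_dual_sum:
  assumes "0 < \<epsilon>" "\<epsilon> < 1/2" "X > 0" "\<And>d. d \<in> F \<Longrightarrow> d > 0"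
    "N \<noteq> 0"
  shows "complex_of_real (X powr (1/2)) / (2 * of_real pi * \<i>)
             * contour_integral
                 (linepath (Complex (1/2 + \<epsilon>) (- T)) (Complex (1/2 + \<epsilon>) T))
                 (\<lambda>s. of_real (pi\<^sup>2 / 6) * (Gamma ((1 - s) / 2) / Gamma (s / 2))
                    * (zeta (2 - 2 * s) / zeta (3 - 2 * s))
                    * (1 / of_real N * (\<Sum>d\<in>F. of_real (pi * X / real_of_int d) powr (s - 1/2)))
                    / s)
     = 1 / (2 * pi * \<i> * of_real N) * perron_line (1/2 + \<epsilon>) T (dual_sum F) X"
proof -
  let ?l = "linepath (Complex (1/2 + \<epsilon>) (- T)) (Complex (1/2 + \<epsilon>) T)"
  let ?c = "1 / (complex_of_real (X powr (1/2)) * of_real N)"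
  have Xh: "complex_of_real (X powr (1/2)) \<noteq> 0" using assms by simp
  have "contour_integral ?l (\<lambda>s. of_real (pi\<^sup>2 / 6) * (Gamma ((1 - s) / 2) / Gamma (s / 2))
                    * (zeta (2 - 2 * s) / zeta (3 - 2 * s))
                    * (1 / of_real N * (\<Sum>d\<in>F. of_real (pi * X / real_of_int d) powr (s - 1/2)))
                    / s)
    = contour_integral ?l (\<lambda>s. ?c * (dual_sum F s * of_real X powr s / s))"
  proof (rule contour_integral_eq)
    fix s assume "s \<in> path_image ?l"
    hence s: "Re s = 1/2 + \<epsilon>" by (intro closed_segment_same_Re) simp
    have df: "dual_factor (s - 1/2) = of_real (pi\<^sup>2 / 6) * (Gamma ((1 - s) / 2) / Gamma (s / 2)) * (zeta (2 - 2 * s) / zeta (3 - 2 * s))"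
      by (rule dual_factor_eq) (use s assms in auto)
    have "complex_of_real (X powr (1/2)) * (\<Sum>d\<in>F. of_real (pi * X / real_of_int d) powr (s - 1/2))
       = (\<Sum>d\<in>F. of_real (real_of_int d / pi) powr (1/2 - s) * of_real X powr s)"
      unfolding sum_distrib_left
    proof (rule sum.cong[OF refl])
      fix d assume "d \<in> F"
      hence "real_of_int d > 0" using assms(4)[of d] by simp
      thus "complex_of_real (X powr (1/2)) * of_real (pi * X / real_of_int d) powr (s - 1/2)
        = of_real (real_of_int d / pi) powr (1/2 - s) * of_real X powr s"
        by (rule of_real_powr_scale[OF assms(3)])
    qed
    hence "complex_of_real (X powr (1/2)) * (\<Sum>d\<in>F. of_real (pi * X / real_of_int d) powr (s - 1/2)) * dual_factor (s - 1/2)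
       = dual_sum F s * of_real X powr s"
      by (simp add: dual_sum_def sum_distrib_right sum_distrib_left mult_ac)
    moreover have "u * (1 / n * S) / w = 1 / (x * n) * ((x * S * u) / w)" if "x \<noteq> 0" for u n S w x :: complex
      using that by simp
    ultimately have "dual_factor (s - 1/2) * (1 / of_real N * (\<Sum>d\<in>F. of_real (pi * X / real_of_int d) powr (s - 1/2))) / s
      = ?c * (dual_sum F s * of_real X powr s / s)"
      using Xh by metis
    thus "of_real (pi\<^sup>2 / 6) * (Gamma ((1 - s) / 2) / Gamma (s / 2))
                    * (zeta (2 - 2 * s) / zeta (3 - 2 * s))
                    * (1 / of_real N * (\<Sum>d\<in>F. of_real (pi * X / real_of_int d) powr (s - 1/2)))
                    / s = ?c * (dual_sum F s * of_real X powr s / s)" unfolding df .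
  qed
  also have "\<dots> = ?c * perron_line (1/2 + \<epsilon>) T (dual_sum F) X"
    unfolding perron_line_def
    by (rule contour_integral_lmul, rule perron_line_integrable) (use assms dual_sum_continuous in auto)
  finally show ?thesis using Xh by simp
qed

lemma large_family_bound:
  assumes rc: "ratios_conjecture" and \<epsilon>: "0 < \<epsilon>" "\<epsilon> < 1/4"
    and pos: "0 < c" "0 < \<eta>" "\<eta> \<le> 1/4 - \<epsilon>" "0 < K"
  obtains C where "C > 0"
    "\<And>X T D1 D. 2 < T \<Longrightarrow> T < X \<Longrightarrow> X \<notin> \<int> \<Longrightarrow> 1 < D1 \<Longrightarrow> D1 < D \<Longrightarrow> T \<le> K * D1 powr (1 - \<epsilon>) \<Longrightarrow> c / ln D1 \<le> \<epsilon> \<Longrightarrow>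
      norm (2 * pi * \<i> * (\<Sum>d\<in>discs_between D1 D. \<Sum>n | real n < X. odd_coeff d n)
        - perron_line (1/2 + \<epsilon>) T (dual_sum (discs_between D1 D)) X)
      \<le> C * (X powr (1/2 + \<epsilon>) * T powr \<epsilon> * ratios_error c K \<eta> \<epsilon> D
            + card (discs_between D1 D) * (X powr (1 + \<epsilon>) * T powr (-1 + \<epsilon>) * D powr \<epsilon>))"
proof -
  obtain C1 where C1: "C1 > 0"
    "\<And>X T D d. 2 < T \<Longrightarrow> T < X \<Longrightarrow> X \<notin> \<int> \<Longrightarrow> fundamental_discriminant d \<Longrightarrow> 1 < d \<Longrightarrow> real_of_int d < D \<Longrightarrow>
       norm (2 * pi * \<i> * (\<Sum>n | real n < X. odd_coeff d n) - perron_line (1/2 + \<epsilon>) T (odd_logderiv d) X)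
         \<le> C1 * (X powr (1 + \<epsilon>) * T powr (-1 + \<epsilon>) * D powr \<epsilon>)"
    using odd_perron[OF rc \<epsilon>] by blast
  obtain C2 where C2: "C2 > 0"
    "\<And>X T D d. 2 < T \<Longrightarrow> T < X \<Longrightarrow> 1 < d \<Longrightarrow> real_of_int d < D \<Longrightarrow>
       norm (perron_line (1/2 + \<epsilon>) T (\<lambda>s. density_series s - local_sum d s) X)
         \<le> C2 * (X powr (1 + \<epsilon>) * T powr (-1 + \<epsilon>) * D powr \<epsilon>)"
    using density_local_perron[OF \<epsilon>] by blast
  obtain C3 where C3: "C3 > 0" "\<And>T. T \<ge> 1 \<Longrightarrow> 2 * arsinh (T / (1/2 + \<epsilon>)) \<le> C3 * T powr \<epsilon>"
    using arsinh_bound[of "1/2 + \<epsilon>" \<epsilon>] \<epsilon> by auto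
  define C where "C = C1 + C2 + 2 * C3"
  have "C > 0" using C1(1) C2(1) C3(1) by (simp add: C_def)
  thus thesis
  proof (rule that)
    fix X T D1 D :: real
    assume T: "2 < T" "T < X" and X: "X \<notin> \<int>" and D: "1 < D1" "D1 < D"
      and TK: "T \<le> K * D1 powr (1 - \<epsilon>)" and cD: "c / ln D1 \<le> \<epsilon>"
    define F where "F = discs_between D1 D"
    define R where "R = ratios_error c K \<eta> \<epsilon> D"
    define W where "W = X powr (1 + \<epsilon>) * T powr (-1 + \<epsilon>) * D powr \<epsilon>"
    let ?\<sigma> = "1/2 + \<epsilon>"
    let ?seg = "closed_segment (Complex ?\<sigma> (-T)) (Complex ?\<sigma> T)"
    let ?L = "\<lambda>f. perron_line ?\<sigma> T f X"
    have fin: "finite F" unfolding F_def by (rule finite_discs_between)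
    have F: "fundamental_discriminant d" "1 < d" "real_of_int d < D" if "d \<in> F" for d
      using that D by (auto simp: F_def discs_between_def)
    have R0: "R \<ge> 0" unfolding R_def by (rule norm_ratios_remainder_le(2)[OF rc]) (use pos \<epsilon> in auto)
    have \<sigma>: "?\<sigma> > 0" "X > 0" using \<epsilon> T by auto
    have c_odd: "continuous_on ?seg (odd_logderiv d)" if "d \<in> F" for d
      by (rule continuous_on_vertical_segment[OF odd_logderiv_holomorphic[OF rc F(1,2)[OF that]]]) (use \<epsilon> in auto)
    define h where "h = (\<lambda>d s. density_series s - local_sum d s)"
    have c_dl: "continuous_on ?seg (h d)" for d
      unfolding h_def by (rule continuous_on_vertical_segment[OF holomorphic_on_diff[OF density_series_holomorphic local_sum_holomorphic]])
         (use \<epsilon> in auto)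
    have c_dual: "continuous_on ?seg (dual_sum F)"
      by (rule dual_sum_continuous) (use \<epsilon> F(2) in force)+
    \<comment> \<open>The terms zeta'/zeta(2 s) and \<open>local_sum\<close> cancel in this
      combination, and what is left is the sum over F of L'/L minus
      \<open>ratios_main_term\<close>.\<close>
    define \<Delta> where "\<Delta> = (\<lambda>s. dual_sum F s - (\<Sum>d\<in>F. odd_logderiv d s) - (\<Sum>d\<in>F. h d s))"
    have c_\<Delta>: "continuous_on ?seg \<Delta>" unfolding \<Delta>_def
      by (intro continuous_on_diff continuous_on_sum c_dual c_odd c_dl)
    have \<Delta>_le: "norm (\<Delta> (Complex ?\<sigma> t)) \<le> 2 * R" if t: "\<bar>t\<bar> \<le> T" for t
    proof -
      let ?s = "Complex ?\<sigma> t"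
      have "\<Delta> ?s = (\<Sum>d\<in>F. deriv (L_kronecker d) ?s / L_kronecker d ?s - ratios_main_term d (?s - 1/2))"
        unfolding \<Delta>_def dual_sum_def sum_subtractf[symmetric]
      proof (rule sum.cong[OF refl])
        fix d
        have "Re ?s > 1/2" using \<epsilon> by simp
        from ratios_main_term_eq[OF this, of d]
        show "of_real (real_of_int d / pi) powr (1/2 - ?s) * dual_factor (?s - 1/2) - odd_logderiv d ?s - h d ?s
          = deriv (L_kronecker d) ?s / L_kronecker d ?s - ratios_main_term d (?s - 1/2)"
          unfolding odd_logderiv_def h_def by simp
      qed
      thus ?thesis unfolding R_def F_def
        using family_remainder_bound[OF rc pos(1,4,2) \<epsilon> pos(3) D cD, of t] t TK by simp
    qed
    have L\<Delta>: "norm (?L \<Delta>) \<le> 2 * C3 * (X powr ?\<sigma> * T powr \<epsilon> * R)"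
    proof -
      have "norm (?L \<Delta>) \<le> 2 * R * X powr ?\<sigma> * (2 * arsinh (T / ?\<sigma>))"
        by (rule norm_perron_line_le[OF _ _ _ _ c_\<Delta> \<Delta>_le]) (use \<epsilon> T R0 in auto)
      also have "\<dots> \<le> 2 * R * X powr ?\<sigma> * (C3 * T powr \<epsilon>)"
        by (intro mult_left_mono C3(2)) (use T R0 in auto)
      finally show ?thesis by (simp add: mult_ac)
    qed
    have "?L (dual_sum F) - ?L (\<lambda>s. \<Sum>d\<in>F. odd_logderiv d s) - ?L (\<lambda>s. \<Sum>d\<in>F. h d s) = ?L \<Delta>"
    proof -
      have c1: "continuous_on ?seg (\<lambda>s. \<Sum>d\<in>F. odd_logderiv d s)" by (intro continuous_on_sum c_odd)
      have c2: "continuous_on ?seg (\<lambda>s. \<Sum>d\<in>F. h d s)" by (intro continuous_on_sum c_dl)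
      show ?thesis unfolding \<Delta>_def
        using perron_line_diff[OF \<sigma> continuous_on_diff[OF c_dual c1] c2] perron_line_diff[OF \<sigma> c_dual c1] by simp
    qed
    moreover have "?L (\<lambda>s. \<Sum>d\<in>F. odd_logderiv d s) = (\<Sum>d\<in>F. ?L (odd_logderiv d))"
      by (rule perron_line_sum[OF \<sigma> fin c_odd])
    moreover have "?L (\<lambda>s. \<Sum>d\<in>F. h d s) = (\<Sum>d\<in>F. ?L (h d))"
      by (rule perron_line_sum[OF \<sigma> fin c_dl])
    ultimately have "?L (dual_sum F) = (\<Sum>d\<in>F. ?L (odd_logderiv d)) + (\<Sum>d\<in>F. ?L (h d)) + ?L \<Delta>"
      by (simp add: algebra_simps)
    hence "2 * pi * \<i> * (\<Sum>d\<in>F. \<Sum>n | real n < X. odd_coeff d n) - ?L (dual_sum F)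
       = (\<Sum>d\<in>F. 2 * pi * \<i> * (\<Sum>n | real n < X. odd_coeff d n) - ?L (odd_logderiv d))
         - (\<Sum>d\<in>F. ?L (h d)) - ?L \<Delta>"
      by (simp add: sum_subtractf sum_distrib_left)
    also have "norm \<dots> \<le> card F * (C1 * W) + card F * (C2 * W) + 2 * C3 * (X powr ?\<sigma> * T powr \<epsilon> * R)"
    proof (intro order_trans[OF norm_triangle_ineq4] add_mono L\<Delta>)
      show "norm (\<Sum>d\<in>F. 2 * pi * \<i> * (\<Sum>n | real n < X. odd_coeff d n) - ?L (odd_logderiv d)) \<le> card F * (C1 * W)"
        using C1(2)[OF T X F] by (intro sum_norm_bound) (simp add: W_def)
      show "norm (\<Sum>d\<in>F. ?L (h d)) \<le> card F * (C2 * W)"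
        using C2(2)[OF T F(2,3)] by (intro sum_norm_bound) (simp add: W_def h_def)
    qed
    also have "\<dots> \<le> C * (X powr ?\<sigma> * T powr \<epsilon> * R + card F * W)"
    proof -
      have "0 \<le> (C1 + C2) * (X powr ?\<sigma> * T powr \<epsilon> * R)" using C1(1) C2(1) R0 by simp
      moreover have "0 \<le> 2 * C3 * (card F * W)" using C3(1) by (simp add: W_def)
      ultimately show ?thesis unfolding C_def by (simp add: algebra_simps)
    qed
    finally show "norm (2 * pi * \<i> * (\<Sum>d\<in>discs_between D1 D. \<Sum>n | real n < X. odd_coeff d n)
        - perron_line (1/2 + \<epsilon>) T (dual_sum (discs_between D1 D)) X)
      \<le> C * (X powr (1/2 + \<epsilon>) * T powr \<epsilon> * ratios_error c K \<eta> \<epsilon> D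
            + card (discs_between D1 D) * (X powr (1 + \<epsilon>) * T powr (-1 + \<epsilon>) * D powr \<epsilon>))"
      unfolding F_def R_def W_def .
  qed
qed

lemma small_family_bound:
  assumes \<epsilon>: "0 < \<epsilon>" "\<epsilon> < 1/4"
  obtains C where "C > 0"
    "\<And>X T D1 D. 2 < T \<Longrightarrow> T < X \<Longrightarrow> 1 < D1 \<Longrightarrow> D1 < D \<Longrightarrow> T \<le> T0 \<Longrightarrow>
      norm (2 * pi * \<i> * (\<Sum>d\<in>discs_between D1 D. \<Sum>n | real n < X. odd_coeff d n)
        - perron_line (1/2 + \<epsilon>) T (dual_sum (discs_between D1 D)) X)
      \<le> C * (card (discs_between D1 D) * (X powr (1 + \<epsilon>) * T powr (-1 + \<epsilon>) * D powr \<epsilon>))"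
proof -
  let ?\<sigma> = "1/2 + \<epsilon>"
  \<comment> \<open>The maximum with 2 keeps the segment nondegenerate for every T0. One compact set
    then contains all segments with T <= T0.\<close>
  define T1 where "T1 = max T0 2"
  have "compact ((\<lambda>s. dual_factor (s - 1/2)) ` closed_segment (Complex ?\<sigma> (-T1)) (Complex ?\<sigma> T1))"
    using \<epsilon> by (intro compact_continuous_image dual_factor_continuous compact_segment) auto
  hence "bounded ((\<lambda>s. dual_factor (s - 1/2)) ` closed_segment (Complex ?\<sigma> (-T1)) (Complex ?\<sigma> T1))" by (rule compact_imp_bounded)
  then obtain M where M: "\<And>s. s \<in> closed_segment (Complex ?\<sigma> (-T1)) (Complex ?\<sigma> T1) \<Longrightarrow> norm (dual_factor (s - 1/2)) \<le> M"
    unfolding bounded_iff by blast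
  obtain C3 where C3: "C3 > 0" "\<And>T. T \<ge> 1 \<Longrightarrow> 2 * arsinh (T / (1/2 + \<epsilon>)) \<le> C3 * T powr \<epsilon>"
    using arsinh_bound[of "1/2 + \<epsilon>" \<epsilon>] \<epsilon> by auto
  define M1 where "M1 = \<bar>M\<bar> * pi powr \<epsilon>"
  \<comment> \<open>The constant 2 / \<epsilon> comes from at most 2 X coefficients of size ln X <=
    X powr \<epsilon> / \<epsilon>. The last factor makes up for T powr (-1 + \<epsilon>), as T is
    at most T1.\<close>
  define C where "C = (2 * pi * (2 / \<epsilon>) + M1 * (C3 * T1 powr \<epsilon>)) * T1 powr (1 - \<epsilon>)"
  have "C > 0" unfolding C_def M1_def using \<epsilon> C3(1)
    by (intro mult_pos_pos add_pos_nonneg) (auto simp: T1_def)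
  thus thesis
  proof (rule that)
    fix X T D1 D :: real
    assume T: "2 < T" "T < X" and D: "1 < D1" "D1 < D" and TT: "T \<le> T0"
    define F where "F = discs_between D1 D"
    define W where "W = X powr (1 + \<epsilon>) * T powr (-1 + \<epsilon>) * D powr \<epsilon>"
    define N where "N = real (card F)"
    have T1: "T \<le> T1" "T1 \<ge> 2" using TT by (auto simp: T1_def)
    have fin: "finite F" unfolding F_def by (rule finite_discs_between)
    have F: "1 < d" if "d \<in> F" for d using that D by (auto simp: F_def discs_between_def)
    have a: "norm (\<Sum>n | real n < X. odd_coeff d n) \<le> 2 / \<epsilon> * X powr (1 + \<epsilon>)" for d
    proof -
      have "norm (\<Sum>n | real n < X. odd_coeff d n) \<le> (\<Sum>n | real n < X. ln X)"
      proof (rule sum_norm_le)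
        fix n assume "n \<in> {n. real n < X}"
        hence n: "real n < X" by simp
        have "norm (odd_coeff d n) \<le> ln (real n)" by (rule norm_odd_coeff_le)
        also have "\<dots> \<le> ln X" using n T by (cases "n = 0") auto
        finally show "norm (odd_coeff d n) \<le> ln X" .
      qed
      also have "\<dots> = real (card {n. real n < X}) * ln X" by simp
      also have "\<dots> \<le> (2 * X) * (X powr \<epsilon> / \<epsilon>)"
      proof (intro mult_mono ln_powr_bound)
        have "{n. real n < X} \<subseteq> {..nat \<lfloor>X\<rfloor>}" by (auto simp: le_nat_floor)
        hence "card {n. real n < X} \<le> card {..nat \<lfloor>X\<rfloor>}" by (intro card_mono) auto
        hence "real (card {n. real n < X}) \<le> real (nat \<lfloor>X\<rfloor>) + 1" by simp
        thus "real (card {n. real n < X}) \<le> 2 * X" using T by linarith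
      qed (use T \<epsilon> in auto)
      also have "\<dots> = 2 / \<epsilon> * X powr (1 + \<epsilon>)" using T by (simp add: powr_add)
      finally show ?thesis .
    qed
    have b: "norm (dual_sum F (Complex ?\<sigma> t)) \<le> N * M1" if t: "\<bar>t\<bar> \<le> T" for t
    proof -
      let ?s = "Complex ?\<sigma> t"
      have seg: "?s \<in> closed_segment (Complex ?\<sigma> (-T1)) (Complex ?\<sigma> T1)"
      proof -
        have "?s = (1 - (t + T1) / (2 * T1)) *\<^sub>R Complex ?\<sigma> (-T1) + ((t + T1) / (2 * T1)) *\<^sub>R Complex ?\<sigma> T1"
          using T1 by (simp add: complex_eq_iff field_simps)
        moreover have "0 \<le> (t + T1) / (2 * T1)" "(t + T1) / (2 * T1) \<le> 1" using t T1 by (auto simp: field_simps)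
        ultimately show ?thesis unfolding closed_segment_def by blast
      qed
      have "norm (dual_sum F ?s) \<le> N * M1" unfolding dual_sum_def N_def
      proof (rule sum_norm_bound)
        fix d assume "d \<in> F"
        hence d: "real_of_int d > 1" using F[of d] by simp
        have "norm (of_real (real_of_int d / pi) powr (1/2 - ?s) :: complex) = (real_of_int d / pi) powr (- \<epsilon>)"
          using d norm_of_real_powr[of "real_of_int d / pi" "1/2 - ?s"] by simp
        also have "\<dots> = pi powr \<epsilon> * real_of_int d powr (-\<epsilon>)" using d by (simp add: powr_divide powr_minus_divide)
        also have "\<dots> \<le> pi powr \<epsilon> * 1" using d \<epsilon> powr_mono[of "-\<epsilon>" 0 "real_of_int d"] by (intro mult_left_mono) auto
        finally have "norm (of_real (real_of_int d / pi) powr (1/2 - ?s) :: complex) * norm (dual_factor (?s - 1/2)) \<le> pi powr \<epsilon> * 1 * \<bar>M\<bar>"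
          using M[OF seg] by (intro mult_mono) auto
        thus "norm (of_real (real_of_int d / pi) powr (1/2 - ?s) * dual_factor (?s - 1/2)) \<le> M1"
          unfolding norm_mult by (simp add: M1_def mult_ac)
      qed
      thus ?thesis .
    qed
    have NM: "N * M1 \<ge> 0" by (simp add: N_def M1_def)
    have "norm (perron_line ?\<sigma> T (dual_sum F) X) \<le> N * M1 * X powr ?\<sigma> * (2 * arsinh (T / ?\<sigma>))"
      by (rule norm_perron_line_le[OF _ _ _ NM dual_sum_continuous b]) (use \<epsilon> T F in force)+
    also have "\<dots> \<le> N * M1 * X powr (1 + \<epsilon>) * (C3 * T1 powr \<epsilon>)"
    proof (rule mult_mono)
      show "N * M1 * X powr ?\<sigma> \<le> N * M1 * X powr (1 + \<epsilon>)" using T NM by (intro mult_left_mono powr_mono) auto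
      have "C3 * T powr \<epsilon> \<le> C3 * T1 powr \<epsilon>" using T T1 \<epsilon> C3(1) by (intro mult_left_mono powr_mono2) auto
      thus "2 * arsinh (T / ?\<sigma>) \<le> C3 * T1 powr \<epsilon>" using C3(2)[of T] T by simp
      show "0 \<le> 2 * arsinh (T / ?\<sigma>)" using T \<epsilon> by (simp add: less_imp_le)
    qed (use NM in auto)
    finally have p2: "norm (perron_line ?\<sigma> T (dual_sum F) X) \<le> N * (M1 * (C3 * T1 powr \<epsilon>)) * X powr (1 + \<epsilon>)" by (simp add: mult_ac)
    have "norm (\<Sum>d\<in>F. \<Sum>n | real n < X. odd_coeff d n) \<le> N * (2 / \<epsilon> * X powr (1 + \<epsilon>))"
      unfolding N_def by (intro sum_norm_bound a)
    hence "2 * pi * norm (\<Sum>d\<in>F. \<Sum>n | real n < X. odd_coeff d n) \<le> 2 * pi * (N * (2 / \<epsilon> * X powr (1 + \<epsilon>)))"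
      by (intro mult_left_mono) auto
    hence p1: "norm (2 * pi * \<i> * (\<Sum>d\<in>F. \<Sum>n | real n < X. odd_coeff d n)) \<le> N * (2 * pi * (2 / \<epsilon>)) * X powr (1 + \<epsilon>)"
      by (simp add: norm_mult mult_ac)
    have W: "X powr (1 + \<epsilon>) \<le> T1 powr (1 - \<epsilon>) * W"
    proof -
      have "X powr (1 + \<epsilon>) = X powr (1 + \<epsilon>) * (T powr (1 - \<epsilon>) * T powr (-1 + \<epsilon>))"
        using T by (simp add: powr_add[symmetric])
      also have "\<dots> \<le> X powr (1 + \<epsilon>) * (T1 powr (1 - \<epsilon>) * T powr (-1 + \<epsilon>))"
        using T T1 \<epsilon> by (intro mult_left_mono mult_right_mono powr_mono2) auto
      also have "\<dots> \<le> X powr (1 + \<epsilon>) * (T1 powr (1 - \<epsilon>) * T powr (-1 + \<epsilon>)) * D powr \<epsilon>"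
        using mult_left_mono[of 1 "D powr \<epsilon>" "X powr (1 + \<epsilon>) * (T1 powr (1 - \<epsilon>) * T powr (-1 + \<epsilon>))"] D \<epsilon>
        by (simp add: ge_one_powr_ge_zero)
      finally show ?thesis by (simp add: W_def mult_ac)
    qed
    have "norm (2 * pi * \<i> * (\<Sum>d\<in>F. \<Sum>n | real n < X. odd_coeff d n) - perron_line ?\<sigma> T (dual_sum F) X)
       \<le> N * (2 * pi * (2 / \<epsilon>)) * X powr (1 + \<epsilon>) + N * (M1 * (C3 * T1 powr \<epsilon>)) * X powr (1 + \<epsilon>)"
      by (intro order_trans[OF norm_triangle_ineq4] add_mono p1 p2)
    also have "\<dots> = N * (2 * pi * (2 / \<epsilon>) + M1 * (C3 * T1 powr \<epsilon>)) * X powr (1 + \<epsilon>)" by (simp add: algebra_simps)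
    also have "\<dots> \<le> N * (2 * pi * (2 / \<epsilon>) + M1 * (C3 * T1 powr \<epsilon>)) * (T1 powr (1 - \<epsilon>) * W)"
      using \<epsilon> C3(1) by (intro mult_left_mono W) (auto simp: N_def M1_def intro!: mult_nonneg_nonneg add_nonneg_nonneg)
    also have "\<dots> = C * (N * W)" by (simp add: C_def mult_ac)
    finally show "norm (2 * pi * \<i> * (\<Sum>d\<in>discs_between D1 D. \<Sum>n | real n < X. odd_coeff d n)
        - perron_line (1/2 + \<epsilon>) T (dual_sum (discs_between D1 D)) X)
      \<le> C * (card (discs_between D1 D) * (X powr (1 + \<epsilon>) * T powr (-1 + \<epsilon>) * D powr \<epsilon>))"
      unfolding F_def N_def W_def .
  qed
qed

theorem theorem2p4:
  fixes \<epsilon> c \<eta> K K' :: real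
  assumes "ratios_conjecture"
    and "0 < \<epsilon>" "\<epsilon> < 1/4"
    and "0 < c" "0 < \<eta>" "\<eta> \<le> 1/4 - \<epsilon>" "0 < K" "0 < K'"
  shows "\<exists>C>0. \<forall>(X::real) (T::real) (D\<^sub>1::real) (D::real).
    2 < T \<and> T < X \<and> X \<notin> \<int> \<and> 1 < D\<^sub>1 \<and> D\<^sub>1 < D \<and> 1 / ln X < \<epsilon> \<and>
    T \<le> K' * X powr (1 - \<epsilon>) \<and> T \<le> K * D\<^sub>1 powr (1 - \<epsilon>) \<longrightarrow>
    (let F = discs_between D\<^sub>1 D; N = real (card F) in
      norm (
        complex_of_real (1 / N * (\<Sum>d\<in>F. \<Sum>(p, k)\<in>{(p::nat, k::nat). prime p \<and> odd k \<and> real (p ^ k) < X}.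
             real_of_int (kronecker d p) * ln (real p)))
        - (complex_of_real (X powr (1/2)) / (2 * of_real pi * \<i>)
             * contour_integral
                 (linepath (Complex (1/2 + \<epsilon>) (- T)) (Complex (1/2 + \<epsilon>) T))
                 (\<lambda>s. of_real (pi\<^sup>2 / 6) * (Gamma ((1 - s) / 2) / Gamma (s / 2))
                    * (zeta (2 - 2 * s) / zeta (3 - 2 * s))
                    * (1 / of_real N * (\<Sum>d\<in>F. of_real (pi * X / real_of_int d) powr (s - 1/2)))
                    / s)
           + complex_of_real (\<Sum>(p, k)\<in>{(p::nat, k::nat). prime p \<and> 0 < k \<and> even k \<and> real (p ^ k) < X}.
               real (card {d\<in>F. int p dvd d}) / N * ln (real p))))
      \<le> C * (X powr (1/2 + \<epsilon>) * T powr \<epsilon> * ratios_error c K \<eta> \<epsilon> D / N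
             + X powr (1 + \<epsilon>) * T powr (-1 + \<epsilon>) * D powr \<epsilon>))"
proof -
  note rc = assms(1) and \<epsilon> = assms(2,3)
  obtain C1 where C1: "C1 > 0"
    "\<And>X T D1 D. 2 < T \<Longrightarrow> T < X \<Longrightarrow> X \<notin> \<int> \<Longrightarrow> 1 < D1 \<Longrightarrow> D1 < D \<Longrightarrow> T \<le> K * D1 powr (1 - \<epsilon>) \<Longrightarrow> c / ln D1 \<le> \<epsilon> \<Longrightarrow>
      norm (2 * pi * \<i> * (\<Sum>d\<in>discs_between D1 D. \<Sum>n | real n < X. odd_coeff d n)
        - perron_line (1/2 + \<epsilon>) T (dual_sum (discs_between D1 D)) X)
      \<le> C1 * (X powr (1/2 + \<epsilon>) * T powr \<epsilon> * ratios_error c K \<eta> \<epsilon> D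
            + card (discs_between D1 D) * (X powr (1 + \<epsilon>) * T powr (-1 + \<epsilon>) * D powr \<epsilon>))"
    using large_family_bound[OF rc \<epsilon> assms(4-7)] by blast
  \<comment> \<open>If c / ln D1 > \<epsilon>, then D1 < exp (c / \<epsilon>), and the bound on T in
    terms of D1 gives T <= T0.\<close>
  define T0 where "T0 = K * exp (c / \<epsilon>) powr (1 - \<epsilon>)"
  obtain C2 where C2: "C2 > 0"
    "\<And>X T D1 D. 2 < T \<Longrightarrow> T < X \<Longrightarrow> 1 < D1 \<Longrightarrow> D1 < D \<Longrightarrow> T \<le> T0 \<Longrightarrow>
      norm (2 * pi * \<i> * (\<Sum>d\<in>discs_between D1 D. \<Sum>n | real n < X. odd_coeff d n)
        - perron_line (1/2 + \<epsilon>) T (dual_sum (discs_between D1 D)) X)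
      \<le> C2 * (card (discs_between D1 D) * (X powr (1 + \<epsilon>) * T powr (-1 + \<epsilon>) * D powr \<epsilon>))"
    using small_family_bound[OF \<epsilon>, of T0] by blast
  \<comment> \<open>The last summand is for the even powers, from ln X <= X powr \<epsilon> /
    \<epsilon> and ln D <= D powr \<epsilon> / \<epsilon>.\<close>
  define C where "C = C1 + C2 + 2 / \<epsilon>\<^sup>2"
  have Cpos: "C > 0" using C1(1) C2(1) \<epsilon> by (simp add: C_def add_pos_pos)
  show ?thesis
  proof (rule exI[of _ C], intro conjI allI impI, rule Cpos)
    fix X T D1 D :: real
    assume H: "2 < T \<and> T < X \<and> X \<notin> \<int> \<and> 1 < D1 \<and> D1 < D \<and> 1 / ln X < \<epsilon> \<and>
      T \<le> K' * X powr (1 - \<epsilon>) \<and> T \<le> K * D1 powr (1 - \<epsilon>)"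
    hence T: "2 < T" "T < X" and X: "X \<notin> \<int>" and D: "1 < D1" "D1 < D" and TK: "T \<le> K * D1 powr (1 - \<epsilon>)" by auto
    define F where "F = discs_between D1 D"
    define N where "N = real (card F)"
    define R where "R = X powr (1/2 + \<epsilon>) * T powr \<epsilon> * ratios_error c K \<eta> \<epsilon> D"
    define W where "W = X powr (1 + \<epsilon>) * T powr (-1 + \<epsilon>) * D powr \<epsilon>"
    define A where "A = (\<Sum>d\<in>F. \<Sum>(p, k)\<in>{(p::nat, k::nat). prime p \<and> odd k \<and> real (p ^ k) < X}. real_of_int (kronecker d p) * ln (real p))"
    define E where "E = (\<Sum>(p, k)\<in>{(p::nat, k::nat). prime p \<and> 0 < k \<and> even k \<and> real (p ^ k) < X}.
               real (card {d\<in>F. int p dvd d}) / N * ln (real p))"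
    define I where "I = complex_of_real (X powr (1/2)) / (2 * of_real pi * \<i>)
             * contour_integral
                 (linepath (Complex (1/2 + \<epsilon>) (- T)) (Complex (1/2 + \<epsilon>) T))
                 (\<lambda>s. of_real (pi\<^sup>2 / 6) * (Gamma ((1 - s) / 2) / Gamma (s / 2))
                    * (zeta (2 - 2 * s) / zeta (3 - 2 * s))
                    * (1 / of_real N * (\<Sum>d\<in>F. of_real (pi * X / real_of_int d) powr (s - 1/2)))
                    / s)"
    have fin: "finite F" unfolding F_def by (rule finite_discs_between)
    have W0: "W \<ge> 0" by (simp add: W_def)
    have R0: "R \<ge> 0" unfolding R_def
      by (intro mult_nonneg_nonneg norm_ratios_remainder_le(2)[OF rc]) (use assms in auto)
    have "norm (complex_of_real (1 / N * A) - (I + complex_of_real E)) \<le> C * (R / N + W)"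
    proof (cases "F = {}")
      \<comment> \<open>Here N = 0, and every quotient by N is 0: the left side vanishes and the
        bound is C times W.\<close>
      case True
      hence "A = 0" "E = 0" "I = 0" by (simp_all add: A_def E_def I_def)
      thus ?thesis using True Cpos W0 R0 by (simp add: N_def)
    next
      case False
      hence N: "N > 0" using fin by (simp add: N_def card_gt_0_iff)
      define P where "P = perron_line (1/2 + \<epsilon>) T (dual_sum F) X"
      have I: "I = 1 / (2 * pi * \<i> * of_real N) * P" unfolding I_def P_def
        by (rule perron_line_dual_sum) (use \<epsilon> T N D in \<open>auto simp: F_def discs_between_def\<close>)
      have A: "complex_of_real A = (\<Sum>d\<in>F. \<Sum>n | real n < X. odd_coeff d n)"
        by (simp add: A_def sum_odd_coeff)
      have main: "norm (2 * pi * \<i> * of_real A - P) \<le> (C1 + C2) * (R + N * W)"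
      proof (cases "c / ln D1 \<le> \<epsilon>")
        case True
        have "norm (2 * pi * \<i> * of_real A - P) \<le> C1 * (R + N * W)"
          using C1(2)[OF T X D TK True] unfolding A P_def F_def R_def N_def W_def .
        also have "\<dots> \<le> (C1 + C2) * (R + N * W)"
          using C2(1) R0 N W0 by (intro mult_right_mono add_nonneg_nonneg) auto
        finally show ?thesis .
      next
        case False
        have "T \<le> T0"
        proof -
          have "ln D1 < c / \<epsilon>" using False D \<epsilon> by (simp add: field_simps)
          hence "D1 < exp (c / \<epsilon>)" using D by (metis exp_less_cancel_iff exp_ln order_less_trans zero_less_one)
          hence "D1 powr (1 - \<epsilon>) \<le> exp (c / \<epsilon>) powr (1 - \<epsilon>)" using D \<epsilon> by (intro powr_mono2) auto
          hence "K * D1 powr (1 - \<epsilon>) \<le> T0" unfolding T0_def using assms(7) by (intro mult_left_mono) auto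
          thus ?thesis using TK by linarith
        qed
        hence "norm (2 * pi * \<i> * of_real A - P) \<le> C2 * (N * W)"
          using C2(2)[OF T D] unfolding A P_def F_def R_def N_def W_def by blast
        also have "\<dots> \<le> (C1 + C2) * (R + N * W)"
          using C1(1) C2(1) R0 N W0 by (intro mult_mono) auto
        finally show ?thesis .
      qed
      have "complex_of_real (1 / N * A) - I = (2 * pi * \<i> * of_real A - P) / (2 * pi * \<i> * of_real N)"
        unfolding I using N by (simp add: field_simps)
      hence "norm (complex_of_real (1 / N * A) - I) = norm (2 * pi * \<i> * of_real A - P) / (2 * pi * N)"
        using N by (simp add: norm_divide norm_mult)
      also have "\<dots> \<le> (C1 + C2) * (R + N * W) / (1 * N)"
        using main pi_ge_two N C1(1) C2(1) R0 W0
        by (intro frac_le mult_right_mono mult_nonneg_nonneg add_nonneg_nonneg) auto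
      also have "\<dots> = (C1 + C2) * (R / N + W)" using N by (simp add: field_simps)
      finally have p1: "norm (complex_of_real (1 / N * A) - I) \<le> (C1 + C2) * (R / N + W)" .
      have "\<bar>E\<bar> \<le> 2 * ln X * ln D" unfolding E_def N_def F_def by (rule even_sum_bound) (use T D in auto)
      also have "\<dots> \<le> 2 * (X powr \<epsilon> / \<epsilon>) * (D powr \<epsilon> / \<epsilon>)"
        using T D \<epsilon> by (intro mult_mono mult_left_mono ln_powr_bound) auto
      also have "\<dots> = 2 / \<epsilon>\<^sup>2 * (X powr \<epsilon> * D powr \<epsilon>)" by (simp add: power2_eq_square)
      also have "\<dots> \<le> 2 / \<epsilon>\<^sup>2 * W" unfolding W_def
        using error_term_lower_bounds(4)[OF T \<epsilon>(1)] \<epsilon> by (intro mult_left_mono mult_right_mono) auto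
      also have "\<dots> \<le> 2 / \<epsilon>\<^sup>2 * (R / N + W)" using R0 N \<epsilon> by (intro mult_left_mono) auto
      finally have p2: "norm (complex_of_real E) \<le> 2 / \<epsilon>\<^sup>2 * (R / N + W)" by simp
      have "complex_of_real (1 / N * A) - (I + complex_of_real E) = (complex_of_real (1 / N * A) - I) - complex_of_real E" by simp
      also have "norm \<dots> \<le> (C1 + C2) * (R / N + W) + 2 / \<epsilon>\<^sup>2 * (R / N + W)"
        by (intro order_trans[OF norm_triangle_ineq4] add_mono p1 p2)
      also have "\<dots> = C * (R / N + W)" unfolding C_def by (simp only: distrib_right)
      finally show ?thesis .
    qed
    thus "let F = discs_between D1 D; N = real (card F) in
      norm (
        complex_of_real (1 / N * (\<Sum>d\<in>F. \<Sum>(p, k)\<in>{(p::nat, k::nat). prime p \<and> odd k \<and> real (p ^ k) < X}.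
             real_of_int (kronecker d p) * ln (real p)))
        - (complex_of_real (X powr (1/2)) / (2 * of_real pi * \<i>)
             * contour_integral
                 (linepath (Complex (1/2 + \<epsilon>) (- T)) (Complex (1/2 + \<epsilon>) T))
                 (\<lambda>s. of_real (pi\<^sup>2 / 6) * (Gamma ((1 - s) / 2) / Gamma (s / 2))
                    * (zeta (2 - 2 * s) / zeta (3 - 2 * s))
                    * (1 / of_real N * (\<Sum>d\<in>F. of_real (pi * X / real_of_int d) powr (s - 1/2)))
                    / s)
           + complex_of_real (\<Sum>(p, k)\<in>{(p::nat, k::nat). prime p \<and> 0 < k \<and> even k \<and> real (p ^ k) < X}.
               real (card {d\<in>F. int p dvd d}) / N * ln (real p))))
      \<le> C * (X powr (1/2 + \<epsilon>) * T powr \<epsilon> * ratios_error c K \<eta> \<epsilon> D / N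
             + X powr (1 + \<epsilon>) * T powr (-1 + \<epsilon>) * D powr \<epsilon>)"
      unfolding Let_def A_def E_def I_def R_def W_def N_def F_def .
  qed
qed

end
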